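(* For every $n$, $\mathcal{R}_{2,n}$ is the set of permutations of length $n$ belonging to the union of the following twelve families together with the families of inverses of the permutations in families (1)–(9) (families (10)–(12) are closed under inversion), twenty-one families in all. All block sizes $A,B,C,D,E,F$ are integers $\ge1$, subject to the further constraints shown: (1) $24153[\iota_A,1,\iota_C,\iota_D,\iota_E]$, $C,E\ge2$, $(A-1)(C-2)+(D-1)(E-2)=1$; (2) $251643[\iota_A,1,\iota_C,\iota_D,1,1]$, $C\ge2$, $(A-1)(C-2)=0$; (3) $2617354[\iota_A,1,\iota_C,1,\iota_E,1,1]$, $C\ge2$, $(A-1)(C-2)=0$; (4) $352164[\iota_A,1,1,1,\iota_D,\iota_E]$, $E\ge2$, $(D-1)(E-2)=0$; (5) $4621375[1,1,1,1,\iota_C,\iota_D,\iota_E]$, $E\ge2$, $(D-1)(E-2)=0$; (6) $2415763[\iota_A,1,\iota_C,\iota_D,1,1,\iota_2]$, $C\ge2$, $(A-1)(C-2)=0$; (7) $241653[\iota_A,1,\iota_C,1,1,\iota_2]$, $C\ge2$, $(A-1)(C-2)=0$; (8) $3246175[1,1,\iota_B,1,\iota_2,\iota_D,\iota_E]$, $E\ge2$, $(D-1)(E-2)=0$; (9) $325164[1,1,1,\iota_2,\iota_D,\iota_E]$, $E\ge2$, $(D-1)(E-2)=0$; (10) $351624[\iota_A,1,\iota_C,\iota_D,1,\iota_F]$, $(A-1)(C-1)=(D-1)(F-1)=0$; (11) $3517264[\iota_A,1,\iota_C,1,1,\iota_E,1]$, $(A-1)(C-1)=0$; (12) $4261735[1,\iota_B,1,1,\iota_D,1,\iota_F]$,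 $(D-1)(F-1)=0$. Consequently $|\mathcal{R}_{2,n}|=32n-214$ for all $n\ge10$.
   Context: Permutations are written in one-line notation $\pi=\pi_1\cdots\pi_n$, and $\operatorname{inv}(\pi)$ is the number of pairs $i<j$ with $\pi_i>\pi_j$. A permutation avoids $1324$ if there are no indices $i_1<i_2<i_3<i_4$ with $\pi_{i_1}<\pi_{i_3}<\pi_{i_2}<\pi_{i_4}$. $\mathrm{Av}_n^k(1324)$ is the set of $1324$-avoiding permutations of length $n$ with exactly $k$ inversions. A permutation of length $n$ is decomposable if for some $1\le j<n$ its first $j$ entries are exactly $\{1,\dots,j\}$; otherwise it is indecomposable. $\pi\setminus x$ is obtained by deleting the entry $x$ and standardizing. An indecomposable $\pi$ of length $n$ is almost decomposable if at least one of $\pi\setminus 1$, $\pi\setminus n$, $\pi\setminus\pi_1$, $\pi\setminus\pi_n$ (deleting the smallest, largest, first, last entry) is decomposable. The set of residuals at defect $\delta$ is $$\mathcal{R}_{\delta,n}=\{\pi\in\mathrm{Av}_n^{2n-7+\delta}(1324):\ \pi\text{ is indecomposable and not almost decomposable}\}.$$ $\iota_m=12\cdots m$ is the increasing permutation of length $m$ (so $1=\iota_1$), and $\tau[\iota_{b_1},\dots,\iota_{b_t}]$ is the inflation of $\tau=\tau_1\cdots\tau_t$ in which the $i$th entry is replaced by an increasing run of $b_i$ entries occupying consecutive positions and consecutive values, the blocks being in the relative order of $\tau$. *)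

theory Defs
  imports "HOL-Combinatorics.Multiset_Permutations"
begin

text \<open>A permutation of length \<open>n\<close> in one-line notation is an element of
  \<open>permutations_of_set {1..n}\<close>, i.e. a list without repetitions whose set of entries is
  \<open>{1..n}\<close>. Positions in a list are counted from 0, entries from 1.\<close>

definition inversions :: "nat list \<Rightarrow> nat" where
  "inversions \<pi> = card {(i, j). i < j \<and> j < length \<pi> \<and> \<pi> ! i > \<pi> ! j}"

definition avoids_1324 :: "nat list \<Rightarrow> bool" where
  "avoids_1324 \<pi> \<longleftrightarrow>
    \<not> (\<exists>i1 i2 i3 i4. i1 < i2 \<and> i2 < i3 \<and> i3 < i4 \<and> i4 < length \<pi> \<and>
          \<pi> ! i1 < \<pi> ! i3 \<and> \<pi> ! i3 < \<pi> ! i2 \<and> \<pi> ! i2 < \<pi> ! i4)"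

text \<open>The number of inversions is prescribed by an integer because \<open>2 n - 7 + \<delta>\<close> can be
  negative.\<close>

definition Av1324 :: "nat \<Rightarrow> int \<Rightarrow> nat list set" where
  "Av1324 n k =
    {\<pi> \<in> permutations_of_set {1..n}. avoids_1324 \<pi> \<and> int (inversions \<pi>) = k}"

definition decomposable :: "nat list \<Rightarrow> bool" where
  "decomposable \<pi> \<longleftrightarrow> (\<exists>j. 1 \<le> j \<and> j < length \<pi> \<and> set (take j \<pi>) = {1..j})"

abbreviation indecomposable :: "nat list \<Rightarrow> bool" where
  "indecomposable \<pi> \<equiv> \<not> decomposable \<pi>"

definition standardize :: "nat list \<Rightarrow> nat list" where
  "standardize xs = map (\<lambda>x. card {y \<in> set xs. y \<le> x}) xs"

definition delete_entry :: "nat list \<Rightarrow> nat \<Rightarrow> nat list" where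
  "delete_entry \<pi> x = standardize (removeAll x \<pi>)"

definition almost_decomposable :: "nat list \<Rightarrow> bool" where
  "almost_decomposable \<pi> \<longleftrightarrow> indecomposable \<pi> \<and>
    (decomposable (delete_entry \<pi> 1) \<or>
     decomposable (delete_entry \<pi> (length \<pi>)) \<or>
     decomposable (delete_entry \<pi> (hd \<pi>)) \<or>
     decomposable (delete_entry \<pi> (last \<pi>)))"

definition residuals :: "int \<Rightarrow> nat \<Rightarrow> nat list set" where
  "residuals \<delta> n =
    {\<pi> \<in> Av1324 n (2 * int n - 7 + \<delta>). indecomposable \<pi> \<and> \<not> almost_decomposable \<pi>}"

definition perm_inverse :: "nat list \<Rightarrow> nat list" where
  "perm_inverse \<pi> =
    map (\<lambda>v. Suc (THE i. i < length \<pi> \<and> \<pi> ! i = v)) [1..<Suc (length \<pi>)]"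

definition iota :: "nat \<Rightarrow> nat list" where
  "iota m = [1..<Suc m]"

text \<open>In the inflation \<open>\<tau>[\<sigma>\<^sub>1, \<dots>, \<sigma>\<^sub>t]\<close> the \<open>i\<close>th block is shifted by the total length of
  the blocks that replace entries of \<open>\<tau>\<close> smaller than the \<open>i\<close>th one.\<close>

definition inflation :: "nat list \<Rightarrow> nat list list \<Rightarrow> nat list" where
  "inflation \<tau> \<sigma>s =
    concat (map (\<lambda>i. map (\<lambda>x. x + (\<Sum>j | j < length \<tau> \<and> \<tau> ! j < \<tau> ! i. length (\<sigma>s ! j))) (\<sigma>s ! i))
                [0..<length \<tau>])"

abbreviation iota_inflation :: "nat list \<Rightarrow> nat list \<Rightarrow> nat list" where
  "iota_inflation \<tau> bs \<equiv> inflation \<tau> (map iota bs)"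

text \<open>The twelve families. Subtraction on block sizes is truncated on \<open>nat\<close>, but the
  accompanying lower bounds make every difference below exact.\<close>

definition family1 :: "nat list set" where
  "family1 = {iota_inflation [2, 4, 1, 5, 3] [A, 1, C, D, E] | A C D E.
    A \<ge> 1 \<and> C \<ge> 1 \<and> D \<ge> 1 \<and> E \<ge> 1 \<and>
    C \<ge> 2 \<and> E \<ge> 2 \<and> (A - 1) * (C - 2) + (D - 1) * (E - 2) = 1}"

definition family2 :: "nat list set" where
  "family2 = {iota_inflation [2, 5, 1, 6, 4, 3] [A, 1, C, D, 1, 1] | A C D.
    A \<ge> 1 \<and> C \<ge> 1 \<and> D \<ge> 1 \<and>
    C \<ge> 2 \<and> (A - 1) * (C - 2) = 0}"

definition family3 :: "nat list set" where
  "family3 = {iota_inflation [2, 6, 1, 7, 3, 5, 4] [A, 1, C, 1, E, 1, 1] | A C E.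
    A \<ge> 1 \<and> C \<ge> 1 \<and> E \<ge> 1 \<and>
    C \<ge> 2 \<and> (A - 1) * (C - 2) = 0}"

definition family4 :: "nat list set" where
  "family4 = {iota_inflation [3, 5, 2, 1, 6, 4] [A, 1, 1, 1, D, E] | A D E.
    A \<ge> 1 \<and> D \<ge> 1 \<and> E \<ge> 1 \<and>
    E \<ge> 2 \<and> (D - 1) * (E - 2) = 0}"

definition family5 :: "nat list set" where
  "family5 = {iota_inflation [4, 6, 2, 1, 3, 7, 5] [1, 1, 1, 1, C, D, E] | C D E.
    C \<ge> 1 \<and> D \<ge> 1 \<and> E \<ge> 1 \<and>
    E \<ge> 2 \<and> (D - 1) * (E - 2) = 0}"

definition family6 :: "nat list set" where
  "family6 = {iota_inflation [2, 4, 1, 5, 7, 6, 3] [A, 1, C, D, 1, 1, 2] | A C D.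
    A \<ge> 1 \<and> C \<ge> 1 \<and> D \<ge> 1 \<and>
    C \<ge> 2 \<and> (A - 1) * (C - 2) = 0}"

definition family7 :: "nat list set" where
  "family7 = {iota_inflation [2, 4, 1, 6, 5, 3] [A, 1, C, 1, 1, 2] | A C.
    A \<ge> 1 \<and> C \<ge> 1 \<and>
    C \<ge> 2 \<and> (A - 1) * (C - 2) = 0}"

definition family8 :: "nat list set" where
  "family8 = {iota_inflation [3, 2, 4, 6, 1, 7, 5] [1, 1, B, 1, 2, D, E] | B D E.
    B \<ge> 1 \<and> D \<ge> 1 \<and> E \<ge> 1 \<and>
    E \<ge> 2 \<and> (D - 1) * (E - 2) = 0}"

definition family9 :: "nat list set" where
  "family9 = {iota_inflation [3, 2, 5, 1, 6, 4] [1, 1, 1, 2, D, E] | D E.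
    D \<ge> 1 \<and> E \<ge> 1 \<and>
    E \<ge> 2 \<and> (D - 1) * (E - 2) = 0}"

definition family10 :: "nat list set" where
  "family10 = {iota_inflation [3, 5, 1, 6, 2, 4] [A, 1, C, D, 1, F] | A C D F.
    A \<ge> 1 \<and> C \<ge> 1 \<and> D \<ge> 1 \<and> F \<ge> 1 \<and>
    (A - 1) * (C - 1) = 0 \<and> (D - 1) * (F - 1) = 0}"

definition family11 :: "nat list set" where
  "family11 = {iota_inflation [3, 5, 1, 7, 2, 6, 4] [A, 1, C, 1, 1, E, 1] | A C E.
    A \<ge> 1 \<and> C \<ge> 1 \<and> E \<ge> 1 \<and>
    (A - 1) * (C - 1) = 0}"

definition family12 :: "nat list set" where
  "family12 = {iota_inflation [4, 2, 6, 1, 7, 3, 5] [1, B, 1, 1, D, 1, F] | B D F.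
    B \<ge> 1 \<and> D \<ge> 1 \<and> F \<ge> 1 \<and>
    (D - 1) * (F - 1) = 0}"

end

theory Submission
  imports Defs
begin

text \<open>
  A permutation is a set of points with two linear orders, \<open>pos\<close> and \<open>val\<close>. Let \<open>a\<close>, \<open>b\<close> be
  the first and last point and \<open>c\<close>, \<open>d\<close> the lowest and highest one. A residual is a connected
  point set that stays connected when any one of these four points is removed, and it has
  \<open>2 n - 5\<close> inversions.

  The argument is a charging scheme: every non-extremal point pays for two inversions, and the
  number \<open>2 n - 5\<close> leaves room for at most one inversion that is not paid for. If \<open>a\<close> lies above
  \<open>b\<close> or \<open>d\<close> stands before \<open>c\<close>, the extremal points alone nearly suffice as partners; the few
  points that miss one partner have a private inversion, because they would become isolated when
  \<open>a\<close> or \<open>b\<close> is removed. This gives at least \<open>2 n - 4\<close> inversions, which is too many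
  (\<open>first_below_last_and_min_before_max\<close>).

  In the remaining case \<open>c\<close> stands before \<open>d\<close> and \<open>a\<close> lies below \<open>b\<close>. The lines through the four
  extremal points cut the plane into nine cells. Avoidance of 1324 makes whole unions of cells
  increasing and empties the central cell (\<open>centre_empty\<close>), and connectedness forces a point in the
  upper left or in the lower right cell (\<open>LH_or_RL\<close>). The four corner cells are inverted with two
  extremal points, the four edge cells with one; each edge point finds a second inversion
  with a point of another cell. Exactly one inversion is then left over
  (\<open>at_most_one_unchosen\<close>), and following where it can be leaves a handful of pictures in which every
  cell is a single increasing run (\<open>crossing_shapes\<close>). Such a picture is an inflation of a
  permutation of length 5, 6 or 7 by increasing runs; up to exchanging positions with values these
  are the twelve types of the theorem. Counting inversions of an inflation
  (\<open>card_invs_inflates\<close>) turns the prescribed number of inversions into the equations between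
  block sizes.

  Conversely, avoidance, connectedness and its stability under deletion pass from a type to its
  inflations (\<open>avoids_inflates\<close>, \<open>conn_inflates\<close>, \<open>conn_inflates_delete\<close>), so that they need to be
  checked only on the types. None of the types has two adjacent entries \<open>v, v + 1\<close>; hence the
  blocks are the maximal runs of consecutive values, and both the type and the block sizes can be
  read off from an inflation (\<open>iota_inflation_inject\<close>). The cardinality is therefore the number of
  solutions of the equations, summed over the twenty-one types.
\<close>

section \<open>Point sets with two linear orders\<close>

text \<open>
  The orders are given by integer-valued maps so that reflections of the plane are again of this form.
\<close>

definition invs :: "('a \<Rightarrow> int) \<Rightarrow> ('a \<Rightarrow> int) \<Rightarrow> 'a set \<Rightarrow> ('a \<times> 'a) set" where
  "invs pos val X = {(u, w). u \<in> X \<and> w \<in> X \<and> pos u < pos w \<and> val w < val u}"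

text \<open>
  A lower-left closed proper part is exactly a cut of the permutation into a direct sum.
\<close>

definition conn :: "('a \<Rightarrow> int) \<Rightarrow> ('a \<Rightarrow> int) \<Rightarrow> 'a set \<Rightarrow> bool" where
  "conn pos val X \<longleftrightarrow>
    \<not> (\<exists>U. U \<noteq> {} \<and> U \<subset> X \<and> (\<forall>u\<in>U. \<forall>w\<in>X - U. pos u < pos w \<and> val u < val w))"

definition avoids :: "('a \<Rightarrow> int) \<Rightarrow> ('a \<Rightarrow> int) \<Rightarrow> 'a set \<Rightarrow> bool" where
  "avoids pos val X \<longleftrightarrow>
    \<not> (\<exists>x\<in>X. \<exists>y\<in>X. \<exists>z\<in>X. \<exists>t\<in>X. pos x < pos y \<and> pos y < pos z \<and> pos z < pos t \<and>
          val x < val z \<and> val z < val y \<and> val y < val t)"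

definition box :: "'a set \<Rightarrow> ('a \<Rightarrow> int) \<Rightarrow> ('a \<Rightarrow> int) \<Rightarrow> int \<Rightarrow> int \<Rightarrow> int \<Rightarrow> int \<Rightarrow> 'a set" where
  "box S pos val p q v w = {u \<in> S. p < pos u \<and> pos u < q \<and> v < val u \<and> val u < w}"

lemma avoidsD:
  assumes "avoids pos val X" "x \<in> X" "y \<in> X" "z \<in> X" "t \<in> X"
    "pos x < pos y" "pos y < pos z" "pos z < pos t" "val x < val z" "val z < val y" "val y < val t"
  shows False
  using assms unfolding avoids_def by blast

lemma conn_cut:
  assumes "conn pos val X" "U \<subseteq> X" "u0 \<in> U" "w0 \<in> X" "w0 \<notin> U"
  obtains u w where "u \<in> U" "w \<in> X" "w \<notin> U" "\<not> (pos u < pos w \<and> val u < val w)"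
  using assms unfolding conn_def by blast

text \<open>
  A point without inversions could be split off together with everything to its left.
\<close>

lemma conn_neighbour:
  assumes conn: "conn pos val X" and u: "u \<in> X" and w0: "w0 \<in> X" "w0 \<noteq> u"
    and inj: "inj_on pos X" "inj_on val X"
  obtains w where "w \<in> X" "(u, w) \<in> invs pos val X \<or> (w, u) \<in> invs pos val X"
proof -
  have ne: "pos w \<noteq> pos u" "val w \<noteq> val u" if "w \<in> X" "w \<noteq> u" for w
    using that u inj by (auto dest: inj_onD)
  have "\<exists>w\<in>X. (u, w) \<in> invs pos val X \<or> (w, u) \<in> invs pos val X"
  proof (rule ccontr)
    assume no: "\<not> ?thesis"
    have below: "val w < val u" if "w \<in> X" "pos w < pos u" for w
      using no that u ne[of w] by (force simp: invs_def)
    have above: "val u < val w" if "w \<in> X" "pos u < pos w" for w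
      using no that u ne[of w] by (force simp: invs_def)
    show False
    proof (cases "\<exists>w\<in>X. pos w < pos u")
      case True
      then obtain w1 where w1: "w1 \<in> X" "pos w1 < pos u" by auto
      let ?U = "{w \<in> X. pos w < pos u}"
      obtain x y where xy: "x \<in> ?U" "y \<in> X" "y \<notin> ?U" "\<not> (pos x < pos y \<and> val x < val y)"
        using conn_cut[OF conn, of ?U w1 u] w1 u by blast
      show False using xy below[of x] above[of y] ne[of y] by (cases "y = u") force+
    next
      case False
      obtain x y where xy: "x \<in> {u}" "y \<in> X" "y \<notin> {u}" "\<not> (pos x < pos y \<and> val x < val y)"
        using conn_cut[OF conn, of "{u}" u w0] w0 u by blast
      show False using xy False above[of y] ne[of y] by force
    qed
  qed
  then show thesis using that by blast
qed

lemma finite_invs: "finite X \<Longrightarrow> finite (invs pos val X)"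
  by (rule finite_subset[of _ "X \<times> X"]) (auto simp: invs_def)

lemma at_most_one_extra:
  assumes "finite I" "B \<subseteq> I" "card I \<le> card B + 1" "e \<in> I - B" "e' \<in> I - B"
  shows "e = e'"
proof -
  have "card (I - B) \<le> 1" using assms(1-3) by (simp add: card_Diff_subset finite_subset)
  then show ?thesis using assms(1,4,5) card_le_Suc0_iff_eq[of "I - B"] by auto
qed

text \<open>
  The setting is invariant under exchanging the two orders (inversion of the permutation) and
  under reflection in the antidiagonal, which swaps \<open>a\<close> with \<open>d\<close> and \<open>b\<close> with \<open>c\<close>. These two symmetries
  cut the number of cases to a quarter.
\<close>

locale extremal_points =
  fixes S :: "'a set" and pos val :: "'a \<Rightarrow> int" and a b c d :: 'a
  assumes fin: "finite S" and inj_pos: "inj_on pos S" and inj_val: "inj_on val S"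
    and ex_in: "a \<in> S" "b \<in> S" "c \<in> S" "d \<in> S"
    and a_min: "\<And>u. u \<in> S \<Longrightarrow> pos a \<le> pos u" and b_max: "\<And>u. u \<in> S \<Longrightarrow> pos u \<le> pos b"
    and c_min: "\<And>u. u \<in> S \<Longrightarrow> val c \<le> val u" and d_max: "\<And>u. u \<in> S \<Longrightarrow> val u \<le> val d"
    and avoid: "avoids pos val S"
    and conn: "conn pos val S" and conn_a: "conn pos val (S - {a})" and conn_b: "conn pos val (S - {b})"
    and conn_c: "conn pos val (S - {c})" and conn_d: "conn pos val (S - {d})"
    and card2: "2 \<le> card S"
begin

abbreviation "Inv \<equiv> invs pos val S"

lemma swap: "extremal_points S val pos c d a b"
proof -
  have cn: "conn val pos X = conn pos val X" for X by (simp only: conn_def conj_commute)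
  have av: "avoids val pos S" using avoid unfolding avoids_def by blast
  show ?thesis
    by unfold_locales (use fin inj_pos inj_val ex_in a_min b_max c_min d_max av card2
        conn conn_a conn_b conn_c conn_d in \<open>auto simp: cn\<close>)
qed

lemma antiflip: "extremal_points S (\<lambda>u. - val u) (\<lambda>u. - pos u) d c b a"
proof -
  have cn: "conn (\<lambda>u. - val u) (\<lambda>u. - pos u) X" if cX: "conn pos val X" for X
    unfolding conn_def
  proof (rule notI, elim exE conjE)
    fix U assume U: "U \<noteq> {}" "U \<subset> X" "\<forall>u\<in>U. \<forall>w\<in>X - U. - val u < - val w \<and> - pos u < - pos w"
    obtain u0 w0 where "u0 \<in> X - U" "w0 \<in> X" "w0 \<in> U" using U by blast
    then obtain x y where "x \<in> X - U" "y \<in> X" "y \<notin> X - U" "\<not> (pos x < pos y \<and> val x < val y)"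
      using conn_cut[OF cX, of "X - U" u0 w0] by blast
    then show False using U(3) by force
  qed
  have av: "avoids (\<lambda>u. - val u) (\<lambda>u. - pos u) S" 
    unfolding avoids_def
  proof clarify
    fix x y z t assume "x \<in> S" "y \<in> S" "z \<in> S" "t \<in> S" "- val x < - val y" "- val y < - val z"
      "- val z < - val t" "- pos x < - pos z" "- pos z < - pos y" "- pos y < - pos t"
    then show False
      using avoidsD[OF avoid, of t y z x] by simp
  qed
  show ?thesis
    by unfold_locales (use fin inj_pos inj_val ex_in a_min b_max c_min d_max av card2
        conn conn_a conn_b conn_c conn_d in \<open>auto simp: cn inj_on_def\<close>)
qed

lemma fin_Inv: "finite Inv" by (rule finite_invs[OF fin])

lemma pos_eq: "u \<in> S \<Longrightarrow> w \<in> S \<Longrightarrow> pos u = pos w \<longleftrightarrow> u = w"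
  using inj_pos by (auto dest: inj_onD)
lemma val_eq: "u \<in> S \<Longrightarrow> w \<in> S \<Longrightarrow> val u = val w \<longleftrightarrow> u = w"
  using inj_val by (auto dest: inj_onD)

lemma no_1324:
  assumes "x \<in> S" "y \<in> S" "z \<in> S" "t \<in> S" "pos x < pos y" "pos y < pos z" "pos z < pos t"
    "val x < val z" "val z < val y" "val y < val t"
  shows False
  using assms avoid unfolding avoids_def by blast

lemma a_less: "u \<in> S \<Longrightarrow> u \<noteq> a \<Longrightarrow> pos a < pos u" using a_min[of u] pos_eq[of u a] ex_in by force
lemma b_greater: "u \<in> S \<Longrightarrow> u \<noteq> b \<Longrightarrow> pos u < pos b" using b_max[of u] pos_eq[of u b] ex_in by force
lemma c_less: "u \<in> S \<Longrightarrow> u \<noteq> c \<Longrightarrow> val c < val u" using c_min[of u] val_eq[of u c] ex_in by force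
lemma d_greater: "u \<in> S \<Longrightarrow> u \<noteq> d \<Longrightarrow> val u < val d" using d_max[of u] val_eq[of u d] ex_in by force

lemma exists_other_point: "\<exists>w\<in>S. w \<noteq> u"
proof (rule ccontr)
  assume "\<not> ?thesis"
  then have "S \<subseteq> {u}" by auto
  then have "card S \<le> card {u}" by (intro card_mono) auto
  then show False using card2 by simp
qed

lemma ac: "a \<noteq> c"
proof
  assume "a = c"
  obtain w0 where w0: "w0 \<in> S" "w0 \<noteq> a" using exists_other_point by blast
  obtain x y where "x \<in> {a}" "y \<in> S" "y \<notin> {a}" "\<not> (pos x < pos y \<and> val x < val y)"
    by (rule conn_cut[OF conn, of "{a}" a w0]) (use w0 ex_in in auto)
  then show False using a_less c_less \<open>a = c\<close> by auto
qed

lemma db: "d \<noteq> b"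
proof
  assume "d = b"
  obtain w0 where w0: "w0 \<in> S" "w0 \<noteq> b" using exists_other_point by blast
  obtain x y where "x \<in> S - {b}" "y \<in> S" "y \<notin> S - {b}" "\<not> (pos x < pos y \<and> val x < val y)"
    by (rule conn_cut[OF conn, of "S - {b}" w0 b]) (use w0 ex_in in auto)
  then show False using b_greater d_greater \<open>d = b\<close> by auto
qed

text \<open>
  In each of the following four lemmas an inversion of two points would be completed to a 1324
  pattern by the two extremal points named.
\<close>

lemma increasing_between_a_d:
  assumes "u \<in> S" "w \<in> S" "pos u < pos w" "pos w < pos d" "val a < val u" "val a < val w"
  shows "val u < val w"
proof (rule ccontr)
  assume "\<not> ?thesis"
  then have "val w < val u" using assms val_eq[of u w] by force
  moreover have "u \<noteq> a" "u \<noteq> d" using assms by auto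
  ultimately show False
    using no_1324[of a u w d] ex_in assms a_less[of u] d_greater[of u] by auto
qed

lemma increasing_between_c_b:
  assumes "u \<in> S" "w \<in> S" "pos u < pos w" "pos c < pos u" "val u < val b" "val w < val b"
  shows "val u < val w"
proof (rule ccontr)
  assume "\<not> ?thesis"
  then have "val w < val u" using assms val_eq[of u w] by force
  moreover have "w \<noteq> b" "w \<noteq> c" using assms by auto
  ultimately show False
    using no_1324[of c u w b] ex_in assms b_greater[of w] c_less[of w] by auto
qed

lemma increasing_between_c_d:
  assumes "u \<in> S" "w \<in> S" "pos u < pos w" "pos c < pos u" "pos w < pos d"
  shows "val u < val w"
proof (rule ccontr)
  assume "\<not> ?thesis"
  then have "val w < val u" using assms val_eq[of u w] by force
  moreover have "w \<noteq> c" "u \<noteq> d" using assms by auto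
  ultimately show False
    using no_1324[of c u w d] ex_in assms d_greater[of u] c_less[of w] by auto
qed

lemma increasing_between_a_b:
  assumes "u \<in> S" "w \<in> S" "pos u < pos w" "val a < val u" "val a < val w" "val u < val b" "val w < val b"
  shows "val u < val w"
proof (rule ccontr)
  assume "\<not> ?thesis"
  then have "val w < val u" using assms val_eq[of u w] by force
  moreover have "w \<noteq> b" "u \<noteq> a" using assms by auto
  ultimately show False
    using no_1324[of a u w b] ex_in assms a_less[of u] b_greater[of w] by auto
qed

section \<open>Configurations with too many inversions\<close>

text \<open>
  The general form of the charging scheme: two private inversions for each point outside \<open>X\<close>,
  and the inversions in \<open>E\<close> on top.
\<close>

lemma two_charges:
  fixes e1 e2 :: "'a \<Rightarrow> 'a \<times> 'a"
  assumes X: "X \<subseteq> S" and inj: "inj_on e1 (S - X)" "inj_on e2 (S - X)"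
    and ne: "\<And>u w. u \<in> S - X \<Longrightarrow> w \<in> S - X \<Longrightarrow> e1 u \<noteq> e2 w"
    and charge: "\<And>u. u \<in> S - X \<Longrightarrow> e1 u \<in> Inv - E \<and> e2 u \<in> Inv - E" and E: "E \<subseteq> Inv"
  shows "2 * card S + card E \<le> card Inv + 2 * card X"
proof -
  have finX: "finite X" and finE: "finite E" using X E fin fin_Inv finite_subset by blast+
  have "card (e1 ` (S - X) \<union> e2 ` (S - X) \<union> E) = card (e1 ` (S - X) \<union> e2 ` (S - X)) + card E"
    using fin finE charge by (intro card_Un_disjoint) blast+
  also have "card (e1 ` (S - X) \<union> e2 ` (S - X)) = card (S - X) + card (S - X)"
    using fin ne by (subst card_Un_disjoint) (simp, simp, blast, simp add: card_image inj)
  finally have "card (e1 ` (S - X) \<union> e2 ` (S - X) \<union> E) = 2 * card (S - X) + card E" by simp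
  moreover have "e1 ` (S - X) \<union> e2 ` (S - X) \<union> E \<subseteq> Inv" using charge E by blast
  ultimately have "2 * card (S - X) + card E \<le> card Inv" using card_mono[OF fin_Inv] by metis
  then show ?thesis using card_Diff_subset[OF finX X] card_mono[OF fin X] by linarith
qed

text \<open>
  Here every other point is inverted with \<open>a\<close> or \<open>b\<close> and with \<open>c\<close> or \<open>d\<close>.
\<close>

lemma inversions_if_max_before_min:
  assumes "val b < val a" "pos d < pos c" "a \<noteq> d" "b \<noteq> c"
  shows "2 * card S \<le> card Inv + 4"
proof -
  let ?X = "{a, b, c, d}"
  let ?I = "S - ?X"
  define e1 where "e1 u = (if val u < val a then (a, u) else (u, b))" for u
  define e2 where "e2 u = (if pos u < pos c then (u, c) else (d, u))" for u
  let ?E = "{(a, c), (a, b), (d, c), (d, b)}"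
  have neq: "a \<noteq> b" "a \<noteq> c" "c \<noteq> d" "b \<noteq> d" using assms ac db by auto
  have "2 * card S + card ?E \<le> card Inv + 2 * card ?X"
  proof (rule two_charges[of _ e1 e2])
    show "inj_on e1 ?I" "inj_on e2 ?I"
      by (auto simp: inj_on_def e1_def e2_def split: if_splits)
    show "e1 u \<noteq> e2 w" if "u \<in> ?I" "w \<in> ?I" for u w
      using that assms by (auto simp: e1_def e2_def split: if_splits)
    show "e1 u \<in> Inv - ?E \<and> e2 u \<in> Inv - ?E" if "u \<in> ?I" for u
    proof -
      have "u \<in> S" "u \<noteq> a" "u \<noteq> b" "u \<noteq> c" "u \<noteq> d" using that by auto
      then show ?thesis
        using assms ex_in a_less[of u] b_greater[of u] c_less[of u] d_greater[of u] pos_eq[of u c]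
        by (auto simp: e1_def e2_def invs_def)
    qed
    show "?E \<subseteq> Inv"
      using neq assms ex_in a_less[of b] a_less[of c] b_greater[of d] c_less[of a] c_less[of d]
          d_greater[of b]
      by (auto simp: invs_def)
  qed (use ex_in in simp)
  moreover have "card ?E = 4" "card ?X = 4" using neq assms by auto
  ultimately show ?thesis by linarith
qed

text \<open>
  If \<open>a = d\<close>, then all points are inverted with \<open>a\<close>. The second charge is an inversion with \<open>b\<close> or
  \<open>c\<close>; the points right of \<open>c\<close> and below \<open>b\<close> have none, but they form an increasing sequence and
  must not become isolated when \<open>a\<close> is removed, so each has a neighbour outside that sequence.
\<close>

lemma inversions_if_first_is_maximal:
  assumes ad: "a = d"
  shows "2 * card S \<le> card Inv + 4"
proof (cases "b = c")
  case True
  let ?I = "S - {a, b}"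
  have neq: "a \<noteq> b" using ac True by auto
  have "2 * card S + card {(a, b)} \<le> card Inv + 2 * card {a, b}"
  proof (rule two_charges[of _ "Pair a" "\<lambda>u. (u, b)"])
    show "(a, u) \<in> Inv - {(a, b)} \<and> (u, b) \<in> Inv - {(a, b)}" if "u \<in> ?I" for u
      using that ex_in True ad a_less[of u] b_greater[of u] c_less[of u] d_greater[of u]
          by (auto simp: invs_def)
    show "{(a, b)} \<subseteq> Inv" using neq ex_in a_less[of b] d_greater[of b] ad by (auto simp: invs_def)
  qed (use ex_in in \<open>auto simp: inj_on_def\<close>)
  then show ?thesis using neq by simp
next
  case bc: False
  let ?I = "S - {a, b, c}"
  have neq: "a \<noteq> b" "a \<noteq> c" using ac db ad by auto
  define Z where "Z = {u \<in> ?I. val u < val b \<and> pos c < pos u}"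
  have "\<exists>w. w \<in> ?I - Z \<and> ((u, w) \<in> Inv \<or> (w, u) \<in> Inv)" if u: "u \<in> Z" for u
  proof -
    have uS: "u \<in> S" "u \<noteq> a" "u \<noteq> b" "u \<noteq> c" "val u < val b" "pos c < pos u" using u by (auto simp: Z_def)
    have inj: "inj_on pos (S - {a})" "inj_on val (S - {a})" using inj_pos inj_val by (auto simp: inj_on_def)
    obtain w where w: "w \<in> S - {a}" "(u, w) \<in> invs pos val (S - {a}) \<or> (w, u) \<in> invs pos val (S - {a})"
      by (rule conn_neighbour[OF conn_a, of u b]) (use uS ex_in neq inj in auto)
    have "w \<noteq> b" "w \<noteq> c" using w uS b_greater[of u] c_less[of u] by (auto simp: invs_def)
    moreover have "w \<notin> Z"
      using w uS increasing_between_c_b[of u w] increasing_between_c_b[of w u]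
          by (auto simp: invs_def Z_def)
    ultimately show ?thesis using w by (auto simp: invs_def)
  qed
  then obtain g where g: "\<And>u. u \<in> Z \<Longrightarrow> g u \<in> ?I - Z \<and> ((u, g u) \<in> Inv \<or> (g u, u) \<in> Inv)" by metis
  define e2 where "e2 u = (if u \<in> Z then (if (u, g u) \<in> Inv then (u, g u) else (g u, u))
      else if val b < val u then (u, b) else (u, c))" for u
  let ?E = "{(a, b), (a, c)}"
  have "2 * card S + card ?E \<le> card Inv + 2 * card {a, b, c}"
  proof (rule two_charges[of _ "Pair a" e2])
    show "inj_on (Pair a) ?I" by (simp add: inj_on_def)
    show "inj_on e2 ?I"
    proof (rule inj_onI)
      fix x y assume "x \<in> ?I" "y \<in> ?I" "e2 x = e2 y"
      then show "x = y" using g[of x] g[of y] bc by (auto simp: e2_def split: if_splits)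
    qed
    have fst_e2: "fst (e2 u) \<noteq> a" if "u \<in> ?I" for u
      using that g[of u] by (auto simp: e2_def)
    then show "(a, u) \<noteq> e2 w" if "w \<in> ?I" for u w using that by (metis fst_conv)
    show "?E \<subseteq> Inv"
      using neq ex_in a_less[of b] d_greater[of b] a_less[of c] d_greater[of c] ad by (auto simp: invs_def)
    show "(a, u) \<in> Inv - ?E \<and> e2 u \<in> Inv - ?E" if u: "u \<in> ?I" for u
    proof -
      have uS: "u \<in> S" "u \<noteq> a" "u \<noteq> b" "u \<noteq> c" using u by auto
      have "(a, u) \<in> Inv" using uS ex_in ad a_less[of u] d_greater[of u] by (auto simp: invs_def)
      moreover have "e2 u \<in> Inv"
      proof (cases "u \<in> Z")
        case True then show ?thesis using g[of u] by (auto simp: e2_def)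
      next
        case False
        then have "val b < val u \<or> pos u < pos c" using uS val_eq[of u b] pos_eq[of u c] ex_in
            by (force simp: Z_def)
        then show ?thesis using uS ex_in False b_greater[of u] c_less[of u] by (auto simp: invs_def e2_def)
      qed
      ultimately show ?thesis using fst_e2[OF u] uS by auto
    qed
  qed (use ex_in in simp)
  then show ?thesis using neq bc by simp
qed

text \<open>
  The extremal points provide two charges for all points except those between \<open>c\<close> and \<open>d\<close> that lie
  below \<open>b\<close> or above \<open>a\<close>. A low one would be isolated after deleting \<open>a\<close>, hence is inverted with a
  point left of \<open>c\<close>; a high one, by deleting \<open>b\<close>, with a point right of \<open>d\<close>. This accounts for
  \<open>2 n - 5\<close> inversions. One more is found from the connectedness after deleting \<open>a\<close> and after
  deleting \<open>b\<close>: it either is directly an inversion between the left and the right part (or with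
  \<open>b\<close>), or it yields a left point above \<open>a\<close> and a right point below \<open>b\<close>, which are inverted.
\<close>

lemma inversions_if_first_above_last_and_min_before_max:
  assumes ba: "val b < val a" and cd: "pos c < pos d"
  shows "2 * card S \<le> card Inv + 4"
proof -
  let ?X = "{a, b, c, d}"
  let ?I = "S - ?X"
  have neq: "a \<noteq> b" "a \<noteq> c" "a \<noteq> d" "b \<noteq> c" "b \<noteq> d" "c \<noteq> d"
    using assms ac db a_min[of c] b_max[of d] ex_in by auto
  have order: "pos a < pos c" "pos d < pos b" "val c < val b" "val a < val d"
    using neq ex_in a_less[of c] b_greater[of d] c_less[of b] d_greater[of a] by auto
  have I: "u \<in> S" "u \<noteq> a" "u \<noteq> b" "u \<noteq> c" "u \<noteq> d" "pos a < pos u" "pos u < pos b" "val c < val u"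
      "val u < val d"
      "pos u \<noteq> pos c" "pos u \<noteq> pos d" "val u \<noteq> val a" "val u \<noteq> val b"
    if "u \<in> ?I" for u
    using that ex_in a_less[of u] b_greater[of u] c_less[of u] d_greater[of u] by (auto simp: pos_eq val_eq)
  define low where "low = {u \<in> ?I. pos c < pos u \<and> pos u < pos d \<and> val u < val b}"
  define high where "high = {u \<in> ?I. pos c < pos u \<and> pos u < pos d \<and> val a < val u}"
  have "\<exists>w\<in>?I. pos w < pos c \<and> (w, u) \<in> Inv" if u: "u \<in> low" for u
  proof -
    have uI: "u \<in> ?I" and u': "pos c < pos u" "pos u < pos d" "val u < val b" using u
        by (auto simp: low_def)
    have inj: "inj_on pos (S - {a})" "inj_on val (S - {a})" using inj_pos inj_val by (auto simp: inj_on_def)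
    obtain w where w: "w \<in> S - {a}" "(u, w) \<in> invs pos val (S - {a}) \<or> (w, u) \<in> invs pos val (S - {a})"
      by (rule conn_neighbour[OF conn_a, of u b]) (use I[OF uI] ex_in neq inj in auto)
    have "\<not> (u, w) \<in> Inv"
      using increasing_between_c_b[of u w] u' I[OF uI] by (auto simp: invs_def)
    moreover have wu: "(w, u) \<in> Inv" using calculation w by (auto simp: invs_def)
    moreover have "pos w < pos c"
      using wu increasing_between_c_d[of w u] u' pos_eq[of w c] c_less[of u] I[OF uI] ex_in
      by (auto simp: invs_def) (meson linorder_neqE_linordered_idom order.asym)
    ultimately show ?thesis using w u' neq order b_max by (auto simp: invs_def)
  qed
  then obtain g where g: "\<And>u. u \<in> low \<Longrightarrow> g u \<in> ?I \<and> pos (g u) < pos c \<and> (g u, u) \<in> Inv" by metis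
  have "\<exists>w\<in>?I. pos d < pos w \<and> (u, w) \<in> Inv" if u: "u \<in> high" for u
  proof -
    have uI: "u \<in> ?I" and u': "pos c < pos u" "pos u < pos d" "val a < val u" using u
        by (auto simp: high_def)
    have inj: "inj_on pos (S - {b})" "inj_on val (S - {b})" using inj_pos inj_val by (auto simp: inj_on_def)
    obtain w where w: "w \<in> S - {b}" "(u, w) \<in> invs pos val (S - {b}) \<or> (w, u) \<in> invs pos val (S - {b})"
      by (rule conn_neighbour[OF conn_b, of u a]) (use I[OF uI] ex_in neq inj in auto)
    have "\<not> (w, u) \<in> Inv"
      using increasing_between_a_d[of w u] u' I[OF uI] by (auto simp: invs_def)
    moreover have uw: "(u, w) \<in> Inv" using calculation w by (auto simp: invs_def)
    moreover have "pos d < pos w"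
      using uw increasing_between_c_d[of u w] u' pos_eq[of w d] d_greater[of u] I[OF uI] ex_in
      by (auto simp: invs_def) (meson linorder_neqE_linordered_idom order.asym)
    ultimately show ?thesis using w u' neq order a_min by (auto simp: invs_def)
  qed
  then obtain g' where g': "\<And>u. u \<in> high \<Longrightarrow> g' u \<in> ?I \<and> pos d < pos (g' u) \<and> (u, g' u) \<in> Inv" by metis
  define e1 where "e1 u = (if val u < val a then (a, u) else (u, b))" for u
  define e2 where "e2 u = (if pos u < pos c then (u, c) else if pos d < pos u then (d, u)
      else if u \<in> low then (g u, u) else if u \<in> high then (u, g' u) else (u, b))" for u
  \<comment> \<open>the inversions that can serve as the additional one, none of them being a charge\<close>
  define extra where "extra e \<longleftrightarrow> (\<exists>u w. e = (u, w) \<and> e \<in> Inv \<and>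
      (u \<in> ?I \<and> w \<in> ?I \<and> pos u < pos c \<and> pos d < pos w \<or>
       u \<in> ?I \<and> w = b \<and> val b < val u \<and> val u < val a \<and> (pos u < pos c \<or> pos d < pos u)))" for e
  have right: "\<exists>w\<in>?I. pos d < pos w \<and> val w < val b" if no: "\<nexists>e. extra e"
  proof -
    let ?U = "{u \<in> S - {b}. pos u < pos d \<and> (pos u \<le> pos c \<or> val u \<le> val a)}"
    obtain u w where uw: "u \<in> ?U" "w \<in> S - {b}" "w \<notin> ?U" "\<not> (pos u < pos w \<and> val u < val w)"
      by (rule conn_cut[OF conn_b, of ?U a d]) (use neq ex_in order cd in auto)
    show ?thesis
    proof (rule ccontr)
      assume none: "\<not> ?thesis"
      have ud: "u \<noteq> d" using uw by auto
      have "w \<noteq> a" "w \<noteq> c" using uw order cd by auto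
      have wd: "w \<noteq> d" using uw ud d_greater[of u] by auto
      have wI: "w \<in> ?I" using uw \<open>w \<noteq> a\<close> \<open>w \<noteq> c\<close> wd by auto
      have uc: "u \<noteq> c" using uw I[OF wI] order cd by auto
      show False
      proof (cases "pos d < pos w")
        case True
        then have vb: "val b < val w" using none I[OF wI] wI by force
        have uw': "val w < val u" "pos u < pos w" using uw True val_eq[of u w] by auto
        have "val a < val w"
        proof (rule ccontr)
          assume "\<not> ?thesis"
          then have "extra (w, b)" unfolding extra_def using vb I[OF wI] wI ex_in True
              by (auto simp: invs_def)
          then show False using no by blast
        qed
        then have "u \<in> ?I" "pos u < pos c" using uw uw' ud uc pos_eq[of u c] ex_in by auto
        then have "extra (u, w)" unfolding extra_def using uw' wI True by (auto simp: invs_def)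
        then show False using no by blast
      next
        case False
        then have w': "pos w < pos d" "pos c < pos w" "val a < val w" using uw I[OF wI] by auto
        show False
        proof (cases "pos u < pos w")
          case True
          then have "val w < val u" using uw val_eq[of u w] by auto
          then show False using increasing_between_a_d[of u w] True w' uw by auto
        next
          case False
          then have "pos w < pos u" using uw pos_eq[of u w] by force
          then show False using increasing_between_c_d[of w u] w' uw by auto
        qed
      qed
    qed
  qed
  have left: "\<exists>u\<in>?I. pos u < pos c \<and> val a < val u" if no: "\<nexists>e. extra e"
  proof -
    let ?U = "{u \<in> S - {a}. pos u \<le> pos c \<or> (pos u < pos d \<and> val u < val b)}"
    obtain u w where uw: "u \<in> ?U" "w \<in> S - {a}" "w \<notin> ?U" "\<not> (pos u < pos w \<and> val u < val w)"
      by (rule conn_cut[OF conn_a, of ?U c d]) (use neq ex_in order cd in auto)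
    show ?thesis
    proof (rule ccontr)
      assume none: "\<not> ?thesis"
      have "u \<noteq> b" "u \<noteq> d" using uw order cd by auto
      have wc: "w \<noteq> c" using uw by auto
      have uc: "u \<noteq> c" using uw wc c_less[of w] by auto
      have uI: "u \<in> ?I" using uw \<open>u \<noteq> b\<close> \<open>u \<noteq> d\<close> uc by auto
      have wd: "w \<noteq> d" using uw I[OF uI] cd order by auto
      show False
      proof (cases "pos u < pos c")
        case True
        then have va: "val u < val a" using none I[OF uI] uI by force
        have uw': "val w < val u" "pos u < pos w" using uw True val_eq[of u w] by auto
        have "val u < val b"
        proof (rule ccontr)
          assume "\<not> ?thesis"
          then have "extra (u, b)" unfolding extra_def using va I[OF uI] uI ex_in True
              by (auto simp: invs_def)
          then show False using no by blast
        qed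
        then have "w \<in> ?I" "pos d < pos w" using uw uw' wd wc pos_eq[of w d] ex_in by auto
        then have "extra (u, w)" unfolding extra_def using uw' uI True by (auto simp: invs_def)
        then show False using no by blast
      next
        case False
        then have u': "pos u < pos d" "pos c < pos u" "val u < val b" using uw I[OF uI] by auto
        show False
        proof (cases "pos u < pos w")
          case True
          then have "val w < val u" using uw val_eq[of u w] by auto
          then show False using increasing_between_c_b[of u w] True u' uw by auto
        next
          case False
          then have "pos w < pos u" using uw pos_eq[of u w] by force
          then show False using u' uw increasing_between_c_d[of w u] by auto
        qed
      qed
    qed
  qed
  have "\<exists>e. extra e"
  proof (rule ccontr)
    assume no: "\<nexists>e. extra e"
    obtain u where u: "u \<in> ?I" "pos u < pos c" "val a < val u" using left[OF no] by blast
    obtain w where w: "w \<in> ?I" "pos d < pos w" "val w < val b" using right[OF no] by blast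
    have "extra (u, w)" unfolding extra_def using u w ba cd by (auto simp: invs_def)
    then show False using no by blast
  qed
  then obtain e where e: "extra e" by blast
  let ?E = "{(a, c), (a, b), (d, b), e}"
  have lowhigh: "low \<inter> high = {}" using ba by (auto simp: low_def high_def)
  have low_I: "low \<subseteq> ?I" "high \<subseteq> ?I" by (auto simp: low_def high_def)
  have inj1: "inj_on e1 ?I" by (auto simp: inj_on_def e1_def split: if_splits)
  have e2_cases: "e2 u = (u, c) \<or> e2 u = (d, u) \<or> e2 u = (u, b) \<or>
      (e2 u = (g u, u) \<and> g u \<in> ?I \<and> pos (g u) < pos c \<and> pos c < pos u \<and> pos u < pos d) \<or>
      (e2 u = (u, g' u) \<and> g' u \<in> ?I \<and> pos d < pos (g' u) \<and> pos c < pos u \<and> pos u < pos d)"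
    if "u \<in> ?I" for u
    using g[of u] g'[of u] by (auto simp: e2_def low_def high_def)
  have inj2: "inj_on e2 ?I"
  proof (rule inj_onI)
    fix x y assume x: "x \<in> ?I" and y: "y \<in> ?I" and "e2 x = e2 y"
    then show "x = y" using e2_cases[OF x] e2_cases[OF y] by (elim disjE) auto
  qed
  have e1_e2: "e1 u \<noteq> e2 w" if u: "u \<in> ?I" and w: "w \<in> ?I" for u w
  proof (cases "e2 w = (w, b)")
    case True
    then have "val w < val a" using I[OF w] w g'[of w] neq
        by (auto simp: e2_def low_def high_def split: if_splits)
    then show ?thesis using True u by (auto simp: e1_def)
  next
    case False
    then show ?thesis using e2_cases[OF w] u w neq by (auto simp: e1_def)
  qed
  have e1_E: "e1 u \<notin> ?E" if u: "u \<in> ?I" for u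
    using I[OF u] e neq by (auto simp: e1_def extra_def split: if_splits)
  have e2_E: "e2 u \<notin> ?E" if u: "u \<in> ?I" for u
  proof -
    have "e2 u \<noteq> e"
    proof (cases "e2 u = (u, b)")
      case True
      then have "\<not> (pos u < pos c \<or> pos d < pos u)" using I[OF u] neq cd by (auto simp: e2_def)
      then show ?thesis using e True by (auto simp: extra_def)
    next
      case False
      then show ?thesis using e2_cases[OF u] e cd u by (auto simp: extra_def)
    qed
    then show ?thesis using e2_cases[OF u] neq u by auto
  qed
  have "2 * card S + card ?E \<le> card Inv + 2 * card ?X"
  proof (rule two_charges[OF _ inj1 inj2 e1_e2])
    show "e1 u \<in> Inv - ?E \<and> e2 u \<in> Inv - ?E" if u: "u \<in> ?I" for u
    proof -
      have "e1 u \<in> Inv" "e2 u \<in> Inv"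
        using ba I[OF u] ex_in g[of u] g'[of u] by (auto simp: e1_def e2_def invs_def low_def high_def)
      then show ?thesis using e1_E[OF u] e2_E[OF u] by blast
    qed
    show "?E \<subseteq> Inv"
      using neq order assms ex_in e a_less[of b] by (auto simp: invs_def extra_def)
  qed (use ex_in in simp)
  moreover have "card ?E = 4" using e neq by (auto simp: extra_def card_insert_if)
  moreover have "card ?X = 4" using neq by simp
  ultimately show ?thesis by linarith
qed

lemma card_invs_swap: "card (invs val pos S) = card Inv"
  by (rule bij_betw_same_card[of prod.swap]) (auto simp: bij_betw_def invs_def inj_on_def)

lemma first_below_last_and_min_before_max:
  assumes "card Inv + 5 = 2 * card S"
  shows "pos c < pos d" "val a < val b"
proof -
  interpret s: extremal_points S val pos c d a b by (rule swap)
  have no: "\<not> 2 * card S \<le> card Inv + 4" using assms by simp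
  have ne: "a \<noteq> d" "c \<noteq> b"
    using no inversions_if_first_is_maximal s.inversions_if_first_is_maximal by (auto simp: card_invs_swap)
  have 1: "a \<noteq> b" "c \<noteq> d"
    using exists_other_point[of a] a_less b_max exists_other_point[of c] c_less d_max by force+
  then have "val a \<noteq> val b" "pos c \<noteq> pos d" using val_eq pos_eq ex_in by auto
  then show "pos c < pos d" "val a < val b"
    using no ne inversions_if_max_before_min
      inversions_if_first_above_last_and_min_before_max s.inversions_if_first_above_last_and_min_before_max
    by (force simp: card_invs_swap)+
qed

end


section \<open>Inflations of point sets\<close>

definition lowleft :: "('a \<Rightarrow> int) \<Rightarrow> ('a \<Rightarrow> int) \<Rightarrow> 'a set \<Rightarrow> 'a set \<Rightarrow> bool" where
  "lowleft pos val B C \<longleftrightarrow> (\<forall>u\<in>B. \<forall>w\<in>C. pos u < pos w \<and> val u < val w)"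

definition upleft :: "('a \<Rightarrow> int) \<Rightarrow> ('a \<Rightarrow> int) \<Rightarrow> 'a set \<Rightarrow> 'a set \<Rightarrow> bool" where
  "upleft pos val B C \<longleftrightarrow> (\<forall>u\<in>B. \<forall>w\<in>C. pos u < pos w \<and> val w < val u)"

definition chain :: "('a \<Rightarrow> int) \<Rightarrow> ('a \<Rightarrow> int) \<Rightarrow> 'a set \<Rightarrow> bool" where
  "chain pos val B \<longleftrightarrow> (\<forall>u\<in>B. \<forall>w\<in>B. pos u < pos w \<longrightarrow> val u < val w)"

definition block_order :: "('a \<Rightarrow> int) \<Rightarrow> ('a \<Rightarrow> int) \<Rightarrow> nat \<times> 'a set \<Rightarrow> nat \<times> 'a set \<Rightarrow> bool" where
  "block_order pos val = (\<lambda>(s, B) (t, C). if s < t then lowleft pos val B C else upleft pos val B C)"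

text \<open>
  The list \<open>Bs\<close> consists of the blocks in positional order; \<open>\<tau>\<close> records their order by value.
\<close>

definition inflates :: "'a set \<Rightarrow> ('a \<Rightarrow> int) \<Rightarrow> ('a \<Rightarrow> int) \<Rightarrow> nat list \<Rightarrow> 'a set list \<Rightarrow> bool" where
  "inflates S pos val \<tau> Bs \<longleftrightarrow> length Bs = length \<tau> \<and> \<Union> (set Bs) = S \<and> {} \<notin> set Bs \<and>
    (\<forall>B\<in>set Bs. chain pos val B) \<and>
    sorted_wrt (block_order pos val) (zip \<tau> Bs)"

lemma card_1_nonempty: "card B = 1 \<Longrightarrow> B \<noteq> {}"
  by auto

lemma lowleft_Un: "lowleft pos val (B \<union> B') C \<longleftrightarrow> lowleft pos val B C \<and> lowleft pos val B' C"
  "lowleft pos val B (C \<union> C') \<longleftrightarrow> lowleft pos val B C \<and> lowleft pos val B C'"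
  by (auto simp: lowleft_def)

lemma upleft_Un: "upleft pos val (B \<union> B') C \<longleftrightarrow> upleft pos val B C \<and> upleft pos val B' C"
  "upleft pos val B (C \<union> C') \<longleftrightarrow> upleft pos val B C \<and> upleft pos val B C'"
  by (auto simp: upleft_def)

lemma chain_single: "chain pos val {u}"
  by (auto simp: chain_def)

lemma chain_Un:
  assumes "chain pos val B" "chain pos val C" "lowleft pos val B C"
  shows "chain pos val (B \<union> C)"
  using assms by (force simp: chain_def lowleft_def)

lemma lowleft_flip: "lowleft (\<lambda>u. - val u) (\<lambda>u. - pos u) B C \<longleftrightarrow> lowleft pos val C B"
  by (auto simp: lowleft_def)

lemma upleft_flip: "upleft (\<lambda>u. - val u) (\<lambda>u. - pos u) B C \<longleftrightarrow> upleft pos val B C"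
  by (auto simp: upleft_def)

lemma chain_card_1: "card B = 1 \<Longrightarrow> chain pos val B"
  by (auto simp: chain_def card_1_singleton_iff)

text \<open>
  The set \<open>Q\<close> restricts the list of block sizes.
\<close>

definition shaped :: "'a set \<Rightarrow> ('a \<Rightarrow> int) \<Rightarrow> ('a \<Rightarrow> int) \<Rightarrow> nat list \<Rightarrow> nat list set \<Rightarrow> bool" where
  "shaped S pos val \<tau> Q \<longleftrightarrow> (\<exists>Bs. inflates S pos val \<tau> Bs \<and> map card Bs \<in> Q)"

lemma shapedI:
  assumes "length Bs = length \<tau>" "\<Union> (set Bs) = S" "list_all (\<lambda>B. B \<noteq> {} \<and> chain pos val B) Bs"
    "sorted_wrt (block_order pos val) (zip \<tau> Bs)" "map card Bs \<in> Q"
  shows "shaped S pos val \<tau> Q"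
  using assms unfolding shaped_def inflates_def list_all_iff by blast

text \<open>
  Block sizes as far as the shape alone determines them. The equations between block sizes come from
  the number of inversions.
\<close>

definition "sizes1 = {[A, 1, C, D, E] | A C D E. 2 \<le> C \<and> 2 \<le> (E::nat)}"
definition "sizes2 = {[A, 1, C, D, 1, 1] | A C D. 2 \<le> (C::nat)}"
definition "sizes3 = {[A, 1, C, 1, E, 1, 1] | A C E. 2 \<le> (C::nat)}"
definition "sizes4 = {[A, 1, 1, 1, D, E] | A D E. 2 \<le> (E::nat)}"
definition "sizes5 = {[1, 1, 1, 1, C, D, E] | C D E. 2 \<le> (E::nat)}"
definition "sizes6 = {[A, 1, C, D, 1, 1, 2] | A C D. 2 \<le> (C::nat)}"
definition "sizes7 = {[A, 1, C, 1, 1, 2] | A C. 2 \<le> (C::nat)}"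
definition "sizes8 = {[1, 1, B, 1, 2, D, E] | B D E. 2 \<le> (E::nat)}"
definition "sizes9 = {[1, 1, 1, 2, D, E] | D E. 2 \<le> (E::nat)}"
definition "sizes10 = {[A, 1, C, D, 1, F] | A C D F :: nat. True}"
definition "sizes11 = {[A, 1, C, 1, 1, E, 1] | A C E :: nat. True}"
definition "sizes12 = {[1, B, 1, 1, D, 1, F] | B D F :: nat. True}"

section \<open>The nine cells\<close>

text \<open>
  The letters \<open>L\<close>, \<open>C\<close>, \<open>R\<close> stand for the positions left of \<open>c\<close>, between \<open>c\<close> and \<open>d\<close>, and right
  of \<open>d\<close>; the letters \<open>L\<close>, \<open>M\<close>, \<open>H\<close> for the values below \<open>a\<close>, between \<open>a\<close> and \<open>b\<close>, and above \<open>b\<close>.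
  Exchanging the orders swaps \<open>LM\<close> with \<open>CL\<close>, \<open>LH\<close> with \<open>RL\<close> and \<open>CH\<close> with \<open>RM\<close>; reflection in the
  antidiagonal swaps \<open>LL\<close> with \<open>RH\<close>, \<open>LM\<close> with \<open>CH\<close> and \<open>CL\<close> with \<open>RM\<close>.
\<close>

locale crossing = extremal_points +
  assumes few: "card Inv + 5 = 2 * card S"
begin

lemma cd: "pos c < pos d" and ab: "val a < val b"
  using first_below_last_and_min_before_max[OF few] by auto

lemma swap': "crossing S val pos c d a b"
  unfolding crossing_def crossing_axioms_def using swap few by (simp add: card_invs_swap)

lemma antiflip': "crossing S (\<lambda>u. - val u) (\<lambda>u. - pos u) d c b a"
proof -
  have "invs (\<lambda>u. - val u) (\<lambda>u. - pos u) S = invs pos val S" by (auto simp: invs_def)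
  then show ?thesis unfolding crossing_def crossing_axioms_def using antiflip few by simp
qed

lemma acd: "pos a < pos c" "pos d < pos b" "val c < val a" "val b < val d"
  using a_less[of c] b_greater[of d] c_less[of a] d_greater[of b] ac db ex_in by auto

lemma distinct_extremes: "a \<noteq> b" "a \<noteq> c" "a \<noteq> d" "b \<noteq> c" "b \<noteq> d" "c \<noteq> d"
  using acd ab cd by auto

abbreviation "LL \<equiv> box S pos val (pos a) (pos c) (val c) (val a)"
abbreviation "LM \<equiv> box S pos val (pos a) (pos c) (val a) (val b)"
abbreviation "LH \<equiv> box S pos val (pos a) (pos c) (val b) (val d)"
abbreviation "CL \<equiv> box S pos val (pos c) (pos d) (val c) (val a)"
abbreviation "CH \<equiv> box S pos val (pos c) (pos d) (val b) (val d)"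
abbreviation "RL \<equiv> box S pos val (pos d) (pos b) (val c) (val a)"
abbreviation "RM \<equiv> box S pos val (pos d) (pos b) (val a) (val b)"
abbreviation "RH \<equiv> box S pos val (pos d) (pos b) (val b) (val d)"

abbreviation "X4 \<equiv> {a, b, c, d}"

lemma inner:
  assumes "u \<in> S - X4"
  shows "u \<in> S" "u \<noteq> a" "u \<noteq> b" "u \<noteq> c" "u \<noteq> d" "pos a < pos u" "pos u < pos b" "val c < val u"
      "val u < val d"
      "pos u \<noteq> pos c" "pos u \<noteq> pos d" "val u \<noteq> val a" "val u \<noteq> val b"
  using assms ex_in a_less[of u] b_greater[of u] c_less[of u] d_greater[of u] by (auto simp: pos_eq val_eq)

lemma boxes_inner: "LL \<union> LM \<union> LH \<union> CL \<union> CH \<union> RL \<union> RM \<union> RH \<subseteq> S - X4"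
  using acd ab cd by (auto simp: box_def)

text \<open>
  A central point lies upper right of \<open>a\<close> and \<open>c\<close> and lower left of \<open>b\<close> and \<open>d\<close>, so by avoidance
  it cannot have any inversion.
\<close>

lemma centre_empty: "box S pos val (pos c) (pos d) (val a) (val b) = {}"
proof (rule ccontr)
  assume "\<not> ?thesis"
  then obtain u where u: "u \<in> S" "pos c < pos u" "pos u < pos d" "val a < val u" "val u < val b"
    by (auto simp: box_def)
  obtain w where w: "w \<in> S" "(u, w) \<in> Inv \<or> (w, u) \<in> Inv"
    by (rule conn_neighbour[OF conn, of u a]) (use u ex_in inj_pos inj_val in auto)
  then show False
    using u increasing_between_a_d[of w u] increasing_between_c_b[of u w] by (auto simp: invs_def)
qed

lemma boxes: "S - X4 = LL \<union> LM \<union> LH \<union> CL \<union> CH \<union> RL \<union> RM \<union> RH"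
proof
  show "S - X4 \<subseteq> LL \<union> LM \<union> LH \<union> CL \<union> CH \<union> RL \<union> RM \<union> RH"
  proof
    fix u assume "u \<in> S - X4"
    note I = inner[OF this]
    show "u \<in> LL \<union> LM \<union> LH \<union> CL \<union> CH \<union> RL \<union> RM \<union> RH"
      using I centre_empty by (simp add: box_def) (smt (verit))
  qed
qed (rule boxes_inner)

lemma fin_box: "finite (box S pos val p q v w)"
  using fin by (auto simp: box_def)

lemma card_boxes:
  "card S = 4 + card LL + card LM + card LH + card CL + card CH + card RL + card RM + card RH"
proof -
  have "card (S - X4) = card LL + card LM + card LH + card CL + card CH + card RL + card RM + card RH"
    unfolding boxes by (subst card_Un_disjoint; (use fin_box acd ab cd in \<open>force simp: box_def\<close>)?)+
  moreover have "card X4 = 4" using distinct_extremes by auto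
  moreover have "card S = card (S - X4) + card X4" using ex_in fin
    by (metis card_Diff_subset card_mono empty_subsetI finite.emptyI finite_insert insert_subset
        le_add_diff_inverse2)
  ultimately show ?thesis by simp
qed

section \<open>One inversion in excess\<close>

text \<open>
  The inversions that involve an extremal point; corner cells contribute twice, edge cells once.
\<close>

definition outer :: "('a \<times> 'a) set" where
  "outer = {(a, c), (d, b)} \<union> (Pair a ` (LL \<union> CL \<union> RL) \<union> (\<lambda>u. (u, b)) ` (LH \<union> CH \<union> RH)
     \<union> (\<lambda>u. (u, c)) ` (LL \<union> LM \<union> LH) \<union> Pair d ` (RL \<union> RM \<union> RH))"

lemma outer_Inv: "outer \<subseteq> Inv"
  using acd ab cd ex_in by (auto simp: outer_def invs_def box_def)

lemma outer_involves_extreme: "e \<in> outer \<Longrightarrow> fst e \<in> X4 \<or> snd e \<in> X4"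
  by (auto simp: outer_def)

lemma card_outer: "card outer = 2 + 2 * card LL + card LM + 2 * card LH + card CL + card CH + 2 *
    card RL + card RM + 2 * card RH"
proof -
  let ?E1 = "Pair a ` (LL \<union> CL \<union> RL)" and ?E2 = "(\<lambda>u. (u, b)) ` (LH \<union> CH \<union> RH)"
  let ?E3 = "(\<lambda>u. (u, c)) ` (LL \<union> LM \<union> LH)" and ?E4 = "Pair d ` (RL \<union> RM \<union> RH)"
  have c3: "card (X \<union> Y \<union> Z) = card X + card Y + card Z"
    if "finite X" "finite Y" "finite Z" "X \<inter> Y = {}" "X \<inter> Z = {}" "Y \<inter> Z = {}" for X Y Z :: "'a set"
    using that by (simp add: card_Un_disjoint Int_Un_distrib2)
  have "card ?E1 = card LL + card CL + card RL"
    by (subst card_image, simp add: inj_on_def, rule c3) (use fin_box cd in \<open>force simp: box_def\<close>)+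
  moreover have "card ?E2 = card LH + card CH + card RH"
    by (subst card_image, simp add: inj_on_def, rule c3) (use fin_box cd in \<open>force simp: box_def\<close>)+
  moreover have "card ?E3 = card LL + card LM + card LH"
    by (subst card_image, simp add: inj_on_def, rule c3) (use fin_box ab in \<open>force simp: box_def\<close>)+
  moreover have "card ?E4 = card RL + card RM + card RH"
    by (subst card_image, simp add: inj_on_def, rule c3) (use fin_box ab in \<open>force simp: box_def\<close>)+
  moreover have "card (?E1 \<union> ?E2 \<union> ?E3 \<union> ?E4) = card ?E1 + card ?E2 + card ?E3 + card ?E4"
  proof -
    have in4: "a \<notin> LL \<union> LM \<union> LH \<union> CL \<union> CH \<union> RL \<union> RM \<union> RH" "b \<notin> LL \<union> LM \<union> LH \<union> CL \<union> CH \<union> RL \<union> RM \<union> RH"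
      "c \<notin> LL \<union> LM \<union> LH \<union> CL \<union> CH \<union> RL \<union> RM \<union> RH" "d \<notin> LL \<union> LM \<union> LH \<union> CL \<union> CH \<union> RL \<union> RM \<union> RH"
      using boxes_inner by blast+
    have f: "finite ?E1" "finite ?E2" "finite ?E3" "finite ?E4" using fin_box by auto
    have "?E1 \<inter> ?E2 = {}" "(?E1 \<union> ?E2) \<inter> ?E3 = {}" "(?E1 \<union> ?E2 \<union> ?E3) \<inter> ?E4 = {}"
      using in4 distinct_extremes by auto
    then show ?thesis using f by (simp add: card_Un_disjoint)
  qed
  moreover have "card outer = 2 + card (?E1 \<union> ?E2 \<union> ?E3 \<union> ?E4)"
  proof -
    have "{(a, c), (d, b)} \<inter> (?E1 \<union> ?E2 \<union> ?E3 \<union> ?E4) = {}"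
      using distinct_extremes by (auto simp: box_def)
    then show ?thesis unfolding outer_def
      using fin_box distinct_extremes by (subst card_Un_disjoint) auto
  qed
  ultimately show ?thesis by simp
qed

text \<open>
  When \<open>c\<close> is removed the point must not become isolated, and among the remaining points only those
  below \<open>a\<close> can be inverted with it.
\<close>

lemma LM_neighbour:
  assumes "u \<in> LM" shows "\<exists>v\<in>LL \<union> CL \<union> RL. (u, v) \<in> Inv"
proof -
  have u: "u \<in> S" "pos a < pos u" "pos u < pos c" "val a < val u" "val u < val b" using assms
      by (auto simp: box_def)
  have inj: "inj_on pos (S - {c})" "inj_on val (S - {c})" using inj_pos inj_val by (auto simp: inj_on_def)
  obtain w where w: "w \<in> S - {c}" "(u, w) \<in> invs pos val (S - {c}) \<or> (w, u) \<in> invs pos val (S - {c})"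
    by (rule conn_neighbour[OF conn_c, of u a]) (use u ex_in inj distinct_extremes in auto)
  have "(w, u) \<notin> Inv" using increasing_between_a_d[of w u] u cd by (auto simp: invs_def)
  then have uw: "(u, w) \<in> Inv" using w by (auto simp: invs_def)
  have "w \<noteq> a" "w \<noteq> b" "w \<noteq> d" using uw u acd ab by (auto simp: invs_def)
  then have wI: "w \<in> S - X4" using w by auto
  have "val w < val a"
  proof (rule ccontr)
    assume "\<not> ?thesis"
    then show False
      using increasing_between_a_b[of u w] u uw inner[OF wI] by (auto simp: invs_def)
  qed
  then have "w \<in> LL \<union> CL \<union> RL" using wI ab unfolding boxes by (auto simp: box_def)
  then show ?thesis using uw by blast
qed

lemma CH_neighbour:
  assumes "u \<in> CH" shows "\<exists>v\<in>RH \<union> RM \<union> RL. (u, v) \<in> Inv"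
proof -
  interpret f: crossing S "\<lambda>u. - val u" "\<lambda>u. - pos u" d c b a by (rule antiflip')
  have "u \<in> f.LM" using assms by (auto simp: box_def)
  from f.LM_neighbour[OF this] show ?thesis by (auto simp: box_def invs_def)
qed

text \<open>
  The inversions that serve as second charge of the edge points: \<open>g\<close> and \<open>g'\<close> choose a partner for
  the points of \<open>LM\<close> and \<open>CH\<close>, while the points of \<open>CL\<close> and \<open>RM\<close> are inverted with the fixed upper left
  point \<open>h\<close>.
\<close>

definition chosen :: "'a \<Rightarrow> ('a \<Rightarrow> 'a) \<Rightarrow> ('a \<Rightarrow> 'a) \<Rightarrow> 'a \<Rightarrow> 'a \<Rightarrow> bool" where
  "chosen h g g' u v \<longleftrightarrow> (u \<in> LM \<and> v = g u) \<or> (u \<in> CH \<and> v = g' u) \<or> (u = h \<and> v \<in> CL \<union> RM)"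

text \<open>
  The outer and the chosen inversions together number \<open>2 n - 6\<close>, so only one inversion of the
  \<open>2 n - 5\<close> remains.
\<close>

lemma at_most_one_unchosen:
  assumes h: "h \<in> LH"
    and g: "\<And>u. u \<in> LM \<Longrightarrow> (u, g u) \<in> Inv \<and> g u \<notin> X4"
    and g': "\<And>u. u \<in> CH \<Longrightarrow> (u, g' u) \<in> Inv \<and> g' u \<notin> X4"
    and e: "(u, v) \<in> Inv" "u \<notin> X4" "v \<notin> X4" "\<not> chosen h g g' u v"
    and e': "(u', v') \<in> Inv" "u' \<notin> X4" "v' \<notin> X4" "\<not> chosen h g g' u' v'"
  shows "u = u' \<and> v = v'"
proof -
  let ?B1 = "(\<lambda>u. (u, g u)) ` LM" and ?B2 = "(\<lambda>u. (u, g' u)) ` CH" and ?B3 = "Pair h ` (CL \<union> RM)"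
  let ?B = "outer \<union> (?B1 \<union> ?B2 \<union> ?B3)"
  have hX: "h \<notin> X4" "h \<notin> LM" "h \<notin> CH" using h boxes_inner cd by (auto simp: box_def)
  have in_X4: "LM \<inter> X4 = {}" "CH \<inter> X4 = {}" "(CL \<union> RM) \<inter> X4 = {}" using boxes_inner by blast+
  have fin_outer: "finite outer" using finite_subset[OF outer_Inv fin_Inv] .
  have "card ?B1 = card LM" "card ?B2 = card CH" by (simp_all add: card_image inj_on_def)
  moreover have "card ?B3 = card CL + card RM"
  proof -
    have "CL \<inter> RM = {}" using ab by (auto simp: box_def)
    then show ?thesis using fin_box by (subst card_image) (auto simp: inj_on_def card_Un_disjoint)
  qed
  moreover have "card (?B1 \<union> ?B2 \<union> ?B3) = card ?B1 + card ?B2 + card ?B3"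
  proof -
    have "LM \<inter> CH = {}" using ab by (auto simp: box_def)
    then have "?B1 \<inter> ?B2 = {}" by auto
    moreover have "(?B1 \<union> ?B2) \<inter> ?B3 = {}" using hX by auto
    ultimately show ?thesis using fin_box by (simp add: card_Un_disjoint)
  qed
  moreover have "outer \<inter> (?B1 \<union> ?B2 \<union> ?B3) = {}"
  proof -
    have "fst e \<notin> X4 \<and> snd e \<notin> X4" if "e \<in> ?B1 \<union> ?B2 \<union> ?B3" for e
    proof -
      have n: "\<And>u. u \<in> LM \<Longrightarrow> u \<notin> X4" "\<And>u. u \<in> CH \<Longrightarrow> u \<notin> X4" "\<And>u. u \<in> CL \<Longrightarrow> u \<notin> X4" "\<And>u. u \<in> RM \<Longrightarrow> u \<notin> X4"
        using in_X4 by blast+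
      show ?thesis using that
        by (elim UnE imageE) (simp_all del: insert_iff add: n g g' hX)
    qed
    then show ?thesis using outer_involves_extreme by blast
  qed
  then have "card ?B = card outer + card (?B1 \<union> ?B2 \<union> ?B3)"
    using fin_outer fin_box by (intro card_Un_disjoint) auto
  ultimately have le: "card Inv \<le> card ?B + 1"
    using few card_boxes card_outer by linarith
  have sub: "?B \<subseteq> Inv"
    using outer_Inv g g' h cd ab by (auto simp: invs_def box_def)
  have notin: "(x, y) \<notin> ?B" if "x \<notin> X4" "y \<notin> X4" "\<not> chosen h g g' x y" for x y
  proof -
    have "(x, y) \<notin> outer" using that outer_involves_extreme[of "(x, y)"] by auto
    moreover have "(x, y) \<notin> ?B1 \<union> ?B2 \<union> ?B3" using that(3) unfolding chosen_def by blast
    ultimately show ?thesis by blast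
  qed
  have "(u, v) = (u', v')"
    by (rule at_most_one_extra[OF fin_Inv sub le]) (use e e' notin in blast)+
  then show ?thesis by simp
qed

lemma LM_LH: "lowleft pos val LM LH"
  unfolding lowleft_def
proof (intro ballI)
  fix u w assume uw: "u \<in> LM" "w \<in> LH"
  then have "\<not> pos w < pos u" "pos u \<noteq> pos w"
    using increasing_between_a_d[of w u] ab cd pos_eq[of u w] by (auto simp: box_def)
  then show "pos u < pos w \<and> val u < val w" using uw by (auto simp: box_def)
qed

lemma CL_CH: "lowleft pos val CL CH"
  unfolding lowleft_def
proof (intro ballI)
  fix u w assume uw: "u \<in> CL" "w \<in> CH"
  then have "\<not> pos w < pos u" "pos u \<noteq> pos w"
    using increasing_between_c_d[of w u] ab cd pos_eq[of u w] by (auto simp: box_def)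
  then show "pos u < pos w \<and> val u < val w" using uw ab by (auto simp: box_def)
qed

lemma RL_RM: "lowleft pos val RL RM"
  unfolding lowleft_def
proof (intro ballI)
  fix u w assume uw: "u \<in> RL" "w \<in> RM"
  then have "\<not> pos w < pos u" "pos u \<noteq> pos w"
    using increasing_between_c_b[of w u] ab cd pos_eq[of u w] by (auto simp: box_def)
  then show "pos u < pos w \<and> val u < val w" using uw ab by (auto simp: box_def)
qed

lemma LM_RM: "lowleft pos val LM RM"
  using increasing_between_a_b cd by (auto simp: lowleft_def box_def)
lemma LH_CH: "lowleft pos val LH CH"
  using increasing_between_a_d cd ab by (auto simp: lowleft_def box_def)
lemma CL_RL: "lowleft pos val CL RL"
  using increasing_between_c_b cd ab by (auto simp: lowleft_def box_def)
lemma chains: "chain pos val LM" "chain pos val LH" "chain pos val CH"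
  "chain pos val CL" "chain pos val RL" "chain pos val RM"
  using increasing_between_a_d increasing_between_c_b cd ab by (auto simp: chain_def box_def)

lemmas increasing_pairs = LM_LH CL_CH RL_RM LM_RM LH_CH CL_RL

lemma lowleft_boxes:
  "lowleft pos val ({a} \<union> {c} \<union> LL \<union> LM \<union> CL) ({b} \<union> {d} \<union> CH \<union> RM \<union> RH)"
  "lowleft pos val ({a} \<union> LM) LH"
  unfolding lowleft_Un
  by (intro conjI; (rule increasing_pairs | use acd ab cd in \<open>auto simp: lowleft_def box_def\<close>))+

text \<open>
  Otherwise the plane splits into the lower left and the upper right cells.
\<close>

lemma LH_or_RL: "LH \<union> RL \<noteq> {}"
proof
  assume e: "LH \<union> RL = {}"
  let ?U = "{a} \<union> {c} \<union> LL \<union> LM \<union> CL"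
  obtain u w where uw: "u \<in> ?U" "w \<in> S" "w \<notin> ?U" "\<not> (pos u < pos w \<and> val u < val w)"
    by (rule conn_cut[OF conn, of ?U a b]) (use ex_in distinct_extremes acd ab cd in \<open>auto simp: box_def\<close>)
  have "w \<in> {b} \<union> {d} \<union> CH \<union> RM \<union> RH" using uw e boxes by blast
  then show False using lowleft_boxes(1) uw unfolding lowleft_def by blast
qed

text \<open>
  Otherwise \<open>l\<close>, \<open>h\<close>, \<open>v\<close>, \<open>d\<close> form a 1324 pattern.
\<close>

lemma LL_relation:
  assumes "l \<in> LL" "v \<in> CL" "h \<in> LH" shows "pos h < pos l \<or> val v < val l"
proof (rule ccontr)
  assume "\<not> ?thesis"
  then show False using assms no_1324[of l h v d] ex_in cd ab pos_eq[of l h] val_eq[of l v]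
      by (force simp: box_def)
qed

lemma RH_relation:
  assumes "r \<in> RH" "v \<in> RM" "h \<in> LH" shows "val r < val h \<or> pos r < pos v"
proof (rule ccontr)
  assume "\<not> ?thesis"
  then show False using assms no_1324[of a h v r] ex_in cd ab val_eq[of h r] pos_eq[of v r]
      by (force simp: box_def)
qed

text \<open>
  Deleting \<open>c\<close> must not separate the points of \<open>a\<close>, \<open>LL\<close> and \<open>LM\<close> from the rest.
\<close>

lemma LL_after_LH:
  assumes "CL = {}" "RL = {}" obtains h l where "h \<in> LH" "l \<in> LL" "pos h < pos l"
proof -
  let ?U = "{a} \<union> LL \<union> LM"
  obtain u w where uw: "u \<in> ?U" "w \<in> S - {c}" "w \<notin> ?U" "\<not> (pos u < pos w \<and> val u < val w)"
    by (rule conn_cut[OF conn_c, of ?U a b]) (use ex_in distinct_extremes acd ab cd in \<open>auto simp: box_def\<close>)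
  have w: "w \<in> LH \<union> ({b} \<union> {d} \<union> CH \<union> RM \<union> RH)" using uw(2,3) boxes assms by blast
  moreover have "w \<notin> {b} \<union> {d} \<union> CH \<union> RM \<union> RH"
    using lowleft_boxes(1) uw(1,4) unfolding lowleft_def by blast
  ultimately have "w \<in> LH" by blast
  moreover have "u \<in> LL"
    using lowleft_boxes(2) uw(1,4) \<open>w \<in> LH\<close> unfolding lowleft_def by blast
  moreover have "pos w < pos u" using uw(4) calculation pos_eq[of u w] ab by (auto simp: box_def)
  ultimately show thesis using that by blast
qed

lemma extremes_notin_boxes:
  "x \<in> X4 \<Longrightarrow> x \<notin> LL \<and> x \<notin> LM \<and> x \<notin> LH \<and> x \<notin> CL \<and> x \<notin> CH \<and> x \<notin> RL \<and> x \<notin> RM \<and> x \<notin> RH"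
  using boxes_inner by blast

lemma S_eq: "S = X4 \<union> (LL \<union> LM \<union> LH \<union> CL \<union> CH \<union> RL \<union> RM \<union> RH)"
  using boxes ex_in by blast

section \<open>The shapes\<close>

text \<open>
  In each of the following lemmas the hypotheses on the cells determine the whole picture: the
  blocks are the cells in positional order, with an extremal point merged into an adjacent edge
  cell where both form one run.
\<close>

lemma shape_24153:
  assumes "RL = {}" "RH = {}" "card LH = 1" "LL = {}" "CL \<noteq> {}" "RM \<noteq> {}"
  shows "shaped S pos val [2, 4, 1, 5, 3] sizes1"
proof (rule shapedI)
  let ?Bs = "[{a} \<union> LM, LH, {c} \<union> CL, CH \<union> {d}, RM \<union> {b}]"
  show "\<Union> (set ?Bs) = S" using assms S_eq by auto
  show "list_all (\<lambda>B. B \<noteq> {} \<and> chain pos val B) ?Bs"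
    unfolding list.pred_inject
    by (intro conjI chain_Un chains chain_single TrueI;
        (rule increasing_pairs assms | (rule chain_card_1, rule assms) | (rule card_1_nonempty,
            rule assms) | simp; fail
          | use acd ab cd in \<open>force simp: lowleft_def box_def\<close>))
  show "sorted_wrt (block_order pos val) (zip [2, 4, 1, 5, 3] ?Bs)"
    by (simp del: Un_insert_left Un_insert_right add: block_order_def lowleft_Un upleft_Un)
      (intro conjI; (rule increasing_pairs assms | use acd ab cd in \<open>force simp: lowleft_def
          upleft_def box_def\<close>))
  show "map card ?Bs \<in> sizes1"
    using extremes_notin_boxes assms by (auto simp: sizes1_def Suc_le_eq card_gt_0_iff fin_box)
qed simp

lemma shape_4621375:
  assumes "RL = {}" "RH = {}" "card LH = 1" "LM = {}" "card LL = 1" "CL \<noteq> {}" "RM \<noteq> {}"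
    "upleft pos val LH LL" "lowleft pos val LL CL"
  shows "shaped S pos val [4, 6, 2, 1, 3, 7, 5] sizes5"
proof (rule shapedI)
  let ?Bs = "[{a}, LH, LL, {c}, CL, CH \<union> {d}, RM \<union> {b}]"
  show "\<Union> (set ?Bs) = S" using assms S_eq by auto
  show "list_all (\<lambda>B. B \<noteq> {} \<and> chain pos val B) ?Bs"
    unfolding list.pred_inject
    by (intro conjI chain_Un chains chain_single TrueI;
        (rule increasing_pairs assms | (rule chain_card_1, rule assms) | (rule card_1_nonempty,
            rule assms) | simp; fail
          | use acd ab cd in \<open>force simp: lowleft_def box_def\<close>))
  show "sorted_wrt (block_order pos val) (zip [4, 6, 2, 1, 3, 7, 5] ?Bs)"
    by (simp del: Un_insert_left Un_insert_right add: block_order_def lowleft_Un upleft_Un)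
      (intro conjI; (rule increasing_pairs assms | use acd ab cd in \<open>force simp: lowleft_def
          upleft_def box_def\<close>))
  show "map card ?Bs \<in> sizes5"
    using extremes_notin_boxes assms by (auto simp: sizes5_def Suc_le_eq card_gt_0_iff fin_box)
qed simp

lemma shape_3246175:
  assumes "RL = {}" "RH = {}" "card LH = 1" "LM \<noteq> {}" "card LL = 1" "card CL = 1" "RM \<noteq> {}"
    "upleft pos val LL CL" "lowleft pos val LL LM" "lowleft pos val LL LH"
  shows "shaped S pos val [3, 2, 4, 6, 1, 7, 5] sizes8"
proof (rule shapedI)
  let ?Bs = "[{a}, LL, LM, LH, {c} \<union> CL, CH \<union> {d}, RM \<union> {b}]"
  show "\<Union> (set ?Bs) = S" using assms S_eq by auto
  show "list_all (\<lambda>B. B \<noteq> {} \<and> chain pos val B) ?Bs"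
    unfolding list.pred_inject
    by (intro conjI chain_Un chains chain_single TrueI;
        (rule increasing_pairs assms | (rule chain_card_1, rule assms) | (rule card_1_nonempty,
            rule assms) | simp; fail
          | use acd ab cd in \<open>force simp: lowleft_def box_def\<close>))
  show "sorted_wrt (block_order pos val) (zip [3, 2, 4, 6, 1, 7, 5] ?Bs)"
    by (simp del: Un_insert_left Un_insert_right add: block_order_def lowleft_Un upleft_Un)
      (intro conjI; (rule increasing_pairs assms | use acd ab cd in \<open>force simp: lowleft_def
          upleft_def box_def\<close>))
  show "map card ?Bs \<in> sizes8"
    using extremes_notin_boxes assms by (auto simp: sizes8_def Suc_le_eq card_gt_0_iff fin_box)
qed simp

lemma shape_325164:
  assumes "RL = {}" "RH = {}" "card LH = 1" "LM = {}" "card LL = 1" "card CL = 1" "RM \<noteq> {}"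
    "upleft pos val LL CL" "lowleft pos val LL LH"
  shows "shaped S pos val [3, 2, 5, 1, 6, 4] sizes9"
proof (rule shapedI)
  let ?Bs = "[{a}, LL, LH, {c} \<union> CL, CH \<union> {d}, RM \<union> {b}]"
  show "\<Union> (set ?Bs) = S" using assms S_eq by auto
  show "list_all (\<lambda>B. B \<noteq> {} \<and> chain pos val B) ?Bs"
    unfolding list.pred_inject
    by (intro conjI chain_Un chains chain_single TrueI;
        (rule increasing_pairs assms | (rule chain_card_1, rule assms) | (rule card_1_nonempty,
            rule assms) | simp; fail
          | use acd ab cd in \<open>force simp: lowleft_def box_def\<close>))
  show "sorted_wrt (block_order pos val) (zip [3, 2, 5, 1, 6, 4] ?Bs)"
    by (simp del: Un_insert_left Un_insert_right add: block_order_def lowleft_Un upleft_Un)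
      (intro conjI; (rule increasing_pairs assms | use acd ab cd in \<open>force simp: lowleft_def
          upleft_def box_def\<close>))
  show "map card ?Bs \<in> sizes9"
    using extremes_notin_boxes assms by (auto simp: sizes9_def Suc_le_eq card_gt_0_iff fin_box)
qed simp

lemma shape_352164:
  assumes "RL = {}" "RH = {}" "card LH = 1" "CL = {}" "card LL = 1" "RM \<noteq> {}"
    "upleft pos val LH LL" "upleft pos val LM LL"
  shows "shaped S pos val [3, 5, 2, 1, 6, 4] sizes4"
proof (rule shapedI)
  let ?Bs = "[{a} \<union> LM, LH, LL, {c}, CH \<union> {d}, RM \<union> {b}]"
  show "\<Union> (set ?Bs) = S" using assms S_eq by auto
  show "list_all (\<lambda>B. B \<noteq> {} \<and> chain pos val B) ?Bs"
    unfolding list.pred_inject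
    by (intro conjI chain_Un chains chain_single TrueI;
        (rule increasing_pairs assms | (rule chain_card_1, rule assms) | (rule card_1_nonempty,
            rule assms) | simp; fail
          | use acd ab cd in \<open>force simp: lowleft_def box_def\<close>))
  show "sorted_wrt (block_order pos val) (zip [3, 5, 2, 1, 6, 4] ?Bs)"
    by (simp del: Un_insert_left Un_insert_right add: block_order_def lowleft_Un upleft_Un)
      (intro conjI; (rule increasing_pairs assms | use acd ab cd in \<open>force simp: lowleft_def
          upleft_def box_def\<close>))
  show "map card ?Bs \<in> sizes4"
    using extremes_notin_boxes assms by (auto simp: sizes4_def Suc_le_eq card_gt_0_iff fin_box)
qed simp

lemma shape_351624:
  assumes "card LH = 1" "card RL = 1" "LL = {}" "RH = {}"
  shows "shaped S pos val [3, 5, 1, 6, 2, 4] sizes10"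
proof (rule shapedI)
  let ?Bs = "[{a} \<union> LM, LH, {c} \<union> CL, CH \<union> {d}, RL, RM \<union> {b}]"
  show "\<Union> (set ?Bs) = S" using assms S_eq by auto
  show "list_all (\<lambda>B. B \<noteq> {} \<and> chain pos val B) ?Bs"
    unfolding list.pred_inject
    by (intro conjI chain_Un chains chain_single TrueI;
        (rule increasing_pairs assms | (rule chain_card_1, rule assms) | (rule card_1_nonempty,
            rule assms) | simp; fail
          | use acd ab cd in \<open>force simp: lowleft_def box_def\<close>))
  show "sorted_wrt (block_order pos val) (zip [3, 5, 1, 6, 2, 4] ?Bs)"
    by (simp del: Un_insert_left Un_insert_right add: block_order_def lowleft_Un upleft_Un)
      (intro conjI; (rule increasing_pairs assms | use acd ab cd in \<open>force simp: lowleft_def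
          upleft_def box_def\<close>))
  show "map card ?Bs \<in> sizes10"
    using extremes_notin_boxes assms by (auto simp: sizes10_def Suc_le_eq card_gt_0_iff fin_box)
qed simp

lemma shape_3517264:
  assumes "card LH = 1" "card RL = 1" "LL = {}" "CH = {}" "RM = {}" "RH \<noteq> {}"
    "chain pos val RH" "lowleft pos val LH RH" "lowleft pos val RL RH"
  shows "shaped S pos val [3, 5, 1, 7, 2, 6, 4] sizes11"
proof (rule shapedI)
  let ?Bs = "[{a} \<union> LM, LH, {c} \<union> CL, {d}, RL, RH, {b}]"
  show "\<Union> (set ?Bs) = S" using assms S_eq by auto
  show "list_all (\<lambda>B. B \<noteq> {} \<and> chain pos val B) ?Bs"
    unfolding list.pred_inject
    by (intro conjI chain_Un chains chain_single TrueI;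
        (rule increasing_pairs assms | (rule chain_card_1, rule assms) | (rule card_1_nonempty,
            rule assms) | simp; fail
          | use acd ab cd in \<open>force simp: lowleft_def box_def\<close>))
  show "sorted_wrt (block_order pos val) (zip [3, 5, 1, 7, 2, 6, 4] ?Bs)"
    by (simp del: Un_insert_left Un_insert_right add: block_order_def lowleft_Un upleft_Un)
      (intro conjI; (rule increasing_pairs assms | use acd ab cd in \<open>force simp: lowleft_def
          upleft_def box_def\<close>))
  show "map card ?Bs \<in> sizes11"
    using extremes_notin_boxes assms by (auto simp: sizes11_def Suc_le_eq card_gt_0_iff fin_box)
qed simp

lemma shape_4261735:
  assumes "card LH = 1" "card RL = 1" "RH = {}" "LM = {}" "CL = {}" "LL \<noteq> {}"
    "chain pos val LL" "lowleft pos val LL LH" "lowleft pos val LL RL"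
  shows "shaped S pos val [4, 2, 6, 1, 7, 3, 5] sizes12"
proof (rule shapedI)
  let ?Bs = "[{a}, LL, LH, {c}, CH \<union> {d}, RL, RM \<union> {b}]"
  show "\<Union> (set ?Bs) = S" using assms S_eq by auto
  show "list_all (\<lambda>B. B \<noteq> {} \<and> chain pos val B) ?Bs"
    unfolding list.pred_inject
    by (intro conjI chain_Un chains chain_single TrueI;
        (rule increasing_pairs assms | (rule chain_card_1, rule assms) | (rule card_1_nonempty,
            rule assms) | simp; fail
          | use acd ab cd in \<open>force simp: lowleft_def box_def\<close>))
  show "sorted_wrt (block_order pos val) (zip [4, 2, 6, 1, 7, 3, 5] ?Bs)"
    by (simp del: Un_insert_left Un_insert_right add: block_order_def lowleft_Un upleft_Un)
      (intro conjI; (rule increasing_pairs assms | use acd ab cd in \<open>force simp: lowleft_def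
          upleft_def box_def\<close>))
  show "map card ?Bs \<in> sizes12"
    using extremes_notin_boxes assms by (auto simp: sizes12_def Suc_le_eq card_gt_0_iff fin_box)
qed simp

text \<open>
  The shapes that occur with \<open>RL = {}\<close>, up to reflection in the antidiagonal.
\<close>

definition (in -) one_sided :: "'a set \<Rightarrow> ('a \<Rightarrow> int) \<Rightarrow> ('a \<Rightarrow> int) \<Rightarrow> bool" where
  "one_sided S pos val \<longleftrightarrow> shaped S pos val [2, 4, 1, 5, 3] sizes1 \<or> shaped S pos val [3, 5, 2, 1, 6,
      4] sizes4 \<or>
    shaped S pos val [4, 6, 2, 1, 3, 7, 5] sizes5 \<or> shaped S pos val [3, 2, 4, 6, 1, 7, 5] sizes8 \<or>
    shaped S pos val [3, 2, 5, 1, 6, 4] sizes9"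

text \<open>
  A constant rather than an abbreviation, to keep the membership opaque to automation.
\<close>

definition inside where "inside = LL \<union> LM \<union> LH \<union> CL \<union> CH \<union> RL \<union> RM \<union> RH"

lemma ins:
  "u \<in> LL \<Longrightarrow> u \<in> inside"
  "u \<in> LM \<Longrightarrow> u \<in> inside"
  "u \<in> LH \<Longrightarrow> u \<in> inside"
  "u \<in> CL \<Longrightarrow> u \<in> inside"
  "u \<in> CH \<Longrightarrow> u \<in> inside"
  "u \<in> RL \<Longrightarrow> u \<in> inside"
  "u \<in> RM \<Longrightarrow> u \<in> inside"
  "u \<in> RH \<Longrightarrow> u \<in> inside"
  unfolding inside_def by blast+

lemma insideD: "u \<in> inside \<Longrightarrow> u \<notin> X4"
  using boxes_inner unfolding inside_def by blast

lemma LL_notin: "u \<in> LL \<Longrightarrow> u \<notin> LM \<and> u \<notin> LH \<and> u \<notin> CL \<and> u \<notin> CH \<and> u \<notin> RL \<and> u \<notin> RM \<and> u \<notin> RH"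
  using ab cd by (auto simp: box_def)
lemma LM_notin: "u \<in> LM \<Longrightarrow> u \<notin> LL \<and> u \<notin> LH \<and> u \<notin> CL \<and> u \<notin> CH \<and> u \<notin> RL \<and> u \<notin> RM \<and> u \<notin> RH"
  using ab cd by (auto simp: box_def)
lemma LH_notin: "u \<in> LH \<Longrightarrow> u \<notin> LL \<and> u \<notin> LM \<and> u \<notin> CL \<and> u \<notin> CH \<and> u \<notin> RL \<and> u \<notin> RM \<and> u \<notin> RH"
  using ab cd by (auto simp: box_def)
lemma RL_notin: "u \<in> RL \<Longrightarrow> u \<notin> LL \<and> u \<notin> LM \<and> u \<notin> LH \<and> u \<notin> CL \<and> u \<notin> CH \<and> u \<notin> RM \<and> u \<notin> RH"
  using ab cd by (auto simp: box_def)
lemma RM_notin: "u \<in> RM \<Longrightarrow> u \<notin> LL \<and> u \<notin> LM \<and> u \<notin> LH \<and> u \<notin> CL \<and> u \<notin> CH \<and> u \<notin> RL \<and> u \<notin> RH"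
  using ab cd by (auto simp: box_def)
lemma RH_notin: "u \<in> RH \<Longrightarrow> u \<notin> LL \<and> u \<notin> LM \<and> u \<notin> LH \<and> u \<notin> CL \<and> u \<notin> CH \<and> u \<notin> RL \<and> u \<notin> RM"
  using ab cd by (auto simp: box_def)

lemma one_sided_choice:
  assumes "RL = {}" "h \<in> LH"
  obtains g g' where "\<And>u. u \<in> LM \<Longrightarrow> (u, g u) \<in> Inv \<and> g u \<in> LL \<union> CL"
    "\<And>u. u \<in> CH \<Longrightarrow> (u, g' u) \<in> Inv \<and> g' u \<in> RH \<union> RM"
    "\<And>u v u' v'. (u, v) \<in> Inv \<Longrightarrow> u \<in> inside \<Longrightarrow> v \<in> inside \<Longrightarrow> \<not> chosen h g g' u v \<Longrightarrow>
      (u', v') \<in> Inv \<Longrightarrow> u' \<in> inside \<Longrightarrow> v' \<in> inside \<Longrightarrow> \<not> chosen h g g' u' v' \<Longrightarrow> u = u' \<and> v = v'"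
proof -
  have "\<forall>u\<in>LM. \<exists>v. (u, v) \<in> Inv \<and> v \<in> LL \<union> CL" using LM_neighbour assms(1) by blast
  then obtain g where g: "\<And>u. u \<in> LM \<Longrightarrow> (u, g u) \<in> Inv \<and> g u \<in> LL \<union> CL" by metis
  have "\<forall>u\<in>CH. \<exists>v. (u, v) \<in> Inv \<and> v \<in> RH \<union> RM" using CH_neighbour assms(1) by blast
  then obtain g' where g': "\<And>u. u \<in> CH \<Longrightarrow> (u, g' u) \<in> Inv \<and> g' u \<in> RH \<union> RM" by metis
  have nX: "LL \<inter> X4 = {}" "CL \<inter> X4 = {}" "RH \<inter> X4 = {}" "RM \<inter> X4 = {}" using boxes_inner by blast+
  have "\<And>u. u \<in> LM \<Longrightarrow> (u, g u) \<in> Inv \<and> g u \<notin> X4" "\<And>u. u \<in> CH \<Longrightarrow> (u, g' u) \<in> Inv \<and> g' u \<notin> X4"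
    using g g' nX by blast+
  note E = at_most_one_unchosen[OF assms(2) this]
  show thesis by (rule that[OF g g']) (assumption | rule E insideD)+
qed

lemma not_chosen:
  assumes "h \<in> LH"
  shows "u \<in> LL \<Longrightarrow> \<not> chosen h g g' u v" "u \<in> RH \<Longrightarrow> \<not> chosen h g g' u v"
    "u \<in> LH \<Longrightarrow> v \<notin> CL \<Longrightarrow> v \<notin> RM \<Longrightarrow> \<not> chosen h g g' u v"
    "u \<in> LH \<Longrightarrow> u \<noteq> h \<Longrightarrow> \<not> chosen h g g' u v"
proof -
  show "\<not> chosen h g g' u v" if "u \<in> LL" using LL_notin[OF that] assms unfolding chosen_def by blast
  show "\<not> chosen h g g' u v" if "u \<in> RH" using RH_notin[OF that] assms unfolding chosen_def by blast
  show "\<not> chosen h g g' u v" if "u \<in> LH" "v \<notin> CL" "v \<notin> RM"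
    using LH_notin[OF that(1)] that unfolding chosen_def by blast
  show "\<not> chosen h g g' u v" if "u \<in> LH" "u \<noteq> h"
    using LH_notin[OF that(1)] that unfolding chosen_def by blast
qed

lemma LH_above: "u \<in> LH \<Longrightarrow> v \<in> CL \<Longrightarrow> (u, v) \<in> Inv" "u \<in> LH \<Longrightarrow> v \<in> RM \<Longrightarrow> (u, v) \<in> Inv"
  "u \<in> LH \<Longrightarrow> v \<in> RL \<Longrightarrow> (u, v) \<in> Inv"
  using ab cd by (auto simp: invs_def box_def)

lemma LM_above: "u \<in> LM \<Longrightarrow> v \<in> CL \<Longrightarrow> (u, v) \<in> Inv" "u \<in> LM \<Longrightarrow> v \<in> RL \<Longrightarrow> (u, v) \<in> Inv"
  using ab cd by (auto simp: invs_def box_def)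

lemma RH_below_LH:
  assumes "RM = {}" "RL = {}" obtains h r where "h \<in> LH" "r \<in> RH" "(h, r) \<in> Inv"
proof -
  interpret f: crossing S "\<lambda>u. - val u" "\<lambda>u. - pos u" d c b a by (rule antiflip')
  have eq: "f.CL = RM" "f.RL = RL" "f.LH = LH" "f.LL = RH" by (auto simp: box_def)
  obtain h l where "h \<in> LH" "l \<in> RH" "- val h < - val l"
    using f.LL_after_LH eq assms by metis
  then show thesis using that[of h l] cd by (auto simp: invs_def box_def)
qed

lemma LL_inversion:
  assumes "l \<in> LL" "v \<in> CL" "h \<in> LH" shows "(h, l) \<in> Inv \<or> (l, v) \<in> Inv"
  using LL_relation[OF assms] assms ab by (auto simp: invs_def box_def)

lemma RH_inversion:
  assumes "r \<in> RH" "v \<in> RM" "h \<in> LH" shows "(h, r) \<in> Inv \<or> (r, v) \<in> Inv"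
  using RH_relation[OF assms] assms cd by (auto simp: invs_def box_def)

text \<open>
  If there is no lower right point, an unchosen inversion arises at the lower left as soon as
  \<open>CL\<close> is empty, \<open>LL\<close> is not, or \<open>LH\<close> has a second point; the same holds at the upper right with
  \<open>RM\<close> and \<open>RH\<close>. The two inversions are different, so at most one of the two ends is exceptional.
\<close>

lemma one_end_plain:
  assumes "RL = {}" shows "card LH = 1" "RM \<noteq> {} \<and> RH = {} \<or> CL \<noteq> {} \<and> LL = {}"
proof -
  obtain h where h: "h \<in> LH" using LH_or_RL assms by blast
  obtain g g' where E: "\<And>u v u' v'. (u, v) \<in> Inv \<Longrightarrow> u \<in> inside \<Longrightarrow> v \<in> inside \<Longrightarrow> \<not> chosen h g g' u v \<Longrightarrow>
      (u', v') \<in> Inv \<Longrightarrow> u' \<in> inside \<Longrightarrow> v' \<in> inside \<Longrightarrow> \<not> chosen h g g' u' v' \<Longrightarrow> u = u' \<and> v = v'"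
    by (rule one_sided_choice[OF assms h]) blast
  note nch = not_chosen[OF h, where g = g and g' = g']
  have lower: "\<exists>u v. (u, v) \<in> Inv \<and> u \<in> inside \<and> v \<in> LL \<union> CL \<and> \<not> chosen h g g' u v"
    if cond: "CL = {} \<or> LL \<noteq> {} \<or> LH \<noteq> {h}"
  proof (cases "CL = {}")
    case True
    obtain x l where x: "x \<in> LH" "l \<in> LL" "pos x < pos l" by (rule LL_after_LH[OF True assms])
    then have "(x, l) \<in> Inv" using ab by (auto simp: invs_def box_def)
    moreover have "\<not> chosen h g g' x l" using nch(3)[OF x(1)] LL_notin[OF x(2)] by blast
    ultimately show ?thesis using x(2) ins(3)[OF x(1)] by blast
  next
    case False
    then obtain v where v: "v \<in> CL" by blast
    show ?thesis
    proof (cases "LL = {}")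
      case True
      then obtain x where x: "x \<in> LH" "x \<noteq> h" using cond v h by blast
      show ?thesis using LH_above(1)[OF x(1) v] v ins(3)[OF x(1)] nch(4)[OF x] by blast
    next
      case False
      then obtain l where l: "l \<in> LL" by blast
      from LL_inversion[OF l v h] show ?thesis
      proof
        assume "(h, l) \<in> Inv"
        then show ?thesis using l ins(3)[OF h] nch(3)[OF h] LL_notin[OF l] by blast
      next
        assume "(l, v) \<in> Inv"
        then show ?thesis using v ins(1)[OF l] nch(1)[OF l] by blast
      qed
    qed
  qed
  have upper: "\<exists>u v. (u, v) \<in> Inv \<and> u \<in> inside \<and> v \<in> RH \<union> RM \<and> \<not> chosen h g g' u v"
    if cond: "RM = {} \<or> RH \<noteq> {} \<or> LH \<noteq> {h}"
  proof (cases "RM = {}")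
    case True
    obtain x l where x: "x \<in> LH" "l \<in> RH" "(x, l) \<in> Inv" by (rule RH_below_LH[OF True assms])
    moreover have "\<not> chosen h g g' x l" using nch(3)[OF x(1)] RH_notin[OF x(2)] by blast
    ultimately show ?thesis using ins(3)[OF x(1)] by blast
  next
    case False
    then obtain v where v: "v \<in> RM" by blast
    show ?thesis
    proof (cases "RH = {}")
      case True
      then obtain x where x: "x \<in> LH" "x \<noteq> h" using cond v h by blast
      show ?thesis using LH_above(2)[OF x(1) v] v ins(3)[OF x(1)] nch(4)[OF x] by blast
    next
      case False
      then obtain l where l: "l \<in> RH" by blast
      from RH_inversion[OF l v h] show ?thesis
      proof
        assume "(h, l) \<in> Inv"
        then show ?thesis using l ins(3)[OF h] nch(3)[OF h] RH_notin[OF l] by blast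
      next
        assume "(l, v) \<in> Inv"
        then show ?thesis using v ins(8)[OF l] nch(2)[OF l] by blast
      qed
    qed
  qed
  have no: "\<not> ((CL = {} \<or> LL \<noteq> {} \<or> LH \<noteq> {h}) \<and> (RM = {} \<or> RH \<noteq> {} \<or> LH \<noteq> {h}))"
  proof
    assume *: "(CL = {} \<or> LL \<noteq> {} \<or> LH \<noteq> {h}) \<and> (RM = {} \<or> RH \<noteq> {} \<or> LH \<noteq> {h})"
    obtain u v where uv: "(u, v) \<in> Inv" "u \<in> inside" "v \<in> LL \<union> CL" "\<not> chosen h g g' u v"
        using lower * by blast
    obtain u' v' where uv': "(u', v') \<in> Inv" "u' \<in> inside" "v' \<in> RH \<union> RM" "\<not> chosen h g g' u' v'"
        using upper * by blast
    have "v \<in> inside" "v' \<in> inside" using uv(3) uv'(3) ins by blast+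
    then have "v = v'" using E[OF uv(1,2) _ uv(4) uv'(1,2) _ uv'(4)] by blast
    then show False using uv(3) uv'(3) RH_notin[of v] RM_notin[of v] by blast
  qed
  then have "LH = {h}" by blast
  then show "card LH = 1" by simp
  show "RM \<noteq> {} \<and> RH = {} \<or> CL \<noteq> {} \<and> LL = {}" using no by blast
qed

text \<open>
  The upper right end is plain. At the lower left, \<open>CL\<close> and \<open>LL\<close> decide: an empty \<open>CL\<close> forces one
  point of \<open>LL\<close> after \<open>h\<close>; an empty \<open>LL\<close> leaves the generic picture; otherwise \<open>LL\<close> is a single point
  whose unchosen inversion is either with \<open>h\<close> or with the then unique point of \<open>CL\<close>.
\<close>

lemma one_sided_shapes:
  assumes RL: "RL = {}" and RM: "RM \<noteq> {}" and RH: "RH = {}"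
  shows "one_sided S pos val"
proof -
  have LH1: "card LH = 1" by (rule one_end_plain[OF RL])
  then obtain h where LH: "LH = {h}" by (auto simp: card_1_singleton_iff)
  then have h: "h \<in> LH" by blast
  obtain g g' where g: "\<And>u. u \<in> LM \<Longrightarrow> (u, g u) \<in> Inv \<and> g u \<in> LL \<union> CL"
    and E: "\<And>u v u' v'. (u, v) \<in> Inv \<Longrightarrow> u \<in> inside \<Longrightarrow> v \<in> inside \<Longrightarrow> \<not> chosen h g g' u v \<Longrightarrow>
      (u', v') \<in> Inv \<Longrightarrow> u' \<in> inside \<Longrightarrow> v' \<in> inside \<Longrightarrow> \<not> chosen h g g' u' v' \<Longrightarrow> u = u' \<and> v = v'"
    by (rule one_sided_choice[OF RL h]) blast
  note nch = not_chosen[OF h, where g = g and g' = g']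
  have nh: "l \<notin> CL" "l \<notin> RM" if "l \<in> LL" for l using LL_notin[OF that] by blast+
  note hi = ins(3)[OF h]
  have ord: "pos u < pos h" if "u \<in> LM" for u using LM_LH that LH by (auto simp: lowleft_def)
  show ?thesis
  proof (cases "CL = {}")
    case CL: True
    obtain x l0 where x: "x \<in> LH" and l0: "l0 \<in> LL" and "pos x < pos l0" by (rule LL_after_LH[OF CL RL])
    moreover have "x = h" using x LH by blast
    ultimately have l0: "l0 \<in> LL" "pos h < pos l0" by auto
    then have hl0: "(h, l0) \<in> Inv" using h ab by (auto simp: invs_def box_def)
    have nc: "\<not> chosen h g g' h l0" using nch(3)[OF h nh[OF l0(1)]] .
    note E0 = E[OF hl0 hi ins(1)[OF l0(1)] nc]
    have "l = l0" if l: "l \<in> LL" for l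
    proof (rule ccontr)
      assume ne: "l \<noteq> l0"
      have "\<not> pos h < pos l"
      proof
        assume "pos h < pos l"
        then have "(h, l) \<in> Inv" using h l ab by (auto simp: invs_def box_def)
        then show False using E0[OF _ hi ins(1)[OF l]] nch(3)[OF h nh[OF l]] ne by blast
      qed
      moreover have "pos l \<noteq> pos h" using l h pos_eq[of l h] ab by (auto simp: box_def)
      ultimately have lh: "pos l < pos h" by simp
      show False
      proof (cases "val l < val l0")
        case True
        then show False using no_1324[of l h l0 d] lh l h l0 ex_in cd ab by (auto simp: box_def)
      next
        case False
        then have "(l, l0) \<in> Inv" using l l0 lh ne val_eq[of l l0] by (force simp: invs_def box_def)
        then show False using E0[OF _ ins(1)[OF l] ins(1)[OF l0(1)]] nch(1)[OF l] LL_notin[OF l] h by blast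
      qed
    qed
    then have LL: "LL = {l0}" using l0 by blast
    have "upleft pos val LH LL" using LL LH hl0 by (auto simp: upleft_def invs_def)
    moreover have "upleft pos val LM LL"
    proof -
      have "pos u < pos l0 \<and> val l0 < val u" if "u \<in> LM" for u
        using ord[OF that] l0 that by (auto simp: box_def)
      then show ?thesis unfolding LL upleft_def by blast
    qed
    ultimately show ?thesis using shape_352164[OF RL RH LH1 CL _ RM] LL by (auto simp: one_sided_def)
  next
    case CL: False
    show ?thesis
    proof (cases "LL = {}")
      case True
      then show ?thesis using shape_24153[OF RL RH LH1 True CL RM] by (auto simp: one_sided_def)
    next
      case False
      then obtain l0 where l0: "l0 \<in> LL" by blast
      obtain v0 where v0: "v0 \<in> CL" using CL by blast
      have two: "\<exists>v. (u, v) \<in> Inv \<and> v \<in> {l0, v0} \<and> \<not> chosen h g g' u v"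
        if "u \<in> LM" "(u, l0) \<in> Inv" for u
      proof -
        have "l0 \<noteq> v0" "u \<noteq> h" "u \<notin> CH" using LL_notin[OF l0] v0 LM_notin[OF that(1)] h by blast+
        then show ?thesis using LM_above(1)[OF that(1) v0] that unfolding chosen_def by blast
      qed
      show ?thesis
      proof (cases "(h, l0) \<in> Inv")
        case hl0: True
        note E0 = E[OF hl0 hi ins(1)[OF l0] nch(3)[OF h nh[OF l0]]]
        have LM: "LM = {}"
        proof (rule ccontr)
          assume "\<not> ?thesis"
          then obtain u where u: "u \<in> LM" by blast
          then have "(u, l0) \<in> Inv" using ord[OF u] hl0 l0 by (auto simp: invs_def box_def)
          then obtain v where v: "(u, v) \<in> Inv" "v \<in> {l0, v0}" "\<not> chosen h g g' u v" using two[OF u]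
              by blast
          have "v \<in> inside" using v(2) ins(1)[OF l0] ins(4)[OF v0] by blast
          then have "h = u" using E0[OF v(1) ins(2)[OF u] _ v(3)] by blast
          then show False using LM_notin[OF u] h by blast
        qed
        have "l = l0" if l: "l \<in> LL" for l
          using LL_inversion[OF l v0 h] E0[OF _ hi ins(1)[OF l] nch(3)[OF h nh[OF l]]]
            E0[OF _ ins(1)[OF l] ins(4)[OF v0] nch(1)[OF l]] LL_notin[OF l] h by blast
        then have LL: "LL = {l0}" using l0 by blast
        have "lowleft pos val LL CL"
        proof -
          have "(l0, v) \<notin> Inv" if v: "v \<in> CL" for v
            using E0[OF _ ins(1)[OF l0] ins(4)[OF v] nch(1)[OF l0]] LL_notin[OF l0] h by blast
          then have "pos l0 < pos v \<and> val l0 < val v" if "v \<in> CL" for v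
            using that l0 val_eq[of l0 v] by (force simp: invs_def box_def)
          then show ?thesis unfolding LL lowleft_def by blast
        qed
        moreover have "upleft pos val LH LL" using LL LH hl0 by (auto simp: upleft_def invs_def)
        ultimately show ?thesis using shape_4621375[OF RL RH LH1 LM _ CL RM] LL
            by (auto simp: one_sided_def)
      next
        case not_hl0: False
        then have lv0: "(l0, v0) \<in> Inv" using LL_inversion[OF l0 v0 h] by blast
        have nc: "\<not> chosen h g g' l0 v" for v using nch(1)[OF l0] by blast
        note E0 = E[OF lv0 ins(1)[OF l0] ins(4)[OF v0] nc]
        have l_eq: "l = l0 \<and> v = v0" if l: "l \<in> LL" and v: "v \<in> CL" for l v
          using LL_inversion[OF l v h] E0[OF _ hi ins(1)[OF l] nch(3)[OF h nh[OF l]]]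
            E0[OF _ ins(1)[OF l] ins(4)[OF v] nch(1)[OF l]] LL_notin[OF l0] h by blast
        have LL: "LL = {l0}" and CL1: "CL = {v0}" using l_eq l0 v0 by blast+
        have "lowleft pos val LL LH"
        proof -
          have "pos l0 < pos h" using not_hl0 l0 h pos_eq[of l0 h] ab by (force simp: invs_def box_def)
          moreover have "val l0 < val h" using l0 h ab by (auto simp: box_def)
          ultimately show ?thesis unfolding LL LH lowleft_def by blast
        qed
        moreover have "lowleft pos val LL LM"
        proof -
          have "pos l0 < pos u" if u: "u \<in> LM" for u
          proof -
            have "(u, l0) \<notin> Inv"
              using two[OF u] E0[OF _ ins(2)[OF u] ins(4)[OF v0]] E0[OF _ ins(2)[OF u] ins(1)[OF l0]]
                LM_notin[OF u] l0 by blast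
            then show ?thesis using u l0 pos_eq[of u l0] by (force simp: invs_def box_def)
          qed
          then have "pos l0 < pos u \<and> val l0 < val u" if "u \<in> LM" for u
            using that l0 by (auto simp: box_def)
          then show ?thesis unfolding LL lowleft_def by blast
        qed
        moreover have "upleft pos val LL CL" using LL CL1 lv0 by (auto simp: upleft_def invs_def)
        ultimately show ?thesis
          using shape_3246175[OF RL RH LH1 _ _ _ RM] shape_325164[OF RL RH LH1 _ _ _ RM] LL CL1
          by (cases "LM = {}") (auto simp: one_sided_def)
      qed
    qed
  qed
qed

text \<open>
  With an upper left point \<open>h\<close> and a lower right point \<open>r\<close> the inversion \<open>(h, r)\<close> is the one in excess,
  when \<open>r\<close> is used as partner of all points of \<open>LM\<close> and \<open>CH\<close>. So there are no other inversions
  between cells, and avoidance decides which cells can coexist.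
\<close>

lemma two_sided_shapes:
  assumes "LH \<noteq> {}" "RL \<noteq> {}"
  shows "shaped S pos val [3, 5, 1, 6, 2, 4] sizes10 \<or> shaped S pos val [3, 5, 1, 7, 2, 6, 4] sizes11 \<or>
    shaped S pos val [4, 2, 6, 1, 7, 3, 5] sizes12"
proof -
  obtain h r where h: "h \<in> LH" and r: "r \<in> RL" using assms by blast
  have disj: "r \<notin> X4" "h \<notin> X4" "r \<notin> LM" "r \<notin> CH" "r \<notin> CL" "r \<notin> RM" "h \<notin> LM" "h \<notin> CH"
    using insideD[OF ins(3)[OF h]] insideD[OF ins(6)[OF r]] LH_notin[OF h] RL_notin[OF r] by blast+
  have *: "(u, r) \<in> Inv \<and> r \<notin> X4" if "u \<in> LM" for u using LM_above(2)[OF that r] disj by blast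
  have **: "(u, r) \<in> Inv \<and> r \<notin> X4" if "u \<in> CH" for u
    using that r ab cd disj(1) by (auto simp: invs_def box_def)
  have hr: "(h, r) \<in> Inv" using LH_above(3) h r by blast
  have nc: "\<not> chosen h (\<lambda>_. r) (\<lambda>_. r) h r" using disj unfolding chosen_def by blast
  have only: "(u = h \<or> u \<in> LM \<union> CH) \<and> v = r \<or> u = h \<and> v \<in> CL \<union> RM" if "(u, v) \<in> Inv" "u \<in> inside"
      "v \<in> inside" for u v
    using at_most_one_unchosen[OF h * ** that(1) insideD[OF that(2)] insideD[OF that(3)] _ hr
        disj(2) disj(1) nc]
    unfolding chosen_def by blast
  have LH: "LH = {h}"
  proof -
    have "u = h" if u: "u \<in> LH" for u
      using only[OF LH_above(3)[OF u r] ins(3)[OF u] ins(6)[OF r]] LH_notin[OF u] by blast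
    then show ?thesis using h by blast
  qed
  have RL: "RL = {r}"
  proof -
    have "v = r" if v: "v \<in> RL" for v
      using only[OF LH_above(3)[OF h v] ins(3)[OF h] ins(6)[OF v]] RL_notin[OF v] by blast
    then show ?thesis using r by blast
  qed
  have LLn: "(u, v) \<notin> Inv \<and> (v, u) \<notin> Inv" if "u \<in> LL \<union> RH" "v \<in> inside" for u v
  proof -
    have "u \<in> inside" "u \<noteq> h" "u \<noteq> r" "u \<notin> LM \<union> CH" "u \<notin> CL \<union> RM"
      using that(1) h r ins(1)[of u] ins(8)[of u] LL_notin[of u] RH_notin[of u] by blast+
    then show ?thesis using only[of u v] only[of v u] that by blast
  qed
  have LL_LH: "lowleft pos val LL LH" and LH_RH: "lowleft pos val LH RH"
    and LL_RL: "lowleft pos val LL RL" and RL_RH: "lowleft pos val RL RH"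
    and LL_CL: "lowleft pos val LL CL" and LL_LM: "lowleft pos val LL LM"
    and RM_RH: "lowleft pos val RM RH" and CH_RH: "lowleft pos val CH RH"
  proof -
    have ll: "lowleft pos val X Y" if "X \<subseteq> inside" "Y \<subseteq> inside" "X = LL \<or> Y = RH"
      "(\<forall>u\<in>X. \<forall>v\<in>Y. pos u < pos v) \<or> (\<forall>u\<in>X. \<forall>v\<in>Y. val u < val v)" for X Y
      unfolding lowleft_def
    proof (intro ballI)
      fix u v assume uv: "u \<in> X" "v \<in> Y"
      have n: "(u, v) \<notin> Inv" "(v, u) \<notin> Inv" using LLn[of u v] LLn[of v u] that(1-3) uv by blast+
      have "u \<noteq> v" using that(4) uv by blast
      moreover have S: "u \<in> S" "v \<in> S" using that(1,2) uv by (auto simp: inside_def box_def)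
      ultimately have "pos u \<noteq> pos v" "val u \<noteq> val v" using pos_eq val_eq by blast+
      then show "pos u < pos v \<and> val u < val v"
        using that(4) uv n S unfolding invs_def by force
    qed
    have sub: "LL \<subseteq> inside" "LM \<subseteq> inside" "LH \<subseteq> inside" "CL \<subseteq> inside" "CH \<subseteq> inside" "RL \<subseteq> inside"
        "RM \<subseteq> inside" "RH \<subseteq> inside"
      using ins by blast+
    show "lowleft pos val LL LH" by (rule ll[OF sub(1,3)]) (use ab cd in \<open>blast, force simp: box_def\<close>)
    show "lowleft pos val LH RH" by (rule ll[OF sub(3,8)]) (use ab cd in \<open>blast, force simp: box_def\<close>)
    show "lowleft pos val LL RL" by (rule ll[OF sub(1,6)]) (use ab cd in \<open>blast, force simp: box_def\<close>)
    show "lowleft pos val RL RH" by (rule ll[OF sub(6,8)]) (use ab cd in \<open>blast, force simp: box_def\<close>)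
    show "lowleft pos val LL CL" by (rule ll[OF sub(1,4)]) (use ab cd in \<open>blast, force simp: box_def\<close>)
    show "lowleft pos val LL LM" by (rule ll[OF sub(1,2)]) (use ab cd in \<open>blast, force simp: box_def\<close>)
    show "lowleft pos val RM RH" by (rule ll[OF sub(7,8)]) (use ab cd in \<open>blast, force simp: box_def\<close>)
    show "lowleft pos val CH RH" by (rule ll[OF sub(5,8)]) (use ab cd in \<open>blast, force simp: box_def\<close>)
  qed
  have ch: "chain pos val X" if "X = LL \<or> X = RH" for X
    unfolding chain_def
  proof (intro ballI impI)
    fix u v assume uv: "u \<in> X" "v \<in> X" "pos u < pos v"
    have "(u, v) \<notin> Inv" using LLn[of u v] ins(1)[of v] ins(8)[of v] that uv by blast
    moreover have "u \<in> S" "v \<in> S" using that uv by (auto simp: box_def)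
    ultimately show "val u < val v" using uv(3) val_eq[of u v] unfolding invs_def by force
  qed
  have chLL: "chain pos val LL" and chRH: "chain pos val RH" using ch by blast+
  have LL_ex: "LM = {} \<and> CL = {} \<and> RH = {}" if ne: "LL \<noteq> {}"
  proof (rule ccontr)
    obtain l where l: "l \<in> LL" using ne by blast
    assume "\<not> ?thesis"
    then consider u where "u \<in> LM" | u where "u \<in> CL" | u where "u \<in> RH" by blast
    then show False
    proof cases
      case 1
      then have "pos l < pos u" "val l < val r"
        using l r LL_LM LL_RL unfolding lowleft_def by blast+
      then show False using no_1324[of l u r b] l r 1 ex_in ab cd by (auto simp: box_def)
    next
      case 2
      then have "pos l < pos h" "val l < val u"
        using l h LL_LH LL_CL unfolding lowleft_def by blast+
      then show False using no_1324[of l h u d] l h 2 ex_in ab cd by (auto simp: box_def)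
    next
      case 3
      then have "pos l < pos h" "val l < val r" "val h < val u" "pos r < pos u"
        using l h r LL_LH LL_RL LH_RH RL_RH unfolding lowleft_def by blast+
      then show False using no_1324[of l h r u] l h r 3 ab cd by (auto simp: box_def)
    qed
  qed
  have RH_ex: "RM = {} \<and> CH = {}" if ne: "RH \<noteq> {}"
  proof (rule ccontr)
    obtain x where x: "x \<in> RH" using ne by blast
    assume "\<not> ?thesis"
    then consider u where "u \<in> RM" | u where "u \<in> CH" by blast
    then show False
    proof cases
      case 1
      then have "pos u < pos x" "val h < val x"
        using x h RM_RH LH_RH unfolding lowleft_def by blast+
      then show False using no_1324[of a h u x] x h 1 ex_in ab cd by (auto simp: box_def)
    next
      case 2
      then have "pos r < pos x" "val u < val x"
        using x r CH_RH RL_RH unfolding lowleft_def by blast+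
      then show False using no_1324[of c u r x] x r 2 ex_in ab cd by (auto simp: box_def)
    qed
  qed
  have 1: "card LH = 1" "card RL = 1" using LH RL by auto
  show ?thesis
    using shape_351624[OF 1] shape_3517264[OF 1 _ _ _ _ chRH LH_RH RL_RH] shape_4261735[OF 1 _ _ _ _
        chLL LL_LH LL_RL] LL_ex RH_ex
    by blast
qed

theorem crossing_shapes:
  "one_sided S pos val \<or> one_sided S (\<lambda>u. - val u) (\<lambda>u. - pos u) \<or>
   one_sided S val pos \<or> one_sided S (\<lambda>u. - pos u) (\<lambda>u. - val u) \<or>
   shaped S pos val [3, 5, 1, 6, 2, 4] sizes10 \<or> shaped S pos val [3, 5, 1, 7, 2, 6, 4] sizes11 \<or>
   shaped S pos val [4, 2, 6, 1, 7, 3, 5] sizes12"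
proof -
  interpret f: crossing S "\<lambda>u. - val u" "\<lambda>u. - pos u" d c b a by (rule antiflip')
  interpret s: crossing S val pos c d a b by (rule swap')
  interpret sf: crossing S "\<lambda>u. - pos u" "\<lambda>u. - val u" b a d c by (rule s.antiflip')
  have f: "f.RL = RL" "f.RM = CL" "f.RH = LL" by (auto simp: box_def)
  have s: "s.RL = LH" "s.RM = CH" "s.RH = RH" "s.CL = LM" "s.LL = LL" by (auto simp: box_def)
  have sf: "sf.RL = LH" "sf.RM = LM" "sf.RH = LL" by (auto simp: box_def)
  show ?thesis
  proof (cases "RL = {}")
    case True
    then show ?thesis using one_end_plain(2)[OF True] one_sided_shapes f.one_sided_shapes
        unfolding f by blast
  next
    case RL: False
    show ?thesis
    proof (cases "LH = {}")
      case True
      then show ?thesis using s.one_end_plain(2) s.one_sided_shapes sf.one_sided_shapes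
          unfolding s sf by blast
    next
      case False
      then show ?thesis using two_sided_shapes RL by blast
    qed
  qed
qed

end


section \<open>Permutations as point sets\<close>

text \<open>
  The values \<open>1, \<dots>, n\<close> serve as points, ordered by value and by place. Deleting an entry is then simply
  removing a point.
\<close>

definition place :: "nat list \<Rightarrow> nat \<Rightarrow> nat" where
  "place \<pi> v = (THE i. i < length \<pi> \<and> \<pi> ! i = v)"

abbreviation "pl \<pi> \<equiv> (\<lambda>v. int (place \<pi> v))"

lemma place_nth: "distinct \<pi> \<Longrightarrow> i < length \<pi> \<Longrightarrow> place \<pi> (\<pi> ! i) = i"
  unfolding place_def by (rule the_equality) (auto simp: nth_eq_iff_index_eq)

lemma nth_place:
  assumes "distinct \<pi>" "v \<in> set \<pi>"
  shows "place \<pi> v < length \<pi>" "\<pi> ! place \<pi> v = v"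
  using assms place_nth by (auto simp: in_set_conv_nth)

lemma inj_on_place: "distinct \<pi> \<Longrightarrow> inj_on (place \<pi>) (set \<pi>)"
  by (metis inj_onI nth_place(2))

lemma sorted_place: "distinct \<pi> \<Longrightarrow> sorted_wrt (\<lambda>u w. pl \<pi> u < pl \<pi> w) \<pi>"
  by (auto simp: sorted_wrt_iff_nth_less place_nth)

lemma inversions_eq:
  assumes "distinct \<pi>"
  shows "inversions \<pi> = card (invs (pl \<pi>) int (set \<pi>))"
  unfolding inversions_def
proof (rule bij_betw_same_card[of "\<lambda>(i, j). (\<pi> ! i, \<pi> ! j)"])
  let ?A = "{(i, j). i < j \<and> j < length \<pi> \<and> \<pi> ! j < \<pi> ! i}"
  show "bij_betw (\<lambda>(i, j). (\<pi> ! i, \<pi> ! j)) ?A (invs (pl \<pi>) int (set \<pi>))"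
    unfolding bij_betw_def
  proof
    show "inj_on (\<lambda>(i, j). (\<pi> ! i, \<pi> ! j)) ?A"
      using assms by (auto simp: inj_on_def nth_eq_iff_index_eq)
    show "(\<lambda>(i, j). (\<pi> ! i, \<pi> ! j)) ` ?A = invs (pl \<pi>) int (set \<pi>)"
    proof (rule set_eqI, rule iffI)
      fix e assume "e \<in> invs (pl \<pi>) int (set \<pi>)"
      then obtain u w where e: "e = (u, w)" "u \<in> set \<pi>" "w \<in> set \<pi>" "place \<pi> u < place \<pi> w" "w < u"
        by (auto simp: invs_def)
      then have "(place \<pi> u, place \<pi> w) \<in> ?A" using nth_place[OF assms] by auto
      moreover have "e = (\<lambda>(i, j). (\<pi> ! i, \<pi> ! j)) (place \<pi> u, place \<pi> w)"
          using e nth_place[OF assms] by auto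
      ultimately show "e \<in> (\<lambda>(i, j). (\<pi> ! i, \<pi> ! j)) ` ?A" by blast
    qed (use assms in \<open>auto simp: invs_def place_nth\<close>)
  qed
qed

lemma avoids_eq:
  assumes "distinct \<pi>"
  shows "avoids_1324 \<pi> \<longleftrightarrow> avoids (pl \<pi>) int (set \<pi>)"
proof
  assume A: "avoids_1324 \<pi>"
  show "avoids (pl \<pi>) int (set \<pi>)"
    unfolding avoids_def
  proof clarify
    fix x y z t assume "x \<in> set \<pi>" "y \<in> set \<pi>" "z \<in> set \<pi>" "t \<in> set \<pi>" "pl \<pi> x < pl \<pi> y" "pl \<pi> y < pl \<pi> z"
      "pl \<pi> z < pl \<pi> t" "int x < int z" "int z < int y" "int y < int t"
    then show False using A nth_place[OF assms] unfolding avoids_1324_def by (metis of_nat_less_iff)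
  qed
next
  assume A: "avoids (pl \<pi>) int (set \<pi>)"
  show "avoids_1324 \<pi>"
    unfolding avoids_1324_def
  proof clarify
    fix i j k l assume "i < j" "j < k" "k < l" "l < length \<pi>" "\<pi> ! i < \<pi> ! k" "\<pi> ! k < \<pi> ! j"
        "\<pi> ! j < \<pi> ! l"
    then show False
      using avoidsD[OF A, of "\<pi> ! i" "\<pi> ! j" "\<pi> ! k" "\<pi> ! l"] assms by (auto simp: place_nth)
  qed
qed

text \<open>
  Decomposability without reference to the entries being an initial segment, hence unaffected by
  standardization.
\<close>

definition splits :: "nat list \<Rightarrow> bool" where
  "splits ys \<longleftrightarrow> (\<exists>us vs. ys = us @ vs \<and> us \<noteq> [] \<and> vs \<noteq> [] \<and> (\<forall>u\<in>set us. \<forall>w\<in>set vs. u < w))"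

lemma conn_iff_splits:
  assumes s: "sorted_wrt (\<lambda>u w. pos u < pos w) ys"
  shows "conn pos int (set ys) \<longleftrightarrow> \<not> splits ys"
proof
  assume c: "conn pos int (set ys)"
  show "\<not> splits ys"
  proof
    assume "splits ys"
    then obtain us vs where uv: "ys = us @ vs" "us \<noteq> []" "vs \<noteq> []" "\<forall>u\<in>set us. \<forall>w\<in>set vs. u < w"
      by (auto simp: splits_def)
    have p: "\<forall>u\<in>set us. \<forall>w\<in>set vs. pos u < pos w" using s uv(1) by (simp add: sorted_wrt_append)
    have d: "set us \<inter> set vs = {}" using uv(4) by auto
    obtain u w where "u \<in> set us" "w \<in> set ys" "w \<notin> set us" "\<not> (pos u < pos w \<and> int u < int w)"
      by (rule conn_cut[OF c, of "set us" "hd us" "hd vs"]) (use uv d in \<open>auto simp: disjoint_iff\<close>)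
    then show False using uv p by auto
  qed
next
  assume n: "\<not> splits ys"
  show "conn pos int (set ys)"
    unfolding conn_def
  proof (rule notI, elim exE conjE)
    fix U assume U: "U \<noteq> {}" "U \<subset> set ys" "\<forall>u\<in>U. \<forall>w\<in>set ys - U. pos u < pos w \<and> int u < int w"
    let ?us = "takeWhile (\<lambda>y. y \<in> U) ys" and ?vs = "dropWhile (\<lambda>y. y \<in> U) ys"
    have ys: "ys = ?us @ ?vs" by simp
    have vs: "?vs \<noteq> []" using U(2) by auto
    have h: "hd ?vs \<notin> U" "hd ?vs \<in> set ys" using hd_dropWhile[OF vs] vs hd_in_set[OF vs]
        set_dropWhileD by fast+
    have s2: "sorted_wrt (\<lambda>u w. pos u < pos w) ?vs" using s ys sorted_wrt_append by metis
    have no: "z \<notin> U" if z: "z \<in> set ?vs" for z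
    proof
      assume zU: "z \<in> U"
      then have "z \<in> set (tl ?vs)" using z h vs by (cases ?vs) auto
      then have "pos (hd ?vs) < pos z" using s2 vs by (cases ?vs) auto
      then show False using bspec[OF bspec[OF U(3) zU], of "hd ?vs"] h by auto
    qed
    have "?us \<noteq> []"
    proof
      assume "?us = []"
      then have vs_ys: "?vs = ys" using ys by simp
      obtain z where "z \<in> U" "z \<in> set ys" using U(1,2) by blast
      then show False using no[of z] unfolding vs_ys by blast
    qed
    moreover have "\<forall>u\<in>set ?us. \<forall>w\<in>set ?vs. u < w"
      using U(3) no set_takeWhileD set_dropWhileD by (metis (full_types) DiffI of_nat_less_iff)
    ultimately show False using n ys vs unfolding splits_def by blast
  qed
qed

text \<open>
  Standardization replaces each entry by its rank, which preserves the order.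
\<close>

lemma decomposable_standardize:
  assumes d: "distinct ys"
  shows "decomposable (standardize ys) \<longleftrightarrow> splits ys"
proof -
  define r where "r x = card {y \<in> set ys. y \<le> x}" for x
  have std: "standardize ys = map r ys" unfolding standardize_def r_def by simp
  have mono: "r u < r w" if "u \<in> set ys" "w \<in> set ys" "u < w" for u w
  proof -
    have "{y \<in> set ys. y \<le> u} \<subseteq> {y \<in> set ys. y \<le> w}" "w \<in> {y \<in> set ys. y \<le> w}" "w \<notin> {y \<in> set ys. y \<le> u}"
      using that by auto
    then have "{y \<in> set ys. y \<le> u} \<subset> {y \<in> set ys. y \<le> w}" by blast
    then show ?thesis unfolding r_def by (intro psubset_card_mono) auto
  qed
  have pos: "1 \<le> r u" if "u \<in> set ys" for u
    unfolding r_def using that by (auto simp: Suc_le_eq card_gt_0_iff)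
  have inj: "inj_on r (set ys)" by (rule inj_onI) (metis mono less_irrefl linorder_neqE_nat)
  show ?thesis
  proof
    assume "decomposable (standardize ys)"
    then obtain j where j: "1 \<le> j" "j < length ys" "r ` set (take j ys) = {1..j}"
      unfolding decomposable_def std by (auto simp: take_map)
    have "u < w" if u: "u \<in> set (take j ys)" and w: "w \<in> set (drop j ys)" for u w
    proof -
      have uw: "u \<in> set ys" "w \<in> set ys" using u w in_set_takeD in_set_dropD by fast+
      have "w \<notin> set (take j ys)" using w d set_take_disj_set_drop_if_distinct[of ys j j] by auto
      have "r w \<notin> {1..j}"
      proof
        assume "r w \<in> {1..j}"
        then obtain x where x: "x \<in> set (take j ys)" "r w = r x" unfolding j(3)[symmetric] by blast
        then have "w = x" using inj uw(2) in_set_takeD[of x j ys] by (auto dest: inj_onD)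
        then show False using x \<open>w \<notin> set (take j ys)\<close> by blast
      qed
      moreover have "r u \<in> {1..j}" using u j(3) by blast
      ultimately have "r u < r w" using pos[OF uw(2)] by auto
      then show ?thesis using mono[OF uw(2,1)] uw by (metis linorder_neqE_nat less_asym)
    qed
    then have "\<forall>u\<in>set (take j ys). \<forall>w\<in>set (drop j ys). u < w" by blast
    moreover have "take j ys \<noteq> []" "drop j ys \<noteq> []" "ys = take j ys @ drop j ys" using j by auto
    ultimately show "splits ys" unfolding splits_def by blast
  next
    assume "splits ys"
    then obtain us vs where uv: "ys = us @ vs" "us \<noteq> []" "vs \<noteq> []" "\<forall>u\<in>set us. \<forall>w\<in>set vs. u < w"
      by (auto simp: splits_def)
    have sub: "r ` set us \<subseteq> {1..length us}"
    proof
      fix k assume "k \<in> r ` set us"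
      then obtain u where u: "u \<in> set us" "k = r u" by auto
      have "{y \<in> set ys. y \<le> u} \<subseteq> set us" using uv(1,4) u(1) by force
      then have "r u \<le> card (set us)" unfolding r_def by (intro card_mono) auto
      then show "k \<in> {1..length us}" using u pos[of u] uv(1) card_length[of us] by auto
    qed
    have "card (r ` set us) = length us"
      using inj d uv(1) by (subst card_image) (auto simp: inj_on_def distinct_card)
    then have "r ` set us = {1..length us}" using sub by (intro card_subset_eq) auto
    then show "decomposable (standardize ys)"
      unfolding decomposable_def std using uv by (intro exI[of _ "length us"]) (auto simp: Suc_le_eq)
  qed
qed

lemma permD:
  assumes "\<pi> \<in> permutations_of_set {1..n}"
  shows "distinct \<pi>" "set \<pi> = {1..n}" "length \<pi> = n"
  using assms distinct_card[of \<pi>] by (auto simp: permutations_of_set_def)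

lemma decomposable_iff_splits:
  assumes "\<pi> \<in> permutations_of_set {1..n}"
  shows "decomposable \<pi> \<longleftrightarrow> splits \<pi>"
proof -
  have "card {y \<in> {1..n}. y \<le> x} = x" if "x \<in> {1..n}" for x
  proof -
    have "{y \<in> {1..n}. y \<le> x} = {1..x}" using that by auto
    then show ?thesis by simp
  qed
  then have "standardize \<pi> = \<pi>"
    unfolding standardize_def permD(2)[OF assms] by (intro map_idI) (simp only: permD(2)[OF assms])
  then show ?thesis using decomposable_standardize[of \<pi>] permD[OF assms] by simp
qed

text \<open>
  The defining properties of residuals at defect 2, phrased symmetrically in the two orders.
\<close>

definition residual_points :: "'a set \<Rightarrow> ('a \<Rightarrow> int) \<Rightarrow> ('a \<Rightarrow> int) \<Rightarrow> bool" where
  "residual_points S pos val \<longleftrightarrow> avoids pos val S \<and> conn pos val S \<and>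
    (\<forall>x\<in>S. (\<forall>u\<in>S. pos x \<le> pos u) \<or> (\<forall>u\<in>S. pos u \<le> pos x) \<or> (\<forall>u\<in>S. val x \<le> val u) \<or> (\<forall>u\<in>S. val u \<le> val x)
       \<longrightarrow> conn pos val (S - {x})) \<and>
    card (invs pos val S) + 5 = 2 * card S"

lemma residuals_2_iff:
  "\<pi> \<in> residuals 2 n \<longleftrightarrow> \<pi> \<in> permutations_of_set {1..n} \<and> residual_points {1..n} (pl \<pi>) int"
proof (cases "\<pi> \<in> permutations_of_set {1..n}")
  case True
  note \<pi> = permD[OF True]
  have inv: "int (inversions \<pi>) = 2 * int n - 7 + 2 \<longleftrightarrow> card (invs (pl \<pi>) int {1..n}) + 5 = 2 * card {1..n}"
    using inversions_eq[OF \<pi>(1)] \<pi>(2) by auto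
  show ?thesis
  proof (cases "n = 0")
    case True
    then show ?thesis using inv by (auto simp: residuals_def Av1324_def residual_points_def)
  next
    case n: False
    then have ne: "\<pi> \<noteq> []" using \<pi> by auto
    have dec: "decomposable \<pi> \<longleftrightarrow> \<not> conn (pl \<pi>) int {1..n}"
      using decomposable_iff_splits[OF True] conn_iff_splits[OF sorted_place[OF \<pi>(1)]] \<pi>(2) by simp
    have del: "decomposable (delete_entry \<pi> x) \<longleftrightarrow> \<not> conn (pl \<pi>) int ({1..n} - {x})" for x
    proof -
      have "sorted_wrt (\<lambda>u w. pl \<pi> u < pl \<pi> w) (removeAll x \<pi>)"
        unfolding removeAll_filter_not_eq by (rule sorted_wrt_filter[OF sorted_place[OF \<pi>(1)]])
      from conn_iff_splits[OF this] show ?thesis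
        using decomposable_standardize[OF distinct_removeAll[OF \<pi>(1)], of x] \<pi>(2)
            by (simp add: delete_entry_def)
    qed
    have ext: "(\<forall>u\<in>{1..n}. pl \<pi> x \<le> pl \<pi> u) \<longleftrightarrow> x = hd \<pi>" "(\<forall>u\<in>{1..n}. pl \<pi> u \<le> pl \<pi> x) \<longleftrightarrow> x = last \<pi>"
      "(\<forall>u\<in>{1..n}. int x \<le> int u) \<longleftrightarrow> x = 1" "(\<forall>u\<in>{1..n}. int u \<le> int x) \<longleftrightarrow> x = n" if x: "x \<in> {1..n}" for x
    proof -
      have h: "hd \<pi> = \<pi> ! 0" "last \<pi> = \<pi> ! (n - 1)" using ne \<pi>(3) by (auto simp: hd_conv_nth last_conv_nth)
      have p0: "place \<pi> (hd \<pi>) = 0" "place \<pi> (last \<pi>) = n - 1"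
        unfolding h using place_nth[OF \<pi>(1)] n \<pi>(3) by auto
      have mem: "hd \<pi> \<in> {1..n}" "last \<pi> \<in> {1..n}" using ne \<pi>(2) hd_in_set last_in_set by auto
      have lt: "place \<pi> u < n" if "u \<in> {1..n}" for u using nth_place(1)[OF \<pi>(1)] that \<pi> by auto
      have ij: "place \<pi> u = place \<pi> w \<longleftrightarrow> u = w" if "u \<in> {1..n}" "w \<in> {1..n}" for u w
        using inj_on_place[OF \<pi>(1)] that \<pi>(2) by (auto dest: inj_onD)
      show "(\<forall>u\<in>{1..n}. pl \<pi> x \<le> pl \<pi> u) \<longleftrightarrow> x = hd \<pi>"
        using p0(1) mem(1) ij[OF x mem(1)] by force
      show "(\<forall>u\<in>{1..n}. pl \<pi> u \<le> pl \<pi> x) \<longleftrightarrow> x = last \<pi>"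
      proof
        assume "\<forall>u\<in>{1..n}. pl \<pi> u \<le> pl \<pi> x"
        then have "pl \<pi> (last \<pi>) \<le> pl \<pi> x" using mem(2) by blast
        then have "n - 1 \<le> place \<pi> x" using p0(2) by simp
        then have "place \<pi> x = place \<pi> (last \<pi>)" using lt[OF x] p0(2) by simp
        then show "x = last \<pi>" using ij[OF x mem(2)] by simp
      next
        assume x: "x = last \<pi>"
        have "pl \<pi> u \<le> pl \<pi> x" if "u \<in> {1..n}" for u
          using lt[OF that] p0(2) unfolding x by linarith
        then show "\<forall>u\<in>{1..n}. pl \<pi> u \<le> pl \<pi> x" by blast
      qed
      have "1 \<in> {1..n}" "n \<in> {1..n}" using n by auto
      then show "(\<forall>u\<in>{1..n}. int x \<le> int u) \<longleftrightarrow> x = 1" "(\<forall>u\<in>{1..n}. int u \<le> int x) \<longleftrightarrow> x = n"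
        using x by fastforce+
    qed
    have mem: "hd \<pi> \<in> {1..n}" "last \<pi> \<in> {1..n}" "1 \<in> {1..n}" "n \<in> {1..n}"
        using ne \<pi>(2) hd_in_set last_in_set n by auto
    let ?C = "\<lambda>x. conn (pl \<pi>) int ({1..n} - {x})"
    have "(\<forall>x\<in>{1..n}. (\<forall>u\<in>{1..n}. pl \<pi> x \<le> pl \<pi> u) \<or> (\<forall>u\<in>{1..n}. pl \<pi> u \<le> pl \<pi> x) \<or>
        (\<forall>u\<in>{1..n}. int x \<le> int u) \<or> (\<forall>u\<in>{1..n}. int u \<le> int x) \<longrightarrow> ?C x) \<longleftrightarrow>
      (\<forall>x\<in>{1..n}. x = hd \<pi> \<or> x = last \<pi> \<or> x = 1 \<or> x = n \<longrightarrow> ?C x)"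
      by (intro ball_cong refl) (simp only: ext)
    also have "\<dots> \<longleftrightarrow> ?C 1 \<and> ?C n \<and> ?C (hd \<pi>) \<and> ?C (last \<pi>)"
      using mem by blast
    finally have C: "(\<forall>x\<in>{1..n}. (\<forall>u\<in>{1..n}. pl \<pi> x \<le> pl \<pi> u) \<or> (\<forall>u\<in>{1..n}. pl \<pi> u \<le> pl \<pi> x) \<or>
        (\<forall>u\<in>{1..n}. int x \<le> int u) \<or> (\<forall>u\<in>{1..n}. int u \<le> int x) \<longrightarrow> ?C x) \<longleftrightarrow>
      ?C 1 \<and> ?C n \<and> ?C (hd \<pi>) \<and> ?C (last \<pi>)" .
    have av: "avoids_1324 \<pi> \<longleftrightarrow> avoids (pl \<pi>) int {1..n}" using avoids_eq[OF \<pi>(1)] \<pi>(2) by simp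
    have "\<pi> \<in> residuals 2 n \<longleftrightarrow> avoids_1324 \<pi> \<and> int (inversions \<pi>) = 2 * int n - 7 + 2 \<and> \<not> decomposable \<pi> \<and>
        \<not> decomposable (delete_entry \<pi> 1) \<and> \<not> decomposable (delete_entry \<pi> n) \<and>
        \<not> decomposable (delete_entry \<pi> (hd \<pi>)) \<and> \<not> decomposable (delete_entry \<pi> (last \<pi>))"
      unfolding residuals_def Av1324_def almost_decomposable_def using True \<pi>(3) by auto
    then show ?thesis
      unfolding residual_points_def C inv dec del av using True by blast
  qed
qed (auto simp: residuals_def Av1324_def)


section \<open>Recognizing an inflation\<close>

definition order_iso :: "('a \<Rightarrow> 'b) \<Rightarrow> 'a set \<Rightarrow> ('a \<Rightarrow> int) \<Rightarrow> ('a \<Rightarrow> int) \<Rightarrow> 'b set \<Rightarrow> ('b \<Rightarrow> int) \<Rightarrow> ('b \<Rightarrow>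
    int) \<Rightarrow> bool" where
  "order_iso f S pos val S' pos' val' \<longleftrightarrow> bij_betw f S S' \<and>
    (\<forall>u\<in>S. \<forall>w\<in>S. (pos' (f u) < pos' (f w) \<longleftrightarrow> pos u < pos w) \<and> (val' (f u) < val' (f w) \<longleftrightarrow> val u < val w))"

lemma conn_order_iso:
  assumes iso: "order_iso f S pos val S' pos' val'" and X: "X \<subseteq> S" and c: "conn pos val X"
  shows "conn pos' val' (f ` X)"
  unfolding conn_def
proof (rule notI, elim exE conjE)
  fix U assume U: "U \<noteq> {}" "U \<subset> f ` X" "\<forall>u\<in>U. \<forall>w\<in>f ` X - U. pos' u < pos' w \<and> val' u < val' w"
  let ?V = "{x \<in> X. f x \<in> U}"
  obtain u0 w0 where "u0 \<in> X" "f u0 \<in> U" "w0 \<in> X" "f w0 \<notin> U" using U(1,2) by blast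
  then obtain x y where xy: "x \<in> ?V" "y \<in> X" "y \<notin> ?V" "\<not> (pos x < pos y \<and> val x < val y)"
    using conn_cut[OF c, of ?V u0 w0] by blast
  then have "pos' (f x) < pos' (f y) \<and> val' (f x) < val' (f y)" using U(3) by blast
  then show False using xy X iso unfolding order_iso_def by blast
qed

lemma residual_points_order_iso:
  assumes iso: "order_iso f S pos val S' pos' val'" and r: "residual_points S pos val"
  shows "residual_points S' pos' val'"
proof -
  have S': "S' = f ` S" and inj: "inj_on f S" using iso unfolding order_iso_def bij_betw_def by auto
  have p: "pos' (f u) < pos' (f w) \<longleftrightarrow> pos u < pos w" and v: "val' (f u) < val' (f w) \<longleftrightarrow> val u < val w"
    if "u \<in> S" "w \<in> S" for u w using iso that unfolding order_iso_def by auto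
  have p': "pos' (f u) \<le> pos' (f w) \<longleftrightarrow> pos u \<le> pos w" and v': "val' (f u) \<le> val' (f w) \<longleftrightarrow> val u \<le> val w"
    if "u \<in> S" "w \<in> S" for u w using p[of w u] v[of w u] that by (auto simp: not_less[symmetric])
  have "avoids pos' val' S'"
    unfolding avoids_def
  proof clarify
    fix x' y' z' t' assume "x' \<in> S'" "y' \<in> S'" "z' \<in> S'" "t' \<in> S'"
      and o: "pos' x' < pos' y'" "pos' y' < pos' z'" "pos' z' < pos' t'" "val' x' < val' z'"
          "val' z' < val' y'" "val' y' < val' t'"
    then obtain x y z t where f: "x' = f x" "y' = f y" "z' = f z" "t' = f t" and xS: "x \<in> S" "y \<in> S"
        "z \<in> S" "t \<in> S"
      unfolding S' by blast
    have "avoids pos val S" using r unfolding residual_points_def by blast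
    from avoidsD[OF this xS] show False using o p v xS unfolding f by blast
  qed
  moreover have "conn pos' val' S'"
    using conn_order_iso[OF iso subset_refl] r unfolding S' residual_points_def by blast
  moreover have "conn pos' val' (S' - {x'})"
    if x': "x' \<in> S'" and ext: "(\<forall>u\<in>S'. pos' x' \<le> pos' u) \<or> (\<forall>u\<in>S'. pos' u \<le> pos' x') \<or>
      (\<forall>u\<in>S'. val' x' \<le> val' u) \<or> (\<forall>u\<in>S'. val' u \<le> val' x')" for x'
  proof -
    obtain x where x: "x \<in> S" "x' = f x" using x' S' by blast
    have "(\<forall>u\<in>S. pos x \<le> pos u) \<or> (\<forall>u\<in>S. pos u \<le> pos x) \<or> (\<forall>u\<in>S. val x \<le> val u) \<or> (\<forall>u\<in>S. val u \<le> val x)"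
      using ext p' v' x unfolding S' by simp
    then have "conn pos val (S - {x})"
      using r x(1) unfolding residual_points_def by blast
    moreover have "f ` (S - {x}) = S' - {x'}" using inj x S' by (auto simp: inj_on_def)
    ultimately show ?thesis using conn_order_iso[OF iso, of "S - {x}"] by auto
  qed
  moreover have "card (invs pos' val' S') = card (invs pos val S)"
  proof -
    have "invs pos' val' S' = (\<lambda>(u, w). (f u, f w)) ` invs pos val S"
      using p v unfolding S' invs_def by auto
    moreover have "inj_on (\<lambda>(u, w). (f u, f w)) (invs pos val S)"
      using inj by (auto simp: inj_on_def invs_def)
    ultimately show ?thesis by (simp add: card_image)
  qed
  moreover have "card S' = card S" using inj S' by (simp add: card_image)
  ultimately show ?thesis using r unfolding residual_points_def by auto
qed

lemma residual_points_swap: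
  assumes "residual_points S pos val" shows "residual_points S val pos"
proof -
  have cn: "conn val pos X = conn pos val X" for X by (simp only: conn_def conj_commute)
  have av: "avoids val pos S" using assms unfolding avoids_def residual_points_def by blast
  have "card (invs val pos S) = card (invs pos val S)"
    by (rule bij_betw_same_card[of prod.swap]) (auto simp: bij_betw_def invs_def inj_on_def)
  then show ?thesis using assms av unfolding residual_points_def cn by auto
qed

lemma inflates_order_iso:
  assumes iso: "order_iso f S pos val S' pos' val'" and i: "inflates S pos val \<tau> Bs"
  shows "inflates S' pos' val' \<tau> (map ((`) f) Bs)" "map card (map ((`) f) Bs) = map card Bs"
proof -
  have S': "S' = f ` S" and inj: "inj_on f S" using iso unfolding order_iso_def bij_betw_def by auto
  have sub: "B \<subseteq> S" if "B \<in> set Bs" for B using i that unfolding inflates_def by blast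
  have p: "pos' (f u) < pos' (f w) \<longleftrightarrow> pos u < pos w" and v: "val' (f u) < val' (f w) \<longleftrightarrow> val u < val w"
    if "u \<in> S" "w \<in> S" for u w using iso that unfolding order_iso_def by auto
  have ll: "lowleft pos' val' (f ` B) (f ` C) \<longleftrightarrow> lowleft pos val B C"
    and ul: "upleft pos' val' (f ` B) (f ` C) \<longleftrightarrow> upleft pos val B C" if "B \<in> set Bs" "C \<in> set Bs" for B C
  proof -
    have "B \<subseteq> S" "C \<subseteq> S" using sub that by blast+
    then show "lowleft pos' val' (f ` B) (f ` C) \<longleftrightarrow> lowleft pos val B C"
      "upleft pos' val' (f ` B) (f ` C) \<longleftrightarrow> upleft pos val B C"
      using p v unfolding lowleft_def upleft_def by (simp_all add: subset_iff)
  qed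
  have "chain pos' val' (f ` B)" if "B \<in> set Bs" for B
    using i that sub[OF that] p v unfolding inflates_def chain_def by (simp add: subset_iff)
  moreover have "sorted_wrt (block_order pos' val') (zip \<tau> (map ((`) f) Bs))"
    using i ll ul unfolding inflates_def sorted_wrt_iff_nth_less block_order_def by auto
  ultimately show "inflates S' pos' val' \<tau> (map ((`) f) Bs)"
    using i unfolding inflates_def S' by auto
  show "map card (map ((`) f) Bs) = map card Bs"
    using sub inj by (auto intro!: card_image intro: inj_on_subset)
qed

lemma inflatesD:
  assumes "inflates S pos val \<tau> Bs"
  shows "length Bs = length \<tau>"
    "i < j \<Longrightarrow> j < length \<tau> \<Longrightarrow> if \<tau> ! i < \<tau> ! j then lowleft pos val (Bs ! i) (Bs ! j) else upleft pos
        val (Bs ! i) (Bs ! j)"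
    "i < length \<tau> \<Longrightarrow> Bs ! i \<noteq> {}" "i < length \<tau> \<Longrightarrow> chain pos val (Bs ! i)" "i < length \<tau> \<Longrightarrow> Bs ! i \<subseteq> S"
proof -
  show l: "length Bs = length \<tau>" using assms by (simp add: inflates_def)
  show "i < j \<Longrightarrow> j < length \<tau> \<Longrightarrow> if \<tau> ! i < \<tau> ! j then lowleft pos val (Bs ! i) (Bs ! j) else upleft
      pos val (Bs ! i) (Bs ! j)"
    using assms l by (auto simp: inflates_def sorted_wrt_iff_nth_less block_order_def)
  show "i < length \<tau> \<Longrightarrow> Bs ! i \<noteq> {}" using assms l nth_mem[of i Bs] unfolding inflates_def by metis
  show "i < length \<tau> \<Longrightarrow> chain pos val (Bs ! i)" "i < length \<tau> \<Longrightarrow> Bs ! i \<subseteq> S"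
      using assms l nth_mem[of i Bs] by (auto simp: inflates_def)
qed

lemma inflates_pos_less:
  assumes "inflates S pos val \<tau> Bs" "i < j" "j < length \<tau>" "u \<in> Bs ! i" "w \<in> Bs ! j"
  shows "pos u < pos w"
  using inflatesD(2)[OF assms(1-3)] assms(4,5) by (auto simp: lowleft_def upleft_def split: if_splits)

lemma inflates_val_less_iff:
  assumes "inflates S pos val \<tau> Bs" "distinct \<tau>" "i < length \<tau>" "j < length \<tau>" "i \<noteq> j" "u \<in> Bs ! i"
      "w \<in> Bs ! j"
  shows "val u < val w \<longleftrightarrow> \<tau> ! i < \<tau> ! j"
proof -
  have ne: "\<tau> ! i \<noteq> \<tau> ! j" using assms by (simp add: nth_eq_iff_index_eq)
  show ?thesis
  proof (cases "i < j")
    case True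
    then show ?thesis using inflatesD(2)[OF assms(1) True assms(4)] assms(6,7)
      by (force simp: lowleft_def upleft_def split: if_splits)
  next
    case False
    then have "j < i" using assms(5) by simp
    then show ?thesis using inflatesD(2)[OF assms(1) _ assms(3)] assms(6,7) ne
      by (force simp: lowleft_def upleft_def split: if_splits)
  qed
qed

lemma inflates_block:
  assumes "inflates S pos val \<tau> Bs" "u \<in> S"
  obtains i where "i < length \<tau>" "u \<in> Bs ! i"
  using assms by (auto simp: inflates_def in_set_conv_nth)

lemma inflates_block_unique:
  assumes "inflates S pos val \<tau> Bs" "i < length \<tau>" "j < length \<tau>" "u \<in> Bs ! i" "u \<in> Bs ! j"
  shows "i = j"
  using inflates_pos_less[OF assms(1), of i j u u] inflates_pos_less[OF assms(1), of j i u u] assms(2-5)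
  by (cases i j rule: linorder_cases) auto

lemma card_blocks:
  assumes "inflates S pos val \<tau> Bs" "finite S" "J \<subseteq> {..<length \<tau>}"
  shows "card (\<Union>j\<in>J. Bs ! j) = (\<Sum>j\<in>J. card (Bs ! j))"
proof (rule card_UN_disjoint)
  show "finite J" using assms(3) finite_subset by blast
  show "\<forall>i\<in>J. finite (Bs ! i)" using inflatesD(5)[OF assms(1)] assms(2,3) finite_subset by blast
  show "\<forall>i\<in>J. \<forall>j\<in>J. i \<noteq> j \<longrightarrow> Bs ! i \<inter> Bs ! j = {}"
    using inflates_block_unique[OF assms(1)] assms(3) by blast
qed

lemma concat_nth:
  "i < length xss \<Longrightarrow> k < length (xss ! i) \<Longrightarrow> concat xss ! ((\<Sum>j<i. length (xss ! j)) + k) = xss ! i ! k"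
proof (induction xss arbitrary: i)
  case (Cons xs xss)
  show ?case
  proof (cases i)
    case 0
    then show ?thesis using Cons.prems by (simp add: nth_append)
  next
    case (Suc i')
    have "(\<Sum>j<Suc i'. length ((xs # xss) ! j)) = length xs + (\<Sum>j<i'. length (xss ! j))"
      by (simp add: sum.lessThan_Suc_shift del: sum.lessThan_Suc)
    then show ?thesis using Cons Suc by (simp add: nth_append)
  qed
qed simp

text \<open>
  The number of entries in the blocks below block \<open>i\<close>.
\<close>

definition offset :: "nat list \<Rightarrow> nat list \<Rightarrow> nat \<Rightarrow> nat" where
  "offset \<tau> bs i = (\<Sum>j | j < length \<tau> \<and> \<tau> ! j < \<tau> ! i. bs ! j)"

lemma iota_inflation_concat:
  assumes "length bs = length \<tau>"
  shows "iota_inflation \<tau> bs = concat (map (\<lambda>i. [Suc (offset \<tau> bs i)..<Suc (offset \<tau> bs i + bs !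
      i)]) [0..<length \<tau>])"
proof -
  have "map (\<lambda>x. x + k) [1..<Suc m] = [Suc k..<Suc (k + m)]" for k m
    by (rule nth_equalityI) (auto simp del: upt_Suc)
  moreover have "(\<Sum>j | j < length \<tau> \<and> \<tau> ! j < \<tau> ! i. length (map iota bs ! j)) = offset \<tau> bs i" for i
    unfolding offset_def by (rule sum.cong) (auto simp: assms iota_def)
  ultimately show ?thesis
    unfolding inflation_def by (intro arg_cong[where f = concat] map_cong) (auto simp: assms iota_def)
qed

lemma iota_inflation_nth:
  assumes "length bs = length \<tau>" "i < length \<tau>" "k < bs ! i"
  shows "iota_inflation \<tau> bs ! ((\<Sum>j<i. bs ! j) + k) = Suc (offset \<tau> bs i + k)"
proof -
  let ?xss = "map (\<lambda>i. [Suc (offset \<tau> bs i)..<Suc (offset \<tau> bs i + bs ! i)]) [0..<length \<tau>]"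
  have "(\<Sum>j<i. length (?xss ! j)) = (\<Sum>j<i. bs ! j)" using assms(2) by (intro sum.cong) auto
  then show ?thesis
    using concat_nth[of i ?xss k] assms by (simp add: iota_inflation_concat del: upt_Suc)
qed

lemma length_iota_inflation:
  assumes "length bs = length \<tau>"
  shows "length (iota_inflation \<tau> bs) = (\<Sum>j<length \<tau>. bs ! j)"
  by (simp add: iota_inflation_concat[OF assms] length_concat comp_def
      interv_sum_list_conv_sum_set_nat atLeast0LessThan del: upt_Suc)

text \<open>
  Place and value of a point are its ranks in the two orders. Both are counted blockwise: all earlier
  (respectively lower) blocks, plus the rank inside its own block, which is the same for both
  orders because a block is increasing.
\<close>

lemma iota_inflation_recognition:
  assumes \<pi>: "\<pi> \<in> permutations_of_set {1..n}" and i: "inflates {1..n} (pl \<pi>) int \<tau> Bs" and d: "distinct \<tau>"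
  shows "\<pi> = iota_inflation \<tau> (map card Bs)"
proof -
  note p = permD[OF \<pi>]
  note l = inflatesD(1)[OF i]
  let ?bs = "map card Bs" and ?t = "length \<tau>"
  have lb: "length ?bs = ?t" using l by simp
  have S: "{1..n} = (\<Union>j\<in>{..<?t}. Bs ! j)"
  proof -
    have "\<Union> (set Bs) = {1..n}" using i unfolding inflates_def by blast
    then show ?thesis using l by (auto simp: set_conv_nth)
  qed
  have len: "n = (\<Sum>j<?t. ?bs ! j)"
  proof -
    have "card {1..n} = (\<Sum>j<?t. card (Bs ! j))" unfolding S by (rule card_blocks[OF i]) auto
    moreover have "(\<Sum>j<?t. card (Bs ! j)) = (\<Sum>j<?t. ?bs ! j)" using l by (intro sum.cong) auto
    ultimately show ?thesis by simp
  qed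
  have key: "\<pi> ! q = iota_inflation \<tau> ?bs ! q" if q: "q < n" for q
  proof -
    define u where "u = \<pi> ! q"
    have u: "u \<in> {1..n}" "place \<pi> u = q" using q p nth_mem[of q \<pi>] place_nth[OF p(1), of q]
        unfolding u_def by auto
    obtain k where k: "k < ?t" "u \<in> Bs ! k" by (rule inflates_block[OF i u(1)])
    let ?B = "{w \<in> Bs ! k. w < u}"
    have fin: "finite (Bs ! k)" using inflatesD(5)[OF i k(1)] finite_subset by blast
    have inS: "w \<in> {1..n}" if "w \<in> Bs ! j" "j < ?t" for w j using inflatesD(5)[OF i that(2)] that(1)
        by blast
    have same: "place \<pi> w < place \<pi> u \<longleftrightarrow> w < u" if w: "w \<in> Bs ! k" for w
    proof -
      have ch: "chain (pl \<pi>) int (Bs ! k)" by (rule inflatesD(4)[OF i k(1)])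
      have "place \<pi> w = place \<pi> u \<longleftrightarrow> w = u"
        using inj_on_place[OF p(1)] inS[OF w k(1)] u(1) p(2) by (auto dest: inj_onD)
      then show ?thesis using ch w k(2) unfolding chain_def
        by (metis linorder_neqE_nat of_nat_less_iff order_less_asym)
    qed
    have q1: "card {w \<in> {1..n}. place \<pi> w < q} = q"
    proof -
      have "place \<pi> ` {w \<in> {1..n}. place \<pi> w < q} = {..<q}"
      proof (rule set_eqI, rule iffI)
        fix x assume "x \<in> {..<q}"
        then have "place \<pi> (\<pi> ! x) = x" "\<pi> ! x \<in> {1..n}"
            using q p nth_mem[of x \<pi>] place_nth[OF p(1), of x] by auto
        then show "x \<in> place \<pi> ` {w \<in> {1..n}. place \<pi> w < q}" using \<open>x \<in> {..<q}\<close> by force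
      qed auto
      moreover have "inj_on (place \<pi>) {w \<in> {1..n}. place \<pi> w < q}"
        by (rule inj_on_subset[OF inj_on_place[OF p(1)]]) (use p(2) in blast)
      ultimately show ?thesis using card_image[of "place \<pi>" "{w \<in> {1..n}. place \<pi> w < q}"] by simp
    qed
    have q2: "{w \<in> {1..n}. place \<pi> w < q} = (\<Union>j\<in>{..<k}. Bs ! j) \<union> ?B"
    proof (rule set_eqI, rule iffI)
      fix w assume w: "w \<in> {w \<in> {1..n}. place \<pi> w < q}"
      obtain j where j: "j < ?t" "w \<in> Bs ! j" by (rule inflates_block[OF i, of w]) (use w in auto)
      have "\<not> k < j" using inflates_pos_less[OF i _ j(1) k(2) j(2)] w u by auto
      then show "w \<in> (\<Union>j\<in>{..<k}. Bs ! j) \<union> ?B" using j w same[of w] u by (cases "j = k") auto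
    next
      fix w assume "w \<in> (\<Union>j\<in>{..<k}. Bs ! j) \<union> ?B"
      then show "w \<in> {w \<in> {1..n}. place \<pi> w < q}"
      proof
        assume "w \<in> (\<Union>j\<in>{..<k}. Bs ! j)"
        then obtain j where j: "j < k" "w \<in> Bs ! j" by auto
        then show ?thesis using inflates_pos_less[OF i j(1) k(1) j(2) k(2)] inS[OF j(2)] k(1) u by auto
      next
        assume "w \<in> ?B"
        then show ?thesis using same[of w] inS[of w k] k(1) u by auto
      qed
    qed
    have q3: "card ((\<Union>j\<in>{..<k}. Bs ! j) \<union> ?B) = card (\<Union>j\<in>{..<k}. Bs ! j) + card ?B"
    proof -
      have "finite (\<Union>j\<in>{..<k}. Bs ! j)" using finite_subset[OF inflatesD(5)[OF i]] k(1) by auto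
      moreover have "(\<Union>j\<in>{..<k}. Bs ! j) \<inter> ?B = {}"
      proof -
        have "w \<notin> Bs ! j" if "j < k" "w \<in> Bs ! k" for j w
          using inflates_block_unique[OF i _ k(1) _ that(2), of j] that(1) k(1) by force
        then show ?thesis by blast
      qed
      ultimately show ?thesis using fin by (intro card_Un_disjoint) auto
    qed
    have q4: "card (\<Union>j\<in>{..<k}. Bs ! j) = (\<Sum>j<k. ?bs ! j)"
    proof -
      have "card (\<Union>j\<in>{..<k}. Bs ! j) = (\<Sum>j<k. card (Bs ! j))" by (rule card_blocks[OF i]) (use k in auto)
      moreover have "(\<Sum>j<k. card (Bs ! j)) = (\<Sum>j<k. ?bs ! j)" using l k(1) by (intro sum.cong) auto
      ultimately show ?thesis by simp
    qed
    have q_eq: "q = (\<Sum>j<k. ?bs ! j) + card ?B"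
      using q1 unfolding q2 q3 q4 by (rule sym)
    let ?J = "{j. j < ?t \<and> \<tau> ! j < \<tau> ! k}"
    have u1: "card {w \<in> {1..n}. w \<le> u} = u"
    proof -
      have "{w \<in> {1..n}. w \<le> u} = {1..u}" using u by auto
      then show ?thesis by simp
    qed
    have u2: "{w \<in> {1..n}. w \<le> u} = (\<Union>j\<in>?J. Bs ! j) \<union> insert u ?B"
    proof (rule set_eqI, rule iffI)
      fix w assume w: "w \<in> {w \<in> {1..n}. w \<le> u}"
      obtain j where j: "j < ?t" "w \<in> Bs ! j" by (rule inflates_block[OF i, of w]) (use w in auto)
      show "w \<in> (\<Union>j\<in>?J. Bs ! j) \<union> insert u ?B"
      proof (cases "j = k")
        case False
        have "w \<noteq> u" using inflates_block_unique[OF i j(1) k(1) j(2)] k(2) False by blast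
        then have "\<tau> ! j < \<tau> ! k"
          using inflates_val_less_iff[OF i d j(1) k(1) False j(2) k(2)] w by auto
        then show ?thesis using j by auto
      qed (use j w in auto)
    next
      fix w assume "w \<in> (\<Union>j\<in>?J. Bs ! j) \<union> insert u ?B"
      then show "w \<in> {w \<in> {1..n}. w \<le> u}"
      proof
        assume "w \<in> (\<Union>j\<in>?J. Bs ! j)"
        then obtain j where j: "j < ?t" "\<tau> ! j < \<tau> ! k" "w \<in> Bs ! j" by auto
        then have "w < u" using inflates_val_less_iff[OF i d j(1) k(1) _ j(3) k(2)] by auto
        then show ?thesis using inS[OF j(3,1)] by auto
      qed (use inS[of _ k] k(1) u in auto)
    qed
    have u3: "card ((\<Union>j\<in>?J. Bs ! j) \<union> insert u ?B) = card (\<Union>j\<in>?J. Bs ! j) + card (insert u ?B)"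
    proof -
      have "finite (\<Union>j\<in>?J. Bs ! j)" using finite_subset[OF inflatesD(5)[OF i]] by auto
      moreover have "(\<Union>j\<in>?J. Bs ! j) \<inter> insert u ?B = {}"
      proof -
        have "w \<notin> Bs ! j" if "j \<in> ?J" "w \<in> Bs ! k" for j w
          using inflates_block_unique[OF i _ k(1) _ that(2), of j] that(1) by force
        then show ?thesis using k(2) by blast
      qed
      ultimately show ?thesis using fin by (intro card_Un_disjoint) auto
    qed
    have u4: "card (\<Union>j\<in>?J. Bs ! j) = offset \<tau> ?bs k"
    proof -
      have "card (\<Union>j\<in>?J. Bs ! j) = (\<Sum>j\<in>?J. card (Bs ! j))" by (rule card_blocks[OF i]) auto
      moreover have "(\<Sum>j\<in>?J. card (Bs ! j)) = (\<Sum>j\<in>?J. ?bs ! j)" using l by (intro sum.cong) auto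
      ultimately show ?thesis by (simp add: offset_def)
    qed
    have "card (insert u ?B) = Suc (card ?B)" using fin by simp
    then have u_eq: "u = offset \<tau> ?bs k + Suc (card ?B)"
      using u1 unfolding u2 u3 u4 by simp
    have "card ?B < ?bs ! k"
    proof -
      have "card ?B < card (Bs ! k)" by (rule psubset_card_mono[OF fin]) (use k in auto)
      then show ?thesis using l k(1) by simp
    qed
    from iota_inflation_nth[OF lb k(1) this] show ?thesis
      unfolding q_eq[symmetric] using u_eq u_def by simp
  qed
  show ?thesis
    by (rule nth_equalityI) (use key p len length_iota_inflation[OF lb] in auto)
qed


section \<open>Inversions, avoidance and connectedness of inflations\<close>

text \<open>
  The blocks are intervals of values, pairwise disjoint and ordered like the entries of \<open>\<tau>\<close>.
\<close>

lemma iota_inflation_inflates: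
  assumes d: "distinct \<tau>" and l: "length bs = length \<tau>" and pos: "\<And>b. b \<in> set bs \<Longrightarrow> 1 \<le> b"
  shows "iota_inflation \<tau> bs \<in> permutations_of_set {1..sum_list bs}"
    "\<exists>Bs. inflates {1..sum_list bs} (pl (iota_inflation \<tau> bs)) int \<tau> Bs \<and> map card Bs = bs"
proof -
  let ?t = "length \<tau>" and ?\<pi> = "iota_inflation \<tau> bs" and ?N = "sum_list bs"
  define blk where "blk i = [Suc (offset \<tau> bs i)..<Suc (offset \<tau> bs i + bs ! i)]" for i
  have \<pi>: "?\<pi> = concat (map blk [0..<?t])" unfolding blk_def[abs_def] by (rule iota_inflation_concat[OF l])
  have set_blk: "set (blk i) = {Suc (offset \<tau> bs i)..offset \<tau> bs i + bs ! i}" for i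
      unfolding blk_def by auto
  have N: "?N = (\<Sum>j<?t. bs ! j)" using l by (simp add: sum_list_sum_nth atLeast0LessThan)
  have off: "offset \<tau> bs i + bs ! i \<le> offset \<tau> bs j" if "i < ?t" "\<tau> ! i < \<tau> ! j" for i j
  proof -
    let ?J = "\<lambda>i. {k. k < ?t \<and> \<tau> ! k < \<tau> ! i}"
    have "(\<Sum>k\<in>insert i (?J i). bs ! k) \<le> (\<Sum>k\<in>?J j. bs ! k)" by (rule sum_mono2) (use that in auto)
    then show ?thesis unfolding offset_def by simp
  qed
  have off_N: "offset \<tau> bs i + bs ! i \<le> ?N" if "i < ?t" for i
  proof -
    let ?J = "{k. k < ?t \<and> \<tau> ! k < \<tau> ! i}"
    have "(\<Sum>k\<in>insert i ?J. bs ! k) \<le> (\<Sum>k<?t. bs ! k)" by (rule sum_mono2) (use that in auto)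
    then show ?thesis unfolding offset_def N by simp
  qed
  have val: "u < w" if "i < ?t" "\<tau> ! i < \<tau> ! j" "u \<in> set (blk i)" "w \<in> set (blk j)" for i j u w
    using off[OF that(1,2)] that(3,4) unfolding set_blk by auto
  have disj: "set (blk i) \<inter> set (blk j) = {}" if "i < ?t" "j < ?t" "i \<noteq> j" for i j
  proof -
    have "\<tau> ! i < \<tau> ! j \<or> \<tau> ! j < \<tau> ! i" using d that by (metis linorder_neqE_nat nth_eq_iff_index_eq)
    then have "x \<notin> set (blk j)" if "x \<in> set (blk i)" for x
      using val[of i j x x] val[of j i x x] \<open>i < ?t\<close> \<open>j < ?t\<close> that by blast
    then show ?thesis by blast
  qed
  have ne: "blk i \<noteq> []" if "i < ?t" for i
    using pos[of "bs ! i"] that l by (auto simp: blk_def)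
  have dist: "distinct ?\<pi>"
    unfolding \<pi>
  proof (rule distinct_concat)
    show "distinct (map blk [0..<?t])"
      unfolding distinct_map using disj ne by (auto simp: inj_on_def) (metis inf.idem set_empty)
    show "distinct ys" if "ys \<in> set (map blk [0..<?t])" for ys using that
        by (auto simp: blk_def simp del: upt_Suc)
    show "set ys \<inter> set zs = {}" if "ys \<in> set (map blk [0..<?t])" "zs \<in> set (map blk [0..<?t])"
        "ys \<noteq> zs" for ys zs
      using that disj by force
  qed
  have set_\<pi>: "set ?\<pi> = (\<Union>i\<in>{..<?t}. set (blk i))" unfolding \<pi> by auto
  have "set ?\<pi> \<subseteq> {1..?N}" unfolding set_\<pi> set_blk using off_N by fastforce
  moreover have "card (set ?\<pi>) = ?N"
    using distinct_card[OF dist] length_iota_inflation[OF l] N by simp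
  ultimately have set_N: "set ?\<pi> = {1..?N}" by (intro card_subset_eq) auto
  then show "?\<pi> \<in> permutations_of_set {1..?N}" using dist by (simp add: permutations_of_set_def)
  have pl_blk: "place ?\<pi> (Suc (offset \<tau> bs i + k)) = (\<Sum>j<i. bs ! j) + k" if "i < ?t" "k < bs ! i" for i k
  proof -
    have "(\<Sum>j<i. bs ! j) + k < (\<Sum>j<Suc i. bs ! j)" using that by simp
    also have "\<dots> \<le> (\<Sum>j<?t. bs ! j)" by (rule sum_mono2) (use that in auto)
    finally show ?thesis
      using place_nth[OF dist] iota_inflation_nth[OF l that] length_iota_inflation[OF l] by metis
  qed
  have elem: "\<exists>k<bs ! i. u = Suc (offset \<tau> bs i + k)" if "u \<in> set (blk i)" for i u
    using that unfolding set_blk by (intro exI[of _ "u - Suc (offset \<tau> bs i)"]) auto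
  have pos_less: "place ?\<pi> u < place ?\<pi> w" if ij: "i < j" "j < ?t" "u \<in> set (blk i)"
      "w \<in> set (blk j)" for i j u w
  proof -
    obtain k m where k: "k < bs ! i" "u = Suc (offset \<tau> bs i + k)" and m: "m < bs ! j"
        "w = Suc (offset \<tau> bs j + m)"
      using elem[OF ij(3)] elem[OF ij(4)] by blast
    have "(\<Sum>x<i. bs ! x) + k < (\<Sum>x<Suc i. bs ! x)" using k(1) by simp
    also have "\<dots> \<le> (\<Sum>x<j. bs ! x)" by (rule sum_mono2) (use ij in auto)
    finally show ?thesis using pl_blk[of i k] pl_blk[of j m] k m ij by simp
  qed
  let ?Bs = "map (\<lambda>i. set (blk i)) [0..<?t]"
  have "inflates {1..?N} (pl ?\<pi>) int \<tau> ?Bs"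
    unfolding inflates_def
  proof (intro conjI)
    show "\<Union> (set ?Bs) = {1..?N}" using set_\<pi> set_N by auto
    show "{} \<notin> set ?Bs" using ne by auto
    show "\<forall>B\<in>set ?Bs. chain (pl ?\<pi>) int B"
    proof
      fix B assume "B \<in> set ?Bs"
      then obtain i where i: "i < ?t" "B = set (blk i)" by auto
      show "chain (pl ?\<pi>) int B"
        unfolding chain_def i(2)
      proof (intro ballI impI)
        fix u w assume uw: "u \<in> set (blk i)" "w \<in> set (blk i)" "pl ?\<pi> u < pl ?\<pi> w"
        then show "int u < int w" using elem[OF uw(1)] elem[OF uw(2)] pl_blk[OF i(1)] by auto
      qed
    qed
    show "sorted_wrt (block_order (pl ?\<pi>) int) (zip \<tau> ?Bs)"
      unfolding sorted_wrt_iff_nth_less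
    proof (intro allI impI)
      fix i j assume "i < j" "j < length (zip \<tau> ?Bs)"
      then have ij: "i < j" "j < ?t" "i < ?t" by auto
      have "\<tau> ! i < \<tau> ! j \<or> \<tau> ! j < \<tau> ! i" using d ij by (metis less_irrefl linorder_neqE_nat
          nth_eq_iff_index_eq)
      moreover have "lowleft (pl ?\<pi>) int (set (blk i)) (set (blk j))" if "\<tau> ! i < \<tau> ! j"
        unfolding lowleft_def using val[OF ij(3) that] pos_less[OF ij(1,2)] by auto
      moreover have "upleft (pl ?\<pi>) int (set (blk i)) (set (blk j))" if "\<tau> ! j < \<tau> ! i"
        unfolding upleft_def using val[OF ij(2) that] pos_less[OF ij(1,2)] by auto
      ultimately show "block_order (pl ?\<pi>) int (zip \<tau> ?Bs ! i) (zip \<tau> ?Bs ! j)"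
        using ij by (auto simp: block_order_def)
    qed
  qed simp
  moreover have "map card ?Bs = bs"
    by (rule nth_equalityI) (auto simp: l set_blk)
  ultimately show "\<exists>Bs. inflates {1..?N} (pl ?\<pi>) int \<tau> Bs \<and> map card Bs = bs" by blast
qed

text \<open>
  Two blocks contribute the product of their sizes if they are inverted, and nothing otherwise. The
  argument is the list of pairs of a type entry and the size of its block.
\<close>

fun inflation_inversions :: "(nat \<times> nat) list \<Rightarrow> nat" where
  "inflation_inversions [] = 0"
| "inflation_inversions ((t, b) # xs) = b * (\<Sum>(s, c)\<leftarrow>xs. if t < s then 0 else c) + inflation_inversions xs"

lemma inflates_Cons:
  assumes "inflates S pos val (t # \<tau>) (B # Bs)"
  shows "inflates (\<Union> (set Bs)) pos val \<tau> Bs" "S = B \<union> \<Union> (set Bs)" "chain pos val B" "length Bs = length \<tau>"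
    "\<And>s C. (s, C) \<in> set (zip \<tau> Bs) \<Longrightarrow> if t < s then lowleft pos val B C else upleft pos val B C"
  using assms unfolding inflates_def block_order_def by auto

lemma card_later_blocks:
  assumes "inflates S pos val \<tau> Bs" "finite S"
  shows "card (\<Union>(s, C)\<in>set (zip \<tau> Bs). if t < s then {} else C) = (\<Sum>(s,
      c)\<leftarrow>zip \<tau> (map card Bs). if t < s then 0 else c)"
  using assms
proof (induction \<tau> arbitrary: S Bs)
  case Nil
  then show ?case by simp
next
  case (Cons s \<tau>)
  then obtain B Cs where Bs: "Bs = B # Cs" by (cases Bs) (auto simp: inflates_def)
  note i = inflates_Cons[OF Cons.prems(1)[unfolded Bs]]
  let ?U = "\<Union>(s, C)\<in>set (zip \<tau> Cs). if t < s then {} else C"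
  have IH: "card ?U = (\<Sum>(s, c)\<leftarrow>zip \<tau> (map card Cs). if t < s then 0 else c)"
    by (rule Cons.IH[OF i(1)]) (use i(2) Cons.prems(2) in auto)
  have sub: "?U \<subseteq> \<Union> (set Cs)" by (auto split: if_splits dest: set_zip_rightD)
  have fin: "finite B" "finite ?U" using Cons.prems(2) i(2) sub by (auto intro: finite_subset)
  have "B \<inter> ?U = {}"
  proof -
    have "False" if x: "x \<in> B" "(s', C) \<in> set (zip \<tau> Cs)" "x \<in> C" for x s' C
      using i(5)[OF x(2)] x(1,3) by (auto simp: lowleft_def upleft_def split: if_splits)
    then show ?thesis by (auto split: if_splits)
  qed
  then have "card (B \<union> ?U) = card B + card ?U" using fin by (rule card_Un_disjoint[rotated 2])
  then show ?case unfolding Bs using IH by simp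
qed

lemma card_invs_inflates:
  assumes "inflates S pos val \<tau> Bs" "finite S"
  shows "card (invs pos val S) = inflation_inversions (zip \<tau> (map card Bs))"
  using assms
proof (induction \<tau> arbitrary: S Bs)
  case Nil
  then have "S = {}" by (auto simp: inflates_def)
  then show ?case by (simp add: invs_def)
next
  case (Cons t \<tau>)
  then obtain B Cs where Bs: "Bs = B # Cs" by (cases Bs) (auto simp: inflates_def)
  note i = inflates_Cons[OF Cons.prems(1)[unfolded Bs]]
  let ?R = "\<Union> (set Cs)"
  let ?U = "\<Union>(s, C)\<in>set (zip \<tau> Cs). if t < s then {} else C"
  have fin: "finite B" "finite ?R" using Cons.prems(2) i(2) by auto
  have IH: "card (invs pos val ?R) = inflation_inversions (zip \<tau> (map card Cs))"
    by (rule Cons.IH[OF i(1) fin(2)])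
  have U: "?U \<subseteq> ?R" by (auto split: if_splits dest: set_zip_rightD)
  have mem: "\<exists>s C. (s, C) \<in> set (zip \<tau> Cs) \<and> x \<in> C" if "x \<in> ?R" for x
    using that i(4) by (auto simp: in_set_conv_nth set_zip) blast
  have before: "pos u < pos w" if "u \<in> B" "w \<in> ?R" for u w
    using mem[OF that(2)] i(5) that(1) by (fastforce simp: lowleft_def upleft_def split: if_splits)
  have inv_U: "val w < val u \<longleftrightarrow> w \<in> ?U" if u: "u \<in> B" and w: "w \<in> ?R" for u w
  proof
    assume "val w < val u"
    moreover obtain s C where sC: "(s, C) \<in> set (zip \<tau> Cs)" "w \<in> C" using mem[OF w] by blast
    ultimately have "\<not> t < s" using i(5)[OF sC(1)] u by (force simp: lowleft_def split: if_splits)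
    then show "w \<in> ?U" using sC by force
  next
    assume "w \<in> ?U"
    then obtain s C where sC: "(s, C) \<in> set (zip \<tau> Cs)" "w \<in> C" "\<not> t < s" by (auto split: if_splits)
    then show "val w < val u" using i(5)[OF sC(1)] u by (auto simp: upleft_def)
  qed
  have "invs pos val S = B \<times> ?U \<union> invs pos val ?R"
  proof (rule set_eqI, rule iffI)
    fix e assume "e \<in> invs pos val S"
    then obtain u w where e: "e = (u, w)" "u \<in> B \<union> ?R" "w \<in> B \<union> ?R" "pos u < pos w" "val w < val u"
      unfolding i(2) invs_def by auto
    have "\<not> (u \<in> B \<and> w \<in> B)" using i(3) e(4,5) unfolding chain_def by force
    moreover have "\<not> (u \<in> ?R \<and> w \<in> B)" using before[of w u] e(4) by auto
    ultimately show "e \<in> B \<times> ?U \<union> invs pos val ?R"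
      using e inv_U[of u w] unfolding invs_def by blast
  next
    fix e assume e: "e \<in> B \<times> ?U \<union> invs pos val ?R"
    then show "e \<in> invs pos val S"
    proof
      assume "e \<in> B \<times> ?U"
      then obtain u w where uw: "e = (u, w)" "u \<in> B" "w \<in> ?U" by blast
      then have "w \<in> ?R" using U by blast
      then show ?thesis using uw inv_U[of u w] before[of u w] unfolding i(2) invs_def by blast
    qed (unfold i(2) invs_def, blast)
  qed
  moreover have "(B \<times> ?U) \<inter> invs pos val ?R = {}"
  proof -
    have "u \<notin> ?R" if "u \<in> B" for u using before[of u u] that by auto
    then show ?thesis unfolding invs_def by blast
  qed
  ultimately have "card (invs pos val S) = card B * card ?U + card (invs pos val ?R)"
    using fin finite_subset[OF U fin(2)] finite_invs[OF fin(2), of pos val]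
    by (simp add: card_Un_disjoint card_cartesian_product)
  moreover have "card ?U = (\<Sum>(s, c)\<leftarrow>zip \<tau> (map card Cs). if t < s then 0 else c)"
    by (rule card_later_blocks[OF i(1) fin(2)])
  ultimately show ?case unfolding Bs using IH by simp
qed

text \<open>
  A block is increasing, and every point outside it has the whole block on one side, in both orders.
  So no block contains two of the four points of a 1324 pattern: the middle two are inverted, and
  any other two have a middle point strictly between them in one of the orders.
\<close>

lemma avoids_inflates:
  assumes i: "inflates S pos val \<tau> Bs" and d: "distinct \<tau>" and av: "avoids_1324 \<tau>"
  shows "avoids pos val S"
  unfolding avoids_def
proof clarify
  fix x y z t assume mem: "x \<in> S" "y \<in> S" "z \<in> S" "t \<in> S"
    and o: "pos x < pos y" "pos y < pos z" "pos z < pos t" "val x < val z" "val z < val y" "val y < val t"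
  obtain bx where bx: "bx < length \<tau>" "x \<in> Bs ! bx" by (rule inflates_block[OF i mem(1)])
  obtain b1 where b1: "b1 < length \<tau>" "y \<in> Bs ! b1" by (rule inflates_block[OF i mem(2)])
  obtain b2 where b2: "b2 < length \<tau>" "z \<in> Bs ! b2" by (rule inflates_block[OF i mem(3)])
  obtain bt where bt: "bt < length \<tau>" "t \<in> Bs ! bt" by (rule inflates_block[OF i mem(4)])
  have le: "k \<le> m" if "pos u < pos w" "u \<in> Bs ! k" "w \<in> Bs ! m" "k < length \<tau>" "m < length \<tau>" for u w k m
    using inflates_pos_less[OF i, of m k w u] that by force
  have "b1 \<noteq> b2" using inflatesD(4)[OF i b1(1)] b1 b2 o unfolding chain_def by force
  then have b12: "b1 < b2" using le[OF o(2) b1(2) b2(2) b1(1) b2(1)] by simp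
  then have "\<tau> ! b2 < \<tau> ! b1" using inflates_val_less_iff[OF i d b2(1) b1(1) _ b2(2) b1(2)] o by auto
  have "bx \<noteq> b1"
  proof
    assume e: "bx = b1"
    then have "val z < val x \<longleftrightarrow> val z < val y"
      using inflates_val_less_iff[OF i d b2(1) b1(1) _ b2(2)] b12 b1(2) bx(2) by auto
    then show False using o by simp
  qed
  then have bx1: "bx < b1" using le[OF o(1) bx(2) b1(2) bx(1) b1(1)] by simp
  have "bt \<noteq> b2"
  proof
    assume e: "bt = b2"
    then have "val t < val y \<longleftrightarrow> val z < val y"
      using inflates_val_less_iff[OF i d b2(1) b1(1) _ _ b1(2)] b12 b2(2) bt(2) by auto
    then show False using o by simp
  qed
  then have b2t: "b2 < bt" using le[OF o(3) b2(2) bt(2) b2(1) bt(1)] by simp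
  have "\<tau> ! bx < \<tau> ! b2" using inflates_val_less_iff[OF i d bx(1) b2(1) _ bx(2) b2(2)] o bx1 b12 by auto
  moreover have "\<tau> ! b1 < \<tau> ! bt" using inflates_val_less_iff[OF i d b1(1) bt(1) _ b1(2) bt(2)] o
      b12 b2t by auto
  ultimately show False
    using av bx1 b12 b2t bt(1) \<open>\<tau> ! b2 < \<tau> ! b1\<close> unfolding avoids_1324_def by blast
qed

text \<open>
  A cut of the inflation induces one of \<open>\<tau>\<close> after the last block that it meets, or before that block
  if it is the last of all.
\<close>

lemma conn_inflates:
  assumes i: "inflates S pos val \<tau> Bs" and ns: "\<not> splits \<tau>" and l2: "2 \<le> length \<tau>"
  shows "conn pos val S"
  unfolding conn_def
proof (rule notI, elim exE conjE)
  fix U assume U: "U \<noteq> {}" "U \<subset> S" "\<forall>u\<in>U. \<forall>w\<in>S - U. pos u < pos w \<and> val u < val w"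
  let ?t = "length \<tau>"
  have full: "Bs ! k \<subseteq> U" if km: "k < m" "m < ?t" "u \<in> Bs ! m" "u \<in> U" for k m u
  proof
    fix x assume x: "x \<in> Bs ! k"
    have "pos x < pos u" by (rule inflates_pos_less[OF i km(1,2) x km(3)])
    moreover have "x \<in> S" using inflatesD(5)[OF i, of k] x km by auto
    ultimately show "x \<in> U" using U(3) km(4) by (metis Diff_iff less_asym)
  qed
  have cut: "splits \<tau>" if j: "0 < j" "j < ?t"
    and less: "\<And>k m. k < j \<Longrightarrow> j \<le> m \<Longrightarrow> m < ?t \<Longrightarrow> \<exists>u\<in>Bs ! k. \<exists>w\<in>Bs ! m. val u < val w" for j
  proof -
    have "\<tau> ! k < \<tau> ! m" if km: "k < j" "j \<le> m" "m < ?t" for k m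
    proof (rule ccontr)
      assume "\<not> ?thesis"
      then have "upleft pos val (Bs ! k) (Bs ! m)" using inflatesD(2)[OF i, of k m] km by auto
      then show False using less[OF km] unfolding upleft_def by force
    qed
    then have "\<forall>u\<in>set (take j \<tau>). \<forall>w\<in>set (drop j \<tau>). u < w"
      by (auto simp: in_set_conv_nth)
    then show ?thesis
      using j unfolding splits_def by (intro exI[of _ "take j \<tau>"] exI[of _ "drop j \<tau>"]) auto
  qed
  obtain u0 where u0: "u0 \<in> U" "u0 \<in> S" using U(1,2) by blast
  obtain w0 where w0: "w0 \<in> S" "w0 \<notin> U" using U(2) by blast
  obtain k0 where k0: "k0 < ?t" "u0 \<in> Bs ! k0" by (rule inflates_block[OF i u0(2)])
  obtain m0 where m0: "m0 < ?t" "w0 \<in> Bs ! m0" by (rule inflates_block[OF i w0(1)])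
  define j where "j = Max {k. k < ?t \<and> Bs ! k \<inter> U \<noteq> {}}"
  have fin: "finite {k. k < ?t \<and> Bs ! k \<inter> U \<noteq> {}}" by simp
  have ne: "{k. k < ?t \<and> Bs ! k \<inter> U \<noteq> {}} \<noteq> {}" using k0 u0 by blast
  have jin: "j < ?t" "Bs ! j \<inter> U \<noteq> {}" using Max_in[OF fin ne] unfolding j_def by auto
  have jmax: "Bs ! m \<inter> U = {}" if "j < m" "m < ?t" for m
  proof (rule ccontr)
    assume "\<not> ?thesis"
    then have "m \<le> j" unfolding j_def by (intro Max_ge[OF fin]) (use that in blast)
    then show False using that by simp
  qed
  obtain v where v: "v \<in> Bs ! j" "v \<in> U" using jin(2) by blast
  have meet: "\<exists>u\<in>Bs ! k. u \<in> U" if "k \<le> j" for k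
  proof (cases "k = j")
    case False
    then have "Bs ! k \<subseteq> U" using full[of k j v] v jin(1) that by auto
    moreover have "Bs ! k \<noteq> {}" using inflatesD(3)[OF i, of k] that jin(1) by auto
    ultimately show ?thesis by blast
  qed (use v in blast)
  show False
  proof (cases "Suc j < ?t")
    case True
    have "splits \<tau>"
    proof (rule cut[of "Suc j"])
      fix k m assume km: "k < Suc j" "Suc j \<le> m" "m < ?t"
      obtain u where u: "u \<in> Bs ! k" "u \<in> U" using meet[of k] km by auto
      obtain w where w: "w \<in> Bs ! m" using inflatesD(3)[OF i km(3)] by blast
      have "w \<in> S - U" using jmax[of m] w km inflatesD(5)[OF i km(3)] by auto
      then show "\<exists>u\<in>Bs ! k. \<exists>w\<in>Bs ! m. val u < val w" using U(3) u w by blast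
    qed (use True in auto)
    then show False using ns by blast
  next
    case False
    then have j: "j = ?t - 1" using jin(1) by simp
    have "splits \<tau>"
    proof (rule cut[of j])
      fix k m assume km: "k < j" "j \<le> m" "m < ?t"
      have "m = j" using km j by simp
      have "m0 = j"
      proof (rule ccontr)
        assume "m0 \<noteq> j"
        then have "m0 < j" using m0(1) j by simp
        then show False using full[of m0 j v] v jin(1) m0(2) w0(2) by blast
      qed
      obtain u where "u \<in> Bs ! k" "u \<in> U" using meet[of k] km by auto
      then show "\<exists>u\<in>Bs ! k. \<exists>w\<in>Bs ! m. val u < val w"
        using U(3) w0 m0(2) \<open>m = j\<close> \<open>m0 = j\<close> by blast
    qed (use j l2 in auto)
    then show False using ns by blast
  qed
qed

text \<open>
  Deleting a point leaves an inflation of the same type if its block had at least two points, and of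
  the type with one entry deleted otherwise.
\<close>

lemma conn_inflates_delete:
  assumes i: "inflates S pos val \<tau> Bs" and fin: "finite S" and ns: "\<not> splits \<tau>" and l3: "3 \<le> length \<tau>"
    and k: "k < length \<tau>" "x \<in> Bs ! k"
    and robust: "2 \<le> card (Bs ! k) \<or> \<not> splits (take k \<tau> @ drop (Suc k) \<tau>)"
  shows "conn pos val (S - {x})"
proof -
  have l: "length Bs = length \<tau>" by (rule inflatesD(1)[OF i])
  have only: "m = k" if "m < length \<tau>" "x \<in> Bs ! m" for m
    using inflates_block_unique[OF i that(1) k(1) that(2) k(2)] .
  obtain \<sigma> \<rho> where \<tau>: "\<tau> = \<sigma> @ (\<tau> ! k) # \<rho>" "\<sigma> = take k \<tau>" "\<rho> = drop (Suc k) \<tau>"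
    using id_take_nth_drop[OF k(1)] by blast
  have kl: "k < length Bs" using k(1) l by simp
  obtain As Cs where Bs: "Bs = As @ (Bs ! k) # Cs" "As = take k Bs" "Cs = drop (Suc k) Bs"
    using id_take_nth_drop[OF kl] by blast
  have lA: "length As = length \<sigma>" "length Cs = length \<rho>" using \<tau>(2,3) Bs(2,3) l by simp_all
  have xA: "x \<notin> C" if "C \<in> set As \<union> set Cs" for C
  proof
    assume x: "x \<in> C"
    have "\<exists>m<length Bs. m \<noteq> k \<and> Bs ! m = C"
      using that unfolding Bs(2,3) by (auto simp: in_set_conv_nth)
        (metis less_irrefl less_trans_Suc min_less_iff_conj not_add_less1 less_imp_neq add_Suc_right
            add.commute less_add_Suc1 less_diff_conv)+
    then show False using only x l by auto
  qed
  let ?R = "block_order pos val"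
  have all: "\<Union> (set As) \<union> Bs ! k \<union> \<Union> (set Cs) = S" "{} \<notin> set As \<union> set Cs"
    "\<And>B. B \<in> set As \<union> set Cs \<or> B = Bs ! k \<Longrightarrow> chain pos val B"
    "sorted_wrt ?R (zip \<sigma> As @ (\<tau> ! k, Bs ! k) # zip \<rho> Cs)"
  proof -
    have "zip \<tau> Bs = zip \<sigma> As @ (\<tau> ! k, Bs ! k) # zip \<rho> Cs"
      using \<tau>(1) Bs(1) lA by (metis zip_Cons_Cons zip_append)
    then show "sorted_wrt ?R (zip \<sigma> As @ (\<tau> ! k, Bs ! k) # zip \<rho> Cs)" using i unfolding inflates_def
        by metis
    have set: "set Bs = set As \<union> {Bs ! k} \<union> set Cs" using Bs(1)
        by (metis Un_assoc Un_insert_left Un_insert_right list.simps(15) set_append sup_bot_left)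
    then show "\<Union> (set As) \<union> Bs ! k \<union> \<Union> (set Cs) = S" "{} \<notin> set As \<union> set Cs"
      "\<And>B. B \<in> set As \<union> set Cs \<or> B = Bs ! k \<Longrightarrow> chain pos val B"
      using i unfolding inflates_def by auto
  qed
  show ?thesis
  proof (cases "2 \<le> card (Bs ! k)")
    case True
    let ?B = "Bs ! k - {x}"
    have "?B \<noteq> {}"
    proof
      assume "?B = {}"
      then have "Bs ! k \<subseteq> {x}" by blast
      then have "card (Bs ! k) \<le> card {x}" by (intro card_mono) auto
      then show False using True by simp
    qed
    moreover have "chain pos val ?B" using all(3)[of "Bs ! k"] unfolding chain_def by blast
    moreover have "sorted_wrt ?R (zip \<sigma> As @ (\<tau> ! k, ?B) # zip \<rho> Cs)"
      using all(4) unfolding sorted_wrt_append by (auto simp: block_order_def lowleft_def upleft_def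
          split: if_splits)
    moreover have "zip \<tau> (As @ ?B # Cs) = zip \<sigma> As @ (\<tau> ! k, ?B) # zip \<rho> Cs"
      using \<tau>(1) lA by (metis zip_Cons_Cons zip_append)
    moreover have "\<Union> (set (As @ ?B # Cs)) = S - {x}" using all(1) xA by auto
    moreover have "length (As @ ?B # Cs) = length \<tau>" using \<tau>(1) lA by (metis length_Cons length_append)
    ultimately have "inflates (S - {x}) pos val \<tau> (As @ ?B # Cs)"
      unfolding inflates_def using all(2,3) by auto
    then show ?thesis using conn_inflates ns l3 by force
  next
    case False
    have "finite (Bs ! k)" using inflatesD(5)[OF i k(1)] fin finite_subset by blast
    then have "Bs ! k = {x}" using False k(2) by (metis One_nat_def Suc_1 Suc_leI card_gt_0_iff
        card_1_singletonE empty_iff le_antisym not_less_eq_eq singletonD)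
    then have "\<Union> (set (As @ Cs)) = S - {x}" using all(1) xA by auto
    moreover have "sorted_wrt ?R (zip \<sigma> As @ zip \<rho> Cs)"
      using all(4) unfolding sorted_wrt_append by auto
    moreover have "zip (\<sigma> @ \<rho>) (As @ Cs) = zip \<sigma> As @ zip \<rho> Cs" using lA by simp
    ultimately have "inflates (S - {x}) pos val (\<sigma> @ \<rho>) (As @ Cs)"
      unfolding inflates_def using all(2,3) lA by auto
    moreover have "2 \<le> length (\<sigma> @ \<rho>)" using \<tau>(2,3) l3 k(1) by simp
    ultimately show ?thesis using conn_inflates[of "S - {x}" pos val "\<sigma> @ \<rho>"] robust False \<tau>(2,3) by blast
  qed
qed


text \<open>
  The extremal points of an inflation lie in the extremal blocks, so the conditions concern only the
  first, last, lowest and highest entry of \<open>\<tau>\<close>.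
\<close>

lemma residual_inflation:
  assumes \<tau>: "\<tau> \<in> permutations_of_set {1..t}" and t: "3 \<le> t" and av: "avoids_1324 \<tau>" and ns: "\<not> splits \<tau>"
    and l: "length bs = t" and pos: "\<And>b. b \<in> set bs \<Longrightarrow> 1 \<le> b"
    and robust: "\<And>i. i < t \<Longrightarrow> i = 0 \<or> i = t - 1 \<or> \<tau> ! i = 1 \<or> \<tau> ! i = t \<Longrightarrow>
        2 \<le> bs ! i \<or> \<not> splits (take i \<tau> @ drop (Suc i) \<tau>)"
    and inv: "inflation_inversions (zip \<tau> bs) + 5 = 2 * sum_list bs"
  shows "iota_inflation \<tau> bs \<in> residuals 2 (sum_list bs)"
proof -
  note p = permD[OF \<tau>]
  have l': "length bs = length \<tau>" using l p by simp
  let ?N = "sum_list bs" and ?\<pi> = "iota_inflation \<tau> bs"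
  obtain Bs where i: "inflates {1..?N} (pl ?\<pi>) int \<tau> Bs" and c: "map card Bs = bs"
    using iota_inflation_inflates(2)[OF p(1) l' pos] by blast
  have del: "conn (pl ?\<pi>) int ({1..?N} - {x})" if x: "x \<in> {1..?N}"
    and ext: "(\<forall>u\<in>{1..?N}. pl ?\<pi> x \<le> pl ?\<pi> u) \<or> (\<forall>u\<in>{1..?N}. pl ?\<pi> u \<le> pl ?\<pi> x) \<or>
      (\<forall>u\<in>{1..?N}. int x \<le> int u) \<or> (\<forall>u\<in>{1..?N}. int u \<le> int x)" for x
  proof -
    obtain k where k: "k < length \<tau>" "x \<in> Bs ! k" by (rule inflates_block[OF i x])
    have other: "\<exists>y\<in>{1..?N}. y \<in> Bs ! m" if "m < length \<tau>" for m
      using inflatesD(3)[OF i that] inflatesD(5)[OF i that] by blast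
    have ex_val: "\<exists>m<length \<tau>. \<tau> ! m = v" if "1 \<le> v" "v \<le> t" for v
      using p(2) that by (metis atLeastAtMost_iff in_set_conv_nth)
    have "k = 0 \<or> k = t - 1 \<or> \<tau> ! k = 1 \<or> \<tau> ! k = t"
      using ext
    proof (elim disjE)
      assume a: "\<forall>u\<in>{1..?N}. pl ?\<pi> x \<le> pl ?\<pi> u"
      have False if "0 < k"
        using other[of 0] inflates_pos_less[OF i that k(1) _ k(2)] a that k(1) by force
      then show ?thesis by blast
    next
      assume a: "\<forall>u\<in>{1..?N}. pl ?\<pi> u \<le> pl ?\<pi> x"
      have False if "k < t - 1"
        using other[of "t - 1"] inflates_pos_less[OF i that _ k(2)] a that p(3) t by force
      then show ?thesis using k(1) p(3) by fastforce
    next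
      assume a: "\<forall>u\<in>{1..?N}. int x \<le> int u"
      obtain m where m: "m < length \<tau>" "\<tau> ! m = 1" using ex_val[of 1] t by auto
      obtain y where y: "y \<in> {1..?N}" "y \<in> Bs ! m" using other[OF m(1)] by blast
      have "\<not> \<tau> ! m < \<tau> ! k" if "m \<noteq> k"
        using inflates_val_less_iff[OF i p(1) m(1) k(1) that y(2) k(2)] bspec[OF a y(1)] by simp
      moreover have "1 \<le> \<tau> ! k" using p(2) k(1) nth_mem by fastforce
      ultimately show ?thesis using m by force
    next
      assume a: "\<forall>u\<in>{1..?N}. int u \<le> int x"
      obtain m where m: "m < length \<tau>" "\<tau> ! m = t" using ex_val[of t] t by auto
      obtain y where y: "y \<in> {1..?N}" "y \<in> Bs ! m" using other[OF m(1)] by blast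
      have "\<not> \<tau> ! k < \<tau> ! m" if "k \<noteq> m"
        using inflates_val_less_iff[OF i p(1) k(1) m(1) that k(2) y(2)] bspec[OF a y(1)] by simp
      moreover have "\<tau> ! k \<le> t" using p(2) k(1) nth_mem by fastforce
      ultimately show ?thesis using m by force
    qed
    then have "2 \<le> bs ! k \<or> \<not> splits (take k \<tau> @ drop (Suc k) \<tau>)" using robust k(1) p(3) by auto
    moreover have "bs ! k = card (Bs ! k)" using c k(1) inflatesD(1)[OF i] by auto
    ultimately show ?thesis using conn_inflates_delete[OF i _ ns _ k] t p(3) by auto
  qed
  have "residual_points {1..?N} (pl ?\<pi>) int"
    unfolding residual_points_def
  proof (intro conjI ballI impI)
    show "avoids (pl ?\<pi>) int {1..?N}" by (rule avoids_inflates[OF i p(1) av])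
    show "conn (pl ?\<pi>) int {1..?N}" by (rule conn_inflates[OF i ns]) (use t p(3) in simp)
    show "card (invs (pl ?\<pi>) int {1..?N}) + 5 = 2 * card {1..?N}"
      using card_invs_inflates[OF i] c inv by simp
  qed (rule del)
  then show ?thesis
    unfolding residuals_2_iff using iota_inflation_inflates(1)[OF p(1) l' pos] by blast
qed

section \<open>Inverses\<close>

lemma perm_inverse_place: "perm_inverse \<pi> = map (\<lambda>v. Suc (place \<pi> v)) [1..<Suc (length \<pi>)]"
  unfolding perm_inverse_def place_def ..

lemma perm_inverse_nth: "1 \<le> v \<Longrightarrow> v \<le> length \<pi> \<Longrightarrow> perm_inverse \<pi> ! (v - 1) = Suc (place \<pi> v)"
  unfolding perm_inverse_place using nth_upt[of 1 "v - 1" "Suc (length \<pi>)"] by (simp del: upt_Suc)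

lemma inj_on_Suc_place:
  assumes "\<pi> \<in> permutations_of_set {1..n}" shows "inj_on (\<lambda>v. Suc (place \<pi> v)) {1..n}"
  using inj_on_place[OF permD(1)[OF assms]] unfolding permD(2)[OF assms]
  by (auto intro!: inj_onI dest: inj_onD)

lemma perm_inverse_facts:
  assumes "\<pi> \<in> permutations_of_set {1..n}"
  shows "perm_inverse \<pi> \<in> permutations_of_set {1..n}"
    "v \<in> {1..n} \<Longrightarrow> place (perm_inverse \<pi>) (Suc (place \<pi> v)) = v - 1"
    "perm_inverse (perm_inverse \<pi>) = \<pi>"
proof -
  note p = permD[OF assms]
  have len: "length (perm_inverse \<pi>) = n" using p(3) by (simp add: perm_inverse_place del: upt_Suc)
  have dist: "distinct (perm_inverse \<pi>)"
    unfolding perm_inverse_place distinct_map p(3) using inj_on_Suc_place[OF assms]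
    by (simp add: atLeastLessThanSuc_atLeastAtMost del: upt_Suc)
  have sub: "set (perm_inverse \<pi>) \<subseteq> {1..n}"
    unfolding perm_inverse_place using nth_place(1)[OF p(1)] p(2,3)
        by (auto simp: Suc_le_eq simp del: upt_Suc)
  have set: "set (perm_inverse \<pi>) = {1..n}"
    using sub distinct_card[OF dist] len by (intro card_subset_eq) auto
  show perm: "perm_inverse \<pi> \<in> permutations_of_set {1..n}" using dist set
      by (simp add: permutations_of_set_def)
  have pp: "place (perm_inverse \<pi>) (Suc (place \<pi> v)) = v - 1" if "v \<in> {1..n}" for v
    using place_nth[OF dist, of "v - 1"] perm_inverse_nth[of v \<pi>] that len p(3) by auto
  show "v \<in> {1..n} \<Longrightarrow> place (perm_inverse \<pi>) (Suc (place \<pi> v)) = v - 1" by (rule pp)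
  show "perm_inverse (perm_inverse \<pi>) = \<pi>"
  proof (rule nth_equalityI)
    show "length (perm_inverse (perm_inverse \<pi>)) = length \<pi>" using len p(3)
        by (simp add: perm_inverse_place del: upt_Suc)
    fix i assume "i < length (perm_inverse (perm_inverse \<pi>))"
    then have i: "i < n" using len by (simp add: perm_inverse_place del: upt_Suc)
    have v: "\<pi> ! i \<in> {1..n}" "place \<pi> (\<pi> ! i) = i" using nth_mem[of i \<pi>] p i place_nth[OF p(1),
        of i] by auto
    show "perm_inverse (perm_inverse \<pi>) ! i = \<pi> ! i"
      using perm_inverse_nth[of "Suc i" "perm_inverse \<pi>"] pp[OF v(1)] v len i by auto
  qed
qed

text \<open>
  The inverse has the same points with the two orders exchanged.
\<close>

lemma order_iso_perm_inverse:
  assumes "\<pi> \<in> permutations_of_set {1..n}"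
  shows "order_iso (\<lambda>v. Suc (place \<pi> v)) {1..n} int (pl \<pi>) {1..n} (pl (perm_inverse \<pi>)) int"
proof -
  note p = permD[OF assms]
  have "(\<lambda>v. Suc (place \<pi> v)) ` {1..n} = set (perm_inverse \<pi>)"
    using p(3) by (simp add: perm_inverse_place atLeastLessThanSuc_atLeastAtMost del: upt_Suc)
  also have "\<dots> = {1..n}" using permD[OF perm_inverse_facts(1)[OF assms]] by simp
  finally have "bij_betw (\<lambda>v. Suc (place \<pi> v)) {1..n} {1..n}"
    using inj_on_Suc_place[OF assms] unfolding bij_betw_def by simp
  then show ?thesis
    unfolding order_iso_def using perm_inverse_facts(2)[OF assms] by auto
qed

lemma perm_inverse_residuals:
  assumes "\<pi> \<in> residuals 2 n" shows "perm_inverse \<pi> \<in> residuals 2 n"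
  using assms perm_inverse_facts(1) residual_points_order_iso[OF order_iso_perm_inverse
      residual_points_swap]
  unfolding residuals_2_iff by blast

lemma inflates_swap:
  assumes i: "inflates S pos val \<tau> Bs" and inj: "inj_on pos S" and \<tau>: "\<tau> \<in> permutations_of_set {1..t}"
  shows "inflates S val pos (perm_inverse \<tau>) (map (\<lambda>v. Bs ! place \<tau> v) [1..<Suc t])"
proof -
  note p = permD[OF \<tau>]
  note l = inflatesD(1)[OF i]
  let ?Bs = "map (\<lambda>v. Bs ! place \<tau> v) [1..<Suc t]"
  have len: "length ?Bs = length (perm_inverse \<tau>)" using p(3) by (simp add: perm_inverse_place del: upt_Suc)
  have pl: "place \<tau> v < length Bs" if "v \<in> {1..t}" for v using nth_place(1)[OF p(1)] that p(2) l by simp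
  have "set ?Bs = (!) Bs ` (place \<tau> ` {1..t})" by (auto simp: image_comp
      atLeastLessThanSuc_atLeastAtMost simp del: upt_Suc)
  also have "place \<tau> ` {1..t} = {..<length Bs}"
  proof (rule set_eqI, rule iffI)
    fix k assume "k \<in> {..<length Bs}"
    then have "place \<tau> (\<tau> ! k) = k" "\<tau> ! k \<in> {1..t}" using place_nth[OF p(1),
        of k] nth_mem[of k \<tau>] p(2) l by auto
    then show "k \<in> place \<tau> ` {1..t}" by force
  qed (use pl in auto)
  also have "(!) Bs ` {..<length Bs} = set Bs" by (auto simp: set_conv_nth)
  finally have set: "set ?Bs = set Bs" .
  have ch: "chain val pos B" if "B \<in> set Bs" for B
  proof -
    have c: "chain pos val B" and B: "B \<subseteq> S" using i that unfolding inflates_def by blast+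
    show ?thesis
      unfolding chain_def
    proof (intro ballI impI)
      fix u w assume uw: "u \<in> B" "w \<in> B" "val u < val w"
      then have "pos u \<noteq> pos w" using inj B by (auto dest: inj_onD)
      moreover have "\<not> pos w < pos u" using c uw unfolding chain_def by force
      ultimately show "pos u < pos w" by simp
    qed
  qed
  have "sorted_wrt (block_order val pos) (zip (perm_inverse \<tau>) ?Bs)"
    unfolding sorted_wrt_iff_nth_less
  proof (intro allI impI)
    fix k m assume "k < m" "m < length (zip (perm_inverse \<tau>) ?Bs)"
    then have km: "k < m" "m < t" "k < t" using p(3) by (auto simp: perm_inverse_place simp del: upt_Suc)
    let ?x = "place \<tau> (Suc k)" and ?y = "place \<tau> (Suc m)"
    have x: "?x < length \<tau>" "\<tau> ! ?x = Suc k" and y: "?y < length \<tau>" "\<tau> ! ?y = Suc m"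
      using nth_place[OF p(1), of "Suc k"] nth_place[OF p(1), of "Suc m"] p(2) km by auto
    have nths: "zip (perm_inverse \<tau>) ?Bs ! k = (Suc ?x, Bs ! ?x)"
        "zip (perm_inverse \<tau>) ?Bs ! m = (Suc ?y, Bs ! ?y)"
      using km p(3) by (simp_all add: perm_inverse_place del: upt_Suc)
    have "if ?x < ?y then lowleft val pos (Bs ! ?x) (Bs ! ?y) else upleft val pos (Bs ! ?x) (Bs ! ?y)"
    proof (cases "?x < ?y")
      case True
      then show ?thesis using inflatesD(2)[OF i True y(1)] x(2) y(2) km by (auto simp: lowleft_def)
    next
      case False
      moreover have "?x \<noteq> ?y" using x(2) y(2) km by auto
      ultimately have "?y < ?x" by simp
      then show ?thesis using inflatesD(2)[OF i \<open>?y < ?x\<close> x(1)] x(2) y(2) km False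
          by (auto simp: upleft_def)
    qed
    then show "block_order val pos (zip (perm_inverse \<tau>) ?Bs ! k) (zip (perm_inverse \<tau>) ?Bs ! m)"
      unfolding nths by (simp add: block_order_def)
  qed
  moreover have "\<Union> (set ?Bs) = S" "{} \<notin> set ?Bs" "\<forall>B\<in>set ?Bs. chain val pos B"
    unfolding set using i ch unfolding inflates_def by blast+
  ultimately show ?thesis unfolding inflates_def using len by blast
qed

lemma perm_inverse_recognition:
  assumes \<pi>: "\<pi> \<in> permutations_of_set {1..n}" and i: "inflates {1..n} int (pl \<pi>) \<tau> Bs" and d: "distinct \<tau>"
  shows "perm_inverse \<pi> = iota_inflation \<tau> (map card Bs)"
  using iota_inflation_recognition[OF perm_inverse_facts(1)[OF \<pi>] inflates_order_iso(1)[OF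
      order_iso_perm_inverse[OF \<pi>] i] d]
  unfolding inflates_order_iso(2)[OF order_iso_perm_inverse[OF \<pi>] i] .

lemma perm_inverse_iota_inflation:
  assumes \<tau>: "\<tau> \<in> permutations_of_set {1..t}" and l: "length bs = t" and pos: "\<And>b. b \<in> set bs \<Longrightarrow> 1 \<le> b"
  shows "perm_inverse (iota_inflation \<tau> bs) = iota_inflation (perm_inverse \<tau>) (map (\<lambda>v. bs ! place \<tau>
      v) [1..<Suc t])"
proof -
  note p = permD[OF \<tau>]
  have l': "length bs = length \<tau>" using l p by simp
  let ?N = "sum_list bs" and ?\<pi> = "iota_inflation \<tau> bs"
  have \<pi>: "?\<pi> \<in> permutations_of_set {1..?N}" by (rule iota_inflation_inflates(1)[OF p(1) l' pos])
  obtain Bs where i: "inflates {1..?N} (pl ?\<pi>) int \<tau> Bs" and c: "map card Bs = bs"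
    using iota_inflation_inflates(2)[OF p(1) l' pos] by blast
  have inj: "inj_on (pl ?\<pi>) {1..?N}"
    using inj_on_place[of ?\<pi>] permD[OF \<pi>] by (simp add: inj_on_def)
  note rec = perm_inverse_recognition[OF \<pi> inflates_swap[OF i inj \<tau>] permD(1)[OF
      perm_inverse_facts(1)[OF \<tau>]]]
  have sizes: "map card (map (\<lambda>v. Bs ! place \<tau> v) [1..<Suc t]) = map (\<lambda>v. bs ! place \<tau> v) [1..<Suc t]"
  proof -
    have "card (Bs ! place \<tau> v) = bs ! place \<tau> v" if "v \<in> {1..t}" for v
      using nth_place(1)[OF p(1)] that p(2) inflatesD(1)[OF i] c by (metis nth_map)
    then show ?thesis by (simp add: atLeastLessThanSuc_atLeastAtMost del: upt_Suc)
  qed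
  show ?thesis using rec unfolding sizes .
qed

section \<open>Uniqueness of type and block sizes\<close>

text \<open>
  The lengths of the maximal runs of consecutive increasing values; they recover the block sizes.
\<close>

fun runs :: "nat list \<Rightarrow> nat list" where
  "runs [] = []"
| "runs [x] = [1]"
| "runs (x # y # xs) = (if y = Suc x then Suc (hd (runs (y # xs))) # tl (runs (y # xs)) else 1 #
    runs (y # xs))"

lemma runs_interval:
  assumes "1 \<le> k" "ys = [] \<or> hd ys \<noteq> s + k"
  shows "runs ([s..<s + k] @ ys) = k # runs ys"
  using assms
proof (induction k arbitrary: s rule: nat_induct_at_least)
  case base
  then show ?case by (cases ys) auto
next
  case (Suc k)
  have up: "[s..<s + Suc k] = s # [Suc s..<Suc s + k]" by (simp add: upt_conv_Cons del: upt_Suc)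
  obtain zs where zs: "[Suc s..<Suc s + k] @ ys = Suc s # zs" using Suc.hyps
      by (simp add: upt_conv_Cons del: upt_Suc)
  have "runs ([Suc s..<Suc s + k] @ ys) = k # runs ys" by (rule Suc.IH) (use Suc.prems in auto)
  then show ?case unfolding up append_Cons zs by simp
qed

lemma runs_concat:
  assumes "\<And>i. i < t \<Longrightarrow> 1 \<le> b i" "\<And>i. Suc i < t \<Longrightarrow> f (Suc i) \<noteq> f i + b i"
  shows "runs (concat (map (\<lambda>i. [f i..<f i + b i]) [0..<t])) = map b [0..<t]"
  using assms
proof (induction t arbitrary: f b)
  case (Suc t)
  have up: "[0..<Suc t] = 0 # map Suc [0..<t]" by (simp add: map_Suc_upt upt_conv_Cons del: upt_Suc)
  let ?ys = "concat (map (\<lambda>i. [f (Suc i)..<f (Suc i) + b (Suc i)]) [0..<t])"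
  have IH: "runs ?ys = map (\<lambda>i. b (Suc i)) [0..<t]" by (rule Suc.IH) (use Suc.prems in auto)
  have "?ys = [] \<or> hd ?ys \<noteq> f 0 + b 0"
  proof (cases t)
    case (Suc t')
    have "[0..<t] = 0 # map Suc [0..<t']" unfolding Suc
        by (simp add: map_Suc_upt upt_conv_Cons del: upt_Suc)
    moreover have "1 \<le> b (Suc 0)" "f (Suc 0) \<noteq> f 0 + b 0" using Suc.prems[of 0] Suc.prems[of
        "Suc 0"] Suc by auto
    ultimately show ?thesis by (simp add: upt_conv_Cons)
  qed simp
  then have "runs ([f 0..<f 0 + b 0] @ ?ys) = b 0 # runs ?ys" using Suc.prems(1)[of 0]
      by (intro runs_interval) auto
  then show ?case unfolding up using IH by (simp add: comp_def del: upt_Suc)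
qed simp

text \<open>
  Adjacent blocks of an inflation of such a permutation never merge into one run.
\<close>

definition reduced :: "nat list \<Rightarrow> bool" where
  "reduced \<tau> \<longleftrightarrow> (\<forall>i. Suc i < length \<tau> \<longrightarrow> \<tau> ! Suc i \<noteq> Suc (\<tau> ! i))"

lemma offset_less:
  assumes "i < length \<tau>" "\<tau> ! i < \<tau> ! j"
  shows "offset \<tau> bs i + bs ! i \<le> offset \<tau> bs j"
    "k < length \<tau> \<Longrightarrow> \<tau> ! i < \<tau> ! k \<Longrightarrow> \<tau> ! k < \<tau> ! j \<Longrightarrow> offset \<tau> bs i + bs ! i + bs ! k \<le> offset \<tau> bs j"
proof -
  let ?J = "\<lambda>i. {k. k < length \<tau> \<and> \<tau> ! k < \<tau> ! i}"
  have "(\<Sum>k\<in>insert i (?J i). bs ! k) \<le> (\<Sum>k\<in>?J j. bs ! k)" by (rule sum_mono2) (use assms in auto)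
  then show "offset \<tau> bs i + bs ! i \<le> offset \<tau> bs j" unfolding offset_def by simp
  assume k: "k < length \<tau>" "\<tau> ! i < \<tau> ! k" "\<tau> ! k < \<tau> ! j"
  have "(\<Sum>k\<in>insert k (insert i (?J i)). bs ! k) \<le> (\<Sum>k\<in>?J j. bs ! k)"
      by (rule sum_mono2) (use assms k in auto)
  then show "offset \<tau> bs i + bs ! i + bs ! k \<le> offset \<tau> bs j" 
  proof -
    have "k \<notin> insert i (?J i)" "i \<notin> ?J i" using k by auto
    then have "(\<Sum>k\<in>insert k (insert i (?J i)). bs ! k) = bs ! k + (bs ! i + (\<Sum>k\<in>?J i. bs ! k))"
      by (subst sum.insert; simp)
    then show ?thesis
      using \<open>(\<Sum>k\<in>insert k (insert i (?J i)). bs ! k) \<le> (\<Sum>k\<in>?J j. bs ! k)\<close> unfolding offset_def by linarith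
  qed
qed

lemma runs_iota_inflation:
  assumes \<tau>: "\<tau> \<in> permutations_of_set {1..t}" and r: "reduced \<tau>" and l: "length bs = t" and pos:
      "\<And>b. b \<in> set bs \<Longrightarrow> 1 \<le> b"
  shows "runs (iota_inflation \<tau> bs) = bs"
proof -
  note p = permD[OF \<tau>]
  have l': "length bs = length \<tau>" using l p by simp
  have b1: "1 \<le> bs ! i" if "i < t" for i using pos that l by simp
  have "runs (concat (map (\<lambda>i. [Suc (offset \<tau> bs i)..<Suc (offset \<tau> bs i) + bs ! i]) [0..<t])) = map
      (\<lambda>i. bs ! i) [0..<t]"
  proof (rule runs_concat)
    fix i assume i: "Suc i < t"
    have ne: "\<tau> ! i \<noteq> \<tau> ! Suc i" "\<tau> ! Suc i \<noteq> Suc (\<tau> ! i)"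
      using p i r by (auto simp: nth_eq_iff_index_eq reduced_def)
    show "Suc (offset \<tau> bs (Suc i)) \<noteq> Suc (offset \<tau> bs i) + bs ! i"
    proof (cases "\<tau> ! i < \<tau> ! Suc i")
      case True
      have "Suc (\<tau> ! i) \<in> set \<tau>" using True p i nth_mem[of "Suc i" \<tau>] by auto
      then obtain k where k: "k < length \<tau>" "\<tau> ! k = Suc (\<tau> ! i)" by (auto simp: in_set_conv_nth)
      show ?thesis using offset_less(2)[of i \<tau> "Suc i" k bs] True k i p(3) ne b1[of k] by auto
    next
      case False
      then show ?thesis using offset_less(1)[of "Suc i" \<tau> i bs] i p(3) ne b1[of i] b1[of "Suc i"] by auto
    qed
  qed (rule b1)
  moreover have "map (\<lambda>i. bs ! i) [0..<t] = bs" using map_nth[of bs] l by simp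
  ultimately show ?thesis using iota_inflation_concat[OF l'] p(3) by (simp del: upt_Suc)
qed

text \<open>
  The runs give the block sizes. The first values of the blocks are then known, and they are ordered
  like the entries of the type.
\<close>

lemma iota_inflation_inject:
  assumes \<tau>: "\<tau> \<in> permutations_of_set {1..t}" "reduced \<tau>" "length bs = t" "\<And>b. b \<in> set bs \<Longrightarrow> 1 \<le> b"
    and \<tau>': "\<tau>' \<in> permutations_of_set {1..t'}" "reduced \<tau>'" "length bs' = t'" "\<And>b. b \<in> set bs' \<Longrightarrow> 1 \<le> b"
    and eq: "iota_inflation \<tau> bs = iota_inflation \<tau>' bs'"
  shows "\<tau> = \<tau>' \<and> bs = bs'"
proof -
  have bs: "bs = bs'" using runs_iota_inflation[OF \<tau>] runs_iota_inflation[OF \<tau>'] eq by simp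
  then have t: "t' = t" using \<tau>(3) \<tau>'(3) by simp
  note p = permD[OF \<tau>(1)] and p' = permD[OF \<tau>'(1)[unfolded t]]
  have off: "offset \<tau> bs i = offset \<tau>' bs i" if "i < t" for i
    using iota_inflation_nth[of bs \<tau> i 0] iota_inflation_nth[of bs \<tau>' i 0] that p(3) p'(3) \<tau>(3)
        \<tau>(4)[of "bs ! i"] eq bs
    by auto
  have less: "offset \<tau> bs i < offset \<tau> bs j \<longleftrightarrow> \<tau> ! i < \<tau> ! j"
    if "\<tau> \<in> permutations_of_set {1..t}" "i < t" "j < t" for \<tau> i j
  proof -
    note q = permD[OF that(1)]
    have b: "1 \<le> bs ! i" "1 \<le> bs ! j" using \<tau>(3,4) that by auto
    show ?thesis
      using offset_less(1)[of i \<tau> j bs] offset_less(1)[of j \<tau> i bs] b that(2,3) q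
      by (cases "\<tau> ! i" "\<tau> ! j" rule: linorder_cases) (auto simp: nth_eq_iff_index_eq)
  qed
  have iff: "\<tau> ! i < \<tau> ! j \<longleftrightarrow> \<tau>' ! i < \<tau>' ! j" if "i < t" "j < t" for i j
    using less[OF \<tau>(1) that] less[OF \<tau>'(1)[unfolded t] that] off that by simp
  have rank: "\<tau> ! i = Suc (card {j. j < t \<and> \<tau> ! j < \<tau> ! i})" if "\<tau> \<in> permutations_of_set {1..t}"
      "i < t" for \<tau> i
  proof -
    note q = permD[OF that(1)]
    have "(!) \<tau> ` {j. j < t \<and> \<tau> ! j < \<tau> ! i} = {1..<\<tau> ! i}"
    proof (rule set_eqI, rule iffI)
      fix v assume "v \<in> {1..<\<tau> ! i}"
      then have "v \<in> set \<tau>" using q nth_mem[of i \<tau>] that(2) by auto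
      then show "v \<in> (!) \<tau> ` {j. j < t \<and> \<tau> ! j < \<tau> ! i}" using \<open>v \<in> {1..<\<tau> ! i}\<close> q(3)
          by (auto simp: in_set_conv_nth)
    next
      fix v assume "v \<in> (!) \<tau> ` {j. j < t \<and> \<tau> ! j < \<tau> ! i}"
      then obtain j where j: "j < t" "\<tau> ! j < \<tau> ! i" "v = \<tau> ! j" by blast
      then show "v \<in> {1..<\<tau> ! i}" using nth_mem[of j \<tau>] q by auto
    qed
    moreover have "inj_on ((!) \<tau>) {j. j < t \<and> \<tau> ! j < \<tau> ! i}" using q
        by (auto simp: inj_on_def nth_eq_iff_index_eq)
    ultimately have "card {j. j < t \<and> \<tau> ! j < \<tau> ! i} = card {1..<\<tau> ! i}" using card_image by metis
    moreover have "1 \<le> \<tau> ! i" using nth_mem[of i \<tau>] q that(2) by auto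
    ultimately show ?thesis by simp
  qed
  have "\<tau> ! i = \<tau>' ! i" if i: "i < t" for i
  proof -
    have "{j. j < t \<and> \<tau> ! j < \<tau> ! i} = {j. j < t \<and> \<tau>' ! j < \<tau>' ! i}" using iff i by blast
    then show ?thesis using rank[OF \<tau>(1) i] rank[OF \<tau>'(1)[unfolded t] i] by simp
  qed
  then have "\<tau> = \<tau>'" using p(3) p'(3) by (intro nth_equalityI) auto
  then show ?thesis using bs by simp
qed


section \<open>The twelve types\<close>

text \<open>
  The next three characterizations range over finite lists and can be evaluated by rewriting.
\<close>

lemma splits_iff: "splits ys \<longleftrightarrow> (\<exists>j\<in>set [1..<length ys]. \<forall>u\<in>set (take j ys). \<forall>w\<in>set (drop j ys). u < w)"
proof
  assume "splits ys"
  then obtain us vs where uv: "ys = us @ vs" "us \<noteq> []" "vs \<noteq> []" "\<forall>u\<in>set us. \<forall>w\<in>set vs. u < w"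
    unfolding splits_def by blast
  then show "\<exists>j\<in>set [1..<length ys]. \<forall>u\<in>set (take j ys). \<forall>w\<in>set (drop j ys). u < w"
    by (intro bexI[of _ "length us"]) (auto simp: Suc_le_eq)
next
  assume "\<exists>j\<in>set [1..<length ys]. \<forall>u\<in>set (take j ys). \<forall>w\<in>set (drop j ys). u < w"
  then obtain j where "j \<in> set [1..<length ys]" "\<forall>u\<in>set (take j ys). \<forall>w\<in>set (drop j ys). u < w" by blast
  then show "splits ys" unfolding splits_def by (intro exI[of _ "take j ys"] exI[of _ "drop j ys"]) auto
qed

lemma avoids_1324_iff: "avoids_1324 \<pi> \<longleftrightarrow>
  (\<forall>l\<in>set [0..<length \<pi>]. \<forall>k\<in>set [0..<l]. \<forall>j\<in>set [0..<k]. \<forall>i\<in>set [0..<j].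
    \<not> (\<pi> ! i < \<pi> ! k \<and> \<pi> ! k < \<pi> ! j \<and> \<pi> ! j < \<pi> ! l))"
  unfolding avoids_1324_def set_upt Ball_def atLeastLessThan_iff by blast

lemma reduced_iff: "reduced \<tau> \<longleftrightarrow> (\<forall>i\<in>set [0..<length \<tau> - 1]. \<tau> ! Suc i \<noteq> Suc (\<tau> ! i))"
  by (auto simp: reduced_def)

lemma perm_inverse_eqI:
  assumes "distinct \<tau>" "length \<sigma> = length \<tau>"
    "\<forall>v\<in>set [0..<length \<tau>]. 1 \<le> \<sigma> ! v \<and> \<sigma> ! v \<le> length \<tau> \<and> \<tau> ! (\<sigma> ! v - 1) = Suc v"
  shows "perm_inverse \<tau> = \<sigma>"
proof (rule nth_equalityI)
  show "length (perm_inverse \<tau>) = length \<sigma>" using assms(2) by (simp add: perm_inverse_place del: upt_Suc)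
  fix v assume "v < length (perm_inverse \<tau>)"
  then have v: "v < length \<tau>" by (simp add: perm_inverse_place del: upt_Suc)
  then have s: "1 \<le> \<sigma> ! v" "\<sigma> ! v - 1 < length \<tau>" "\<tau> ! (\<sigma> ! v - 1) = Suc v" using assms(3) by force+
  have "place \<tau> (Suc v) = \<sigma> ! v - 1" using place_nth[OF assms(1) s(2)] s(3) by simp
  then show "perm_inverse \<tau> ! v = \<sigma> ! v" using perm_inverse_nth[of "Suc v" \<tau>] v s(1) by simp
qed

text \<open>
  The second conjunct prescribes \<open>2 n - 5\<close> inversions, where \<open>n\<close> is the sum of the block sizes.
\<close>

definition valid_sizes :: "nat list \<Rightarrow> nat list \<Rightarrow> bool" where
  "valid_sizes \<tau> bs \<longleftrightarrow> (\<forall>b\<in>set bs. 1 \<le> b) \<and> inflation_inversions (zip \<tau> bs) + 5 = 2 * sum_list bs"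

text \<open>
  The block sizes of the twelve families. Subtracting the lower bounds from the sizes turns the
  equations into statements about products of natural numbers.
\<close>

definition "params1 = {[x + 1, 1, y + 2, z + 1, w + 2] | x y z w :: nat. x * y + z * w = 1}"
definition "params2 = {[x + 1, 1, y + 2, z + 1, 1, 1] | x y z :: nat. x * y = 0}"
definition "params3 = {[x + 1, 1, y + 2, 1, z + 1, 1, 1] | x y z :: nat. x * y = 0}"
definition "params4 = {[z + 1, 1, 1, 1, x + 1, y + 2] | x y z :: nat. x * y = 0}"
definition "params5 = {[1, 1, 1, 1, z + 1, x + 1, y + 2] | x y z :: nat. x * y = 0}"
definition "params6 = {[x + 1, 1, y + 2, z + 1, 1, 1, 2] | x y z :: nat. x * y = 0}"
definition "params7 = {[x + 1, 1, y + 2, 1, 1, 2] | x y :: nat. x * y = 0}"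
definition "params8 = {[1, 1, z + 1, 1, 2, x + 1, y + 2] | x y z :: nat. x * y = 0}"
definition "params9 = {[1, 1, 1, 2, x + 1, y + 2] | x y :: nat. x * y = 0}"
definition "params10 = {[x + 1, 1, y + 1, z + 1, 1, w + 1] | x y z w :: nat. x * y = 0 \<and> z * w = 0}"
definition "params11 = {[x + 1, 1, y + 1, 1, 1, z + 1, 1] | x y z :: nat. x * y = 0}"
definition "params12 = {[1, z + 1, 1, 1, x + 1, 1, y + 1] | x y z :: nat. x * y = 0}"

lemma shifted_sizes:
  fixes f :: "nat \<Rightarrow> nat \<Rightarrow> nat \<Rightarrow> nat \<Rightarrow> nat list" and g :: "nat \<Rightarrow> nat \<Rightarrow> nat \<Rightarrow> nat list" and h ::
      "nat \<Rightarrow> nat \<Rightarrow> nat list"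
  shows
  "{f A C D E | A C D E. A \<ge> 1 \<and> C \<ge> 1 \<and> D \<ge> 1 \<and> E \<ge> 1 \<and> C \<ge> 2 \<and> E \<ge> 2 \<and>
      (A - 1) * (C - 2) + (D - 1) * (E - 2) = 1} =
    {f (x + 1) (y + 2) (z + 1) (w + 2) | x y z w. x * y + z * w = 1}"
  "{g A C D | A C D. A \<ge> 1 \<and> C \<ge> 1 \<and> D \<ge> 1 \<and> C \<ge> 2 \<and> (A - 1) * (C - 2) = 0} =
    {g (x + 1) (y + 2) (z + 1) | x y z. x * y = 0}"
  "{g A D E | A D E. A \<ge> 1 \<and> D \<ge> 1 \<and> E \<ge> 1 \<and> E \<ge> 2 \<and> (D - 1) * (E - 2) = 0} =
    {g (z + 1) (x + 1) (y + 2) | x y z. x * y = 0}"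
  "{h A C | A C. A \<ge> 1 \<and> C \<ge> 1 \<and> C \<ge> 2 \<and> (A - 1) * (C - 2) = 0} =
    {h (x + 1) (y + 2) | x y. x * y = 0}"
  "{f A C D F | A C D F. A \<ge> 1 \<and> C \<ge> 1 \<and> D \<ge> 1 \<and> F \<ge> 1 \<and> (A - 1) * (C - 1) = 0 \<and> (D - 1) * (F - 1) = 0} =
    {f (x + 1) (y + 1) (z + 1) (w + 1) | x y z w. x * y = 0 \<and> z * w = 0}"
  "{g A C E | A C E. A \<ge> 1 \<and> C \<ge> 1 \<and> E \<ge> 1 \<and> (A - 1) * (C - 1) = 0} =
    {g (x + 1) (y + 1) (z + 1) | x y z. x * y = 0}"
  "{g B D F | B D F. B \<ge> 1 \<and> D \<ge> 1 \<and> F \<ge> 1 \<and> (D - 1) * (F - 1) = 0} =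
    {g (z + 1) (x + 1) (y + 1) | x y z. x * y = 0}"
proof -
  show "{f A C D E | A C D E. A \<ge> 1 \<and> C \<ge> 1 \<and> D \<ge> 1 \<and> E \<ge> 1 \<and> C \<ge> 2 \<and> E \<ge> 2 \<and>
      (A - 1) * (C - 2) + (D - 1) * (E - 2) = 1} =
    {f (x + 1) (y + 2) (z + 1) (w + 2) | x y z w. x * y + z * w = 1}"
    by (intro Collect_cong iffI; elim exE conjE) (rule_tac x = "A - 1" in exI, rule_tac x =
        "C - 2" in exI, rule_tac x = "D - 1" in exI, rule_tac x = "E - 2" in exI,
        simp only: le_add_diff_inverse2 simp_thms, rule_tac x = "x + 1" in exI, rule_tac x =
        "y + 2" in exI, rule_tac x = "z + 1" in exI, rule_tac x = "w + 2" in exI, simp)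
  show "{g A C D | A C D. A \<ge> 1 \<and> C \<ge> 1 \<and> D \<ge> 1 \<and> C \<ge> 2 \<and> (A - 1) * (C - 2) = 0} =
    {g (x + 1) (y + 2) (z + 1) | x y z. x * y = 0}"
    by (intro Collect_cong iffI; elim exE conjE) (rule_tac x = "A - 1" in exI, rule_tac x =
        "C - 2" in exI, rule_tac x = "D - 1" in exI, simp only: le_add_diff_inverse2 simp_thms,
        rule_tac x = "x + 1" in exI, rule_tac x = "y + 2" in exI, rule_tac x = "z + 1" in exI, simp)
  show "{g A D E | A D E. A \<ge> 1 \<and> D \<ge> 1 \<and> E \<ge> 1 \<and> E \<ge> 2 \<and> (D - 1) * (E - 2) = 0} =
    {g (z + 1) (x + 1) (y + 2) | x y z. x * y = 0}"
    by (intro Collect_cong iffI; elim exE conjE) (rule_tac x = "D - 1" in exI, rule_tac x =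
        "E - 2" in exI, rule_tac x = "A - 1" in exI, simp only: le_add_diff_inverse2 simp_thms,
        rule_tac x = "z + 1" in exI, rule_tac x = "x + 1" in exI, rule_tac x = "y + 2" in exI, simp)
  show "{h A C | A C. A \<ge> 1 \<and> C \<ge> 1 \<and> C \<ge> 2 \<and> (A - 1) * (C - 2) = 0} =
    {h (x + 1) (y + 2) | x y. x * y = 0}"
    by (intro Collect_cong iffI; elim exE conjE) (rule_tac x = "A - 1" in exI, rule_tac x =
        "C - 2" in exI, simp only: le_add_diff_inverse2 simp_thms, rule_tac x = "x + 1" in exI,
        rule_tac x = "y + 2" in exI, simp)
  show "{f A C D F | A C D F. A \<ge> 1 \<and> C \<ge> 1 \<and> D \<ge> 1 \<and> F \<ge> 1 \<and> (A - 1) * (C - 1) = 0 \<and>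
      (D - 1) * (F - 1) = 0} =
    {f (x + 1) (y + 1) (z + 1) (w + 1) | x y z w. x * y = 0 \<and> z * w = 0}"
    by (intro Collect_cong iffI; elim exE conjE) (rule_tac x = "A - 1" in exI, rule_tac x =
        "C - 1" in exI, rule_tac x = "D - 1" in exI, rule_tac x = "F - 1" in exI,
        simp only: le_add_diff_inverse2 simp_thms, rule_tac x = "x + 1" in exI, rule_tac x =
        "y + 1" in exI, rule_tac x = "z + 1" in exI, rule_tac x = "w + 1" in exI, simp)
  show "{g A C E | A C E. A \<ge> 1 \<and> C \<ge> 1 \<and> E \<ge> 1 \<and> (A - 1) * (C - 1) = 0} =
    {g (x + 1) (y + 1) (z + 1) | x y z. x * y = 0}"
    by (intro Collect_cong iffI; elim exE conjE) (rule_tac x = "A - 1" in exI, rule_tac x =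
        "C - 1" in exI, rule_tac x = "E - 1" in exI, simp only: le_add_diff_inverse2 simp_thms,
        rule_tac x = "x + 1" in exI, rule_tac x = "y + 1" in exI, rule_tac x = "z + 1" in exI, simp)
  show "{g B D F | B D F. B \<ge> 1 \<and> D \<ge> 1 \<and> F \<ge> 1 \<and> (D - 1) * (F - 1) = 0} =
    {g (z + 1) (x + 1) (y + 1) | x y z. x * y = 0}"
    by (intro Collect_cong iffI; elim exE conjE) (rule_tac x = "D - 1" in exI, rule_tac x =
        "F - 1" in exI, rule_tac x = "B - 1" in exI, simp only: le_add_diff_inverse2 simp_thms,
        rule_tac x = "z + 1" in exI, rule_tac x = "x + 1" in exI, rule_tac x = "y + 1" in exI, simp)
qed

lemma families_as_inflations:
  "family1 = iota_inflation [2, 4, 1, 5, 3] ` params1"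
  "family2 = iota_inflation [2, 5, 1, 6, 4, 3] ` params2"
  "family3 = iota_inflation [2, 6, 1, 7, 3, 5, 4] ` params3"
  "family4 = iota_inflation [3, 5, 2, 1, 6, 4] ` params4"
  "family5 = iota_inflation [4, 6, 2, 1, 3, 7, 5] ` params5"
  "family6 = iota_inflation [2, 4, 1, 5, 7, 6, 3] ` params6"
  "family7 = iota_inflation [2, 4, 1, 6, 5, 3] ` params7"
  "family8 = iota_inflation [3, 2, 4, 6, 1, 7, 5] ` params8"
  "family9 = iota_inflation [3, 2, 5, 1, 6, 4] ` params9"
  "family10 = iota_inflation [3, 5, 1, 6, 2, 4] ` params10"
  "family11 = iota_inflation [3, 5, 1, 7, 2, 6, 4] ` params11"
  "family12 = iota_inflation [4, 2, 6, 1, 7, 3, 5] ` params12"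
  unfolding family1_def family2_def family3_def family4_def family5_def family6_def family7_def
      family8_def family9_def family10_def family11_def family12_def shifted_sizes
    params1_def params2_def params3_def params4_def params5_def params6_def params7_def params8_def
        params9_def params10_def params11_def params12_def
  by (rule set_eqI, blast)+

text \<open>
  For each shape the number of inversions is a quadratic polynomial in the block sizes; up to linear terms
  it factors, which gives the equation defining the family.
\<close>

lemma sizes_valid_params:
  "bs \<in> sizes1 \<Longrightarrow> valid_sizes [2, 4, 1, 5, 3] bs \<Longrightarrow> bs \<in> params1"
  "bs \<in> sizes2 \<Longrightarrow> valid_sizes [2, 5, 1, 6, 4, 3] bs \<Longrightarrow> bs \<in> params2"
  "bs \<in> sizes3 \<Longrightarrow> valid_sizes [2, 6, 1, 7, 3, 5, 4] bs \<Longrightarrow> bs \<in> params3"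
  "bs \<in> sizes4 \<Longrightarrow> valid_sizes [3, 5, 2, 1, 6, 4] bs \<Longrightarrow> bs \<in> params4"
  "bs \<in> sizes5 \<Longrightarrow> valid_sizes [4, 6, 2, 1, 3, 7, 5] bs \<Longrightarrow> bs \<in> params5"
  "bs \<in> sizes6 \<Longrightarrow> valid_sizes [2, 4, 1, 5, 7, 6, 3] bs \<Longrightarrow> bs \<in> params6"
  "bs \<in> sizes7 \<Longrightarrow> valid_sizes [2, 4, 1, 6, 5, 3] bs \<Longrightarrow> bs \<in> params7"
  "bs \<in> sizes8 \<Longrightarrow> valid_sizes [3, 2, 4, 6, 1, 7, 5] bs \<Longrightarrow> bs \<in> params8"
  "bs \<in> sizes9 \<Longrightarrow> valid_sizes [3, 2, 5, 1, 6, 4] bs \<Longrightarrow> bs \<in> params9"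
  "bs \<in> sizes10 \<Longrightarrow> valid_sizes [3, 5, 1, 6, 2, 4] bs \<Longrightarrow> bs \<in> params10"
  "bs \<in> sizes11 \<Longrightarrow> valid_sizes [3, 5, 1, 7, 2, 6, 4] bs \<Longrightarrow> bs \<in> params11"
  "bs \<in> sizes12 \<Longrightarrow> valid_sizes [4, 2, 6, 1, 7, 3, 5] bs \<Longrightarrow> bs \<in> params12"
proof -
  show "bs \<in> params1" if s: "bs \<in> sizes1" and v: "valid_sizes [2, 4, 1, 5, 3] bs"
  proof -
    obtain A C D E where p: "bs = [A, 1, C, D, E]" "2 \<le> C" "2 \<le> E"
      using s unfolding sizes1_def by blast
    moreover have "1 \<le> A" "1 \<le> C" "1 \<le> D" "1 \<le> E" using v unfolding valid_sizes_def p(1) by simp_all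
    ultimately obtain x y z w where e: "A = x + 1" "C = y + 2" "D = z + 1" "E = w + 2"
        by (metis le_add_diff_inverse2)
    have "x * y + z * w = 1" using v unfolding valid_sizes_def p(1) e by (simp add: algebra_simps)
    then show ?thesis unfolding params1_def p(1) e by blast
  qed
  show "bs \<in> params2" if s: "bs \<in> sizes2" and v: "valid_sizes [2, 5, 1, 6, 4, 3] bs"
  proof -
    obtain A C D where p: "bs = [A, 1, C, D, 1, 1]" "2 \<le> C"
      using s unfolding sizes2_def by blast
    moreover have "1 \<le> A" "1 \<le> C" "1 \<le> D" using v unfolding valid_sizes_def p(1) by simp_all
    ultimately obtain x y z where e: "A = x + 1" "C = y + 2" "D = z + 1" by (metis le_add_diff_inverse2)
    have "x * y = 0" using v unfolding valid_sizes_def p(1) e by (simp add: algebra_simps)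
    then show ?thesis unfolding params2_def p(1) e by blast
  qed
  show "bs \<in> params3" if s: "bs \<in> sizes3" and v: "valid_sizes [2, 6, 1, 7, 3, 5, 4] bs"
  proof -
    obtain A C E where p: "bs = [A, 1, C, 1, E, 1, 1]" "2 \<le> C"
      using s unfolding sizes3_def by blast
    moreover have "1 \<le> A" "1 \<le> C" "1 \<le> E" using v unfolding valid_sizes_def p(1) by simp_all
    ultimately obtain x y z where e: "A = x + 1" "C = y + 2" "E = z + 1" by (metis le_add_diff_inverse2)
    have "x * y = 0" using v unfolding valid_sizes_def p(1) e by (simp add: algebra_simps)
    then show ?thesis unfolding params3_def p(1) e by blast
  qed
  show "bs \<in> params4" if s: "bs \<in> sizes4" and v: "valid_sizes [3, 5, 2, 1, 6, 4] bs"
  proof -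
    obtain A D E where p: "bs = [A, 1, 1, 1, D, E]" "2 \<le> E"
      using s unfolding sizes4_def by blast
    moreover have "1 \<le> A" "1 \<le> D" "1 \<le> E" using v unfolding valid_sizes_def p(1) by simp_all
    ultimately obtain x y z where e: "A = z + 1" "D = x + 1" "E = y + 2" by (metis le_add_diff_inverse2)
    have "x * y = 0" using v unfolding valid_sizes_def p(1) e by (simp add: algebra_simps)
    then show ?thesis unfolding params4_def p(1) e by blast
  qed
  show "bs \<in> params5" if s: "bs \<in> sizes5" and v: "valid_sizes [4, 6, 2, 1, 3, 7, 5] bs"
  proof -
    obtain C D E where p: "bs = [1, 1, 1, 1, C, D, E]" "2 \<le> E"
      using s unfolding sizes5_def by blast
    moreover have "1 \<le> C" "1 \<le> D" "1 \<le> E" using v unfolding valid_sizes_def p(1) by simp_all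
    ultimately obtain x y z where e: "C = z + 1" "D = x + 1" "E = y + 2" by (metis le_add_diff_inverse2)
    have "x * y = 0" using v unfolding valid_sizes_def p(1) e by (simp add: algebra_simps)
    then show ?thesis unfolding params5_def p(1) e by blast
  qed
  show "bs \<in> params6" if s: "bs \<in> sizes6" and v: "valid_sizes [2, 4, 1, 5, 7, 6, 3] bs"
  proof -
    obtain A C D where p: "bs = [A, 1, C, D, 1, 1, 2]" "2 \<le> C"
      using s unfolding sizes6_def by blast
    moreover have "1 \<le> A" "1 \<le> C" "1 \<le> D" using v unfolding valid_sizes_def p(1) by simp_all
    ultimately obtain x y z where e: "A = x + 1" "C = y + 2" "D = z + 1" by (metis le_add_diff_inverse2)
    have "x * y = 0" using v unfolding valid_sizes_def p(1) e by (simp add: algebra_simps)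
    then show ?thesis unfolding params6_def p(1) e by blast
  qed
  show "bs \<in> params7" if s: "bs \<in> sizes7" and v: "valid_sizes [2, 4, 1, 6, 5, 3] bs"
  proof -
    obtain A C where p: "bs = [A, 1, C, 1, 1, 2]" "2 \<le> C"
      using s unfolding sizes7_def by blast
    moreover have "1 \<le> A" "1 \<le> C" using v unfolding valid_sizes_def p(1) by simp_all
    ultimately obtain x y where e: "A = x + 1" "C = y + 2" by (metis le_add_diff_inverse2)
    have "x * y = 0" using v unfolding valid_sizes_def p(1) e by (simp add: algebra_simps)
    then show ?thesis unfolding params7_def p(1) e by blast
  qed
  show "bs \<in> params8" if s: "bs \<in> sizes8" and v: "valid_sizes [3, 2, 4, 6, 1, 7, 5] bs"
  proof -
    obtain B D E where p: "bs = [1, 1, B, 1, 2, D, E]" "2 \<le> E"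
      using s unfolding sizes8_def by blast
    moreover have "1 \<le> B" "1 \<le> D" "1 \<le> E" using v unfolding valid_sizes_def p(1) by simp_all
    ultimately obtain x y z where e: "B = z + 1" "D = x + 1" "E = y + 2" by (metis le_add_diff_inverse2)
    have "x * y = 0" using v unfolding valid_sizes_def p(1) e by (simp add: algebra_simps)
    then show ?thesis unfolding params8_def p(1) e by blast
  qed
  show "bs \<in> params9" if s: "bs \<in> sizes9" and v: "valid_sizes [3, 2, 5, 1, 6, 4] bs"
  proof -
    obtain D E where p: "bs = [1, 1, 1, 2, D, E]" "2 \<le> E"
      using s unfolding sizes9_def by blast
    moreover have "1 \<le> D" "1 \<le> E" using v unfolding valid_sizes_def p(1) by simp_all
    ultimately obtain x y where e: "D = x + 1" "E = y + 2" by (metis le_add_diff_inverse2)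
    have "x * y = 0" using v unfolding valid_sizes_def p(1) e by (simp add: algebra_simps)
    then show ?thesis unfolding params9_def p(1) e by blast
  qed
  show "bs \<in> params10" if s: "bs \<in> sizes10" and v: "valid_sizes [3, 5, 1, 6, 2, 4] bs"
  proof -
    obtain A C D F where p: "bs = [A, 1, C, D, 1, F]" 
      using s unfolding sizes10_def by blast
    moreover have "1 \<le> A" "1 \<le> C" "1 \<le> D" "1 \<le> F" using v unfolding valid_sizes_def p(1) by simp_all
    ultimately obtain x y z w where e: "A = x + 1" "C = y + 1" "D = z + 1" "F = w + 1"
        by (metis le_add_diff_inverse2)
    have "x * y = 0 \<and> z * w = 0" using v unfolding valid_sizes_def p(1) e by (simp add: algebra_simps)
    then show ?thesis unfolding params10_def p(1) e by blast
  qed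
  show "bs \<in> params11" if s: "bs \<in> sizes11" and v: "valid_sizes [3, 5, 1, 7, 2, 6, 4] bs"
  proof -
    obtain A C E where p: "bs = [A, 1, C, 1, 1, E, 1]" 
      using s unfolding sizes11_def by blast
    moreover have "1 \<le> A" "1 \<le> C" "1 \<le> E" using v unfolding valid_sizes_def p(1) by simp_all
    ultimately obtain x y z where e: "A = x + 1" "C = y + 1" "E = z + 1" by (metis le_add_diff_inverse2)
    have "x * y = 0" using v unfolding valid_sizes_def p(1) e by (simp add: algebra_simps)
    then show ?thesis unfolding params11_def p(1) e by blast
  qed
  show "bs \<in> params12" if s: "bs \<in> sizes12" and v: "valid_sizes [4, 2, 6, 1, 7, 3, 5] bs"
  proof -
    obtain B D F where p: "bs = [1, B, 1, 1, D, 1, F]" 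
      using s unfolding sizes12_def by blast
    moreover have "1 \<le> B" "1 \<le> D" "1 \<le> F" using v unfolding valid_sizes_def p(1) by simp_all
    ultimately obtain x y z where e: "B = z + 1" "D = x + 1" "F = y + 1" by (metis le_add_diff_inverse2)
    have "x * y = 0" using v unfolding valid_sizes_def p(1) e by (simp add: algebra_simps)
    then show ?thesis unfolding params12_def p(1) e by blast
  qed
qed

lemma params_valid:
  "\<forall>bs\<in>params1. valid_sizes [2, 4, 1, 5, 3] bs \<and> length bs = length [2, 4, 1, 5, 3]"
  "\<forall>bs\<in>params2. valid_sizes [2, 5, 1, 6, 4, 3] bs \<and> length bs = length [2, 5, 1, 6, 4, 3]"
  "\<forall>bs\<in>params3. valid_sizes [2, 6, 1, 7, 3, 5, 4] bs \<and> length bs = length [2, 6, 1, 7, 3, 5, 4]"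
  "\<forall>bs\<in>params4. valid_sizes [3, 5, 2, 1, 6, 4] bs \<and> length bs = length [3, 5, 2, 1, 6, 4]"
  "\<forall>bs\<in>params5. valid_sizes [4, 6, 2, 1, 3, 7, 5] bs \<and> length bs = length [4, 6, 2, 1, 3, 7, 5]"
  "\<forall>bs\<in>params6. valid_sizes [2, 4, 1, 5, 7, 6, 3] bs \<and> length bs = length [2, 4, 1, 5, 7, 6, 3]"
  "\<forall>bs\<in>params7. valid_sizes [2, 4, 1, 6, 5, 3] bs \<and> length bs = length [2, 4, 1, 6, 5, 3]"
  "\<forall>bs\<in>params8. valid_sizes [3, 2, 4, 6, 1, 7, 5] bs \<and> length bs = length [3, 2, 4, 6, 1, 7, 5]"
  "\<forall>bs\<in>params9. valid_sizes [3, 2, 5, 1, 6, 4] bs \<and> length bs = length [3, 2, 5, 1, 6, 4]"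
  "\<forall>bs\<in>params10. valid_sizes [3, 5, 1, 6, 2, 4] bs \<and> length bs = length [3, 5, 1, 6, 2, 4]"
  "\<forall>bs\<in>params11. valid_sizes [3, 5, 1, 7, 2, 6, 4] bs \<and> length bs = length [3, 5, 1, 7, 2, 6, 4]"
  "\<forall>bs\<in>params12. valid_sizes [4, 2, 6, 1, 7, 3, 5] bs \<and> length bs = length [4, 2, 6, 1, 7, 3, 5]"
  unfolding params1_def params2_def params3_def params4_def params5_def params6_def params7_def
      params8_def params9_def params10_def params11_def params12_def
  by (auto simp: valid_sizes_def algebra_simps)

definition residual_type :: "nat list \<Rightarrow> bool" where
  "residual_type \<tau> \<longleftrightarrow> \<tau> \<in> permutations_of_set {1..length \<tau>} \<and> 3 \<le> length \<tau> \<and> avoids_1324 \<tau> \<and>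
      \<not> splits \<tau> \<and> reduced \<tau>"

lemma permutation_iff: "\<tau> \<in> permutations_of_set {1..length \<tau>} \<longleftrightarrow> distinct \<tau> \<and> list_all (\<lambda>x. 1 \<le> x \<and>
    x \<le> length \<tau>) \<tau>"
proof
  assume \<tau>: "distinct \<tau> \<and> list_all (\<lambda>x. 1 \<le> x \<and> x \<le> length \<tau>) \<tau>"
  then have "set \<tau> \<subseteq> {1..length \<tau>}" by (auto simp: list_all_iff)
  then have "set \<tau> = {1..length \<tau>}" using \<tau> by (intro card_subset_eq) (auto simp: distinct_card)
  then show "\<tau> \<in> permutations_of_set {1..length \<tau>}" using \<tau> by (auto simp: permutations_of_set_def)
qed (auto simp: permutations_of_set_def list_all_iff)

text \<open>
  The inverses of the first nine types are included; the last three types are their own inverses.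
\<close>

lemma residual_types:
  "residual_type [2, 4, 1, 5, 3]"
  "residual_type [2, 5, 1, 6, 4, 3]"
  "residual_type [2, 6, 1, 7, 3, 5, 4]"
  "residual_type [3, 5, 2, 1, 6, 4]"
  "residual_type [4, 6, 2, 1, 3, 7, 5]"
  "residual_type [2, 4, 1, 5, 7, 6, 3]"
  "residual_type [2, 4, 1, 6, 5, 3]"
  "residual_type [3, 2, 4, 6, 1, 7, 5]"
  "residual_type [3, 2, 5, 1, 6, 4]"
  "residual_type [3, 5, 1, 6, 2, 4]"
  "residual_type [3, 5, 1, 7, 2, 6, 4]"
  "residual_type [4, 2, 6, 1, 7, 3, 5]"
  "residual_type [3, 1, 5, 2, 4]"
  "residual_type [3, 1, 6, 5, 2, 4]"
  "residual_type [3, 1, 5, 7, 6, 2, 4]"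
  "residual_type [4, 3, 1, 6, 2, 5]"
  "residual_type [4, 3, 5, 1, 7, 2, 6]"
  "residual_type [3, 1, 7, 2, 4, 6, 5]"
  "residual_type [3, 1, 6, 2, 5, 4]"
  "residual_type [5, 2, 1, 3, 7, 4, 6]"
  "residual_type [4, 2, 1, 6, 3, 5]"
  unfolding residual_type_def avoids_1324_iff splits_iff reduced_iff permutation_iff by code_simp+

lemma inverse_types:
  "perm_inverse [2, 4, 1, 5, 3] = [3, 1, 5, 2, 4]"
  "perm_inverse [2, 5, 1, 6, 4, 3] = [3, 1, 6, 5, 2, 4]"
  "perm_inverse [2, 6, 1, 7, 3, 5, 4] = [3, 1, 5, 7, 6, 2, 4]"
  "perm_inverse [3, 5, 2, 1, 6, 4] = [4, 3, 1, 6, 2, 5]"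
  "perm_inverse [4, 6, 2, 1, 3, 7, 5] = [4, 3, 5, 1, 7, 2, 6]"
  "perm_inverse [2, 4, 1, 5, 7, 6, 3] = [3, 1, 7, 2, 4, 6, 5]"
  "perm_inverse [2, 4, 1, 6, 5, 3] = [3, 1, 6, 2, 5, 4]"
  "perm_inverse [3, 2, 4, 6, 1, 7, 5] = [5, 2, 1, 3, 7, 4, 6]"
  "perm_inverse [3, 2, 5, 1, 6, 4] = [4, 2, 1, 6, 3, 5]"
  "perm_inverse [3, 5, 1, 6, 2, 4] = [3, 5, 1, 6, 2, 4]"
  "perm_inverse [3, 5, 1, 7, 2, 6, 4] = [3, 5, 1, 7, 2, 6, 4]"
  "perm_inverse [4, 2, 6, 1, 7, 3, 5] = [4, 2, 6, 1, 7, 3, 5]"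
  by (rule perm_inverse_eqI; code_simp)+

text \<open>
  Deleting an extremal point must not disconnect: either its block is larger than one, or the
  type itself survives the deletion of the entry.
\<close>

definition robust :: "nat list \<Rightarrow> nat list \<Rightarrow> bool" where
  "robust \<tau> bs \<longleftrightarrow> (\<forall>i\<in>set [0..<length \<tau>]. i = 0 \<or> i = length \<tau> - 1 \<or> \<tau> ! i = 1 \<or> \<tau> ! i = length \<tau> \<longrightarrow>
     2 \<le> bs ! i \<or> \<not> splits (take i \<tau> @ drop (Suc i) \<tau>))"

text \<open>
  Types with an extremal entry deleted whose block may have size one.
\<close>

lemma deletions_not_split:
  "\<not> splits [4, 1, 5, 3]"
  "\<not> splits [2, 4, 1, 3]"
  "\<not> splits [5, 1, 6, 4, 3]"
  "\<not> splits [2, 5, 1, 4, 3]"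
  "\<not> splits [2, 5, 1, 6, 4]"
  "\<not> splits [6, 1, 7, 3, 5, 4]"
  "\<not> splits [2, 6, 1, 3, 5, 4]"
  "\<not> splits [2, 6, 1, 7, 3, 5]"
  "\<not> splits [5, 2, 1, 6, 4]"
  "\<not> splits [3, 5, 2, 6, 4]"
  "\<not> splits [3, 5, 2, 1, 4]"
  "\<not> splits [6, 2, 1, 3, 7, 5]"
  "\<not> splits [4, 6, 2, 3, 7, 5]"
  "\<not> splits [4, 6, 2, 1, 3, 5]"
  "\<not> splits [4, 1, 5, 7, 6, 3]"
  "\<not> splits [2, 4, 1, 5, 6, 3]"
  "\<not> splits [4, 1, 6, 5, 3]"
  "\<not> splits [2, 4, 1, 5, 3]"
  "\<not> splits [2, 4, 6, 1, 7, 5]"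
  "\<not> splits [3, 2, 4, 6, 1, 5]"
  "\<not> splits [3, 2, 5, 1, 4]"
  "\<not> splits [5, 1, 6, 2, 4]"
  "\<not> splits [3, 5, 6, 2, 4]"
  "\<not> splits [3, 5, 1, 2, 4]"
  "\<not> splits [3, 5, 1, 6, 2]"
  "\<not> splits [5, 1, 7, 2, 6, 4]"
  "\<not> splits [3, 5, 7, 2, 6, 4]"
  "\<not> splits [3, 5, 1, 2, 6, 4]"
  "\<not> splits [3, 5, 1, 7, 2, 6]"
  "\<not> splits [4, 2, 6, 7, 3, 5]"
  "\<not> splits [4, 2, 6, 1, 3, 5]"
  "\<not> splits [4, 2, 6, 1, 7, 3]"
  unfolding splits_iff by code_simp+

lemma params_robust:
  "bs \<in> params1 \<Longrightarrow> robust [2, 4, 1, 5, 3] bs"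
  "bs \<in> params2 \<Longrightarrow> robust [2, 5, 1, 6, 4, 3] bs"
  "bs \<in> params3 \<Longrightarrow> robust [2, 6, 1, 7, 3, 5, 4] bs"
  "bs \<in> params4 \<Longrightarrow> robust [3, 5, 2, 1, 6, 4] bs"
  "bs \<in> params5 \<Longrightarrow> robust [4, 6, 2, 1, 3, 7, 5] bs"
  "bs \<in> params6 \<Longrightarrow> robust [2, 4, 1, 5, 7, 6, 3] bs"
  "bs \<in> params7 \<Longrightarrow> robust [2, 4, 1, 6, 5, 3] bs"
  "bs \<in> params8 \<Longrightarrow> robust [3, 2, 4, 6, 1, 7, 5] bs"
  "bs \<in> params9 \<Longrightarrow> robust [3, 2, 5, 1, 6, 4] bs"
  "bs \<in> params10 \<Longrightarrow> robust [3, 5, 1, 6, 2, 4] bs"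
  "bs \<in> params11 \<Longrightarrow> robust [3, 5, 1, 7, 2, 6, 4] bs"
  "bs \<in> params12 \<Longrightarrow> robust [4, 2, 6, 1, 7, 3, 5] bs"
  unfolding params1_def params2_def params3_def params4_def params5_def params6_def params7_def
      params8_def params9_def params10_def params11_def params12_def
  by (elim CollectE exE conjE; simp add: robust_def deletions_not_split[unfolded One_nat_def])+


section \<open>The residuals are the families\<close>

text \<open>
  The images under reflection in the antidiagonal of the shapes in \<open>one_sided\<close>.
\<close>

definition one_sided_flipped :: "'a set \<Rightarrow> ('a \<Rightarrow> int) \<Rightarrow> ('a \<Rightarrow> int) \<Rightarrow> bool" where
  "one_sided_flipped S pos val \<longleftrightarrow> shaped S pos val [2, 4, 1, 5, 3] sizes1 \<or> shaped S pos val [2, 5,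
      1, 6, 4, 3] sizes2 \<or>
    shaped S pos val [2, 6, 1, 7, 3, 5, 4] sizes3 \<or> shaped S pos val [2, 4, 1, 5, 7, 6, 3] sizes6 \<or>
    shaped S pos val [2, 4, 1, 6, 5, 3] sizes7"

lemma chain_flip: "chain (\<lambda>u. - val u) (\<lambda>u. - pos u) B \<longleftrightarrow> (\<forall>u\<in>B. \<forall>w\<in>B. val u < val w \<longrightarrow> pos u < pos w)"
  by (auto simp: chain_def)

lemma chain_flip_imp:
  assumes "chain (\<lambda>u. - val u) (\<lambda>u. - pos u) B" "inj_on val B"
  shows "chain pos val B"
  unfolding chain_def
proof (intro ballI impI)
  fix u w assume uw: "u \<in> B" "w \<in> B" "pos u < pos w"
  then have "\<not> val w < val u" using assms(1) unfolding chain_flip by force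
  moreover have "val u \<noteq> val w" using uw assms(2) by (auto dest: inj_onD)
  ultimately show "val u < val w" by simp
qed

text \<open>
  The entry in place \<open>i\<close> with value \<open>v\<close> of a type of length \<open>t\<close> moves to place \<open>t + 1 - v\<close> and gets the
  value \<open>t + 1 - i\<close>.
\<close>

lemma one_sided_flip:
  assumes o: "one_sided S (\<lambda>u. - val u) (\<lambda>u. - pos u)" and inj: "inj_on val S"
  shows "one_sided_flipped S pos val"
proof -
  have ch: "chain pos val B" if "inflates S (\<lambda>u. - val u) (\<lambda>u. - pos u) \<tau> Bs" "B \<in> set Bs" for \<tau> Bs B
    using that chain_flip_imp[of val pos B] inj unfolding inflates_def by (meson Sup_upper inj_on_subset)

  have "shaped S pos val [2, 4, 1, 5, 3] sizes1" if s: "shaped S (\<lambda>u. - val u) (\<lambda>u. - pos u) [2, 4,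
      1, 5, 3] sizes1"
  proof -
    obtain Bs where i: "inflates S (\<lambda>u. - val u) (\<lambda>u. - pos u) [2, 4, 1, 5, 3] Bs" and c:
        "map card Bs \<in> sizes1"
      using s unfolding shaped_def by blast
    obtain B0 B1 B2 B3 B4 where B: "Bs = [B0, B1, B2, B3, B4]"
      using inflatesD(1)[OF i] by (auto simp: length_Suc_conv)
    have "inflates S pos val [2, 4, 1, 5, 3] [B3, B1, B4, B0, B2]"
      using i ch[OF i] unfolding B inflates_def by (simp add: block_order_def lowleft_flip
          upleft_flip) blast
    moreover have "map card [B3, B1, B4, B0, B2] \<in> sizes1"
      using c unfolding B sizes1_def sizes1_def by auto
    ultimately show ?thesis unfolding shaped_def by blast
  qed
  note flip1 = this
  have "shaped S pos val [2, 5, 1, 6, 4, 3] sizes2" if s: "shaped S (\<lambda>u. - val u) (\<lambda>u. - pos u) [3,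
      5, 2, 1, 6, 4] sizes4"
  proof -
    obtain Bs where i: "inflates S (\<lambda>u. - val u) (\<lambda>u. - pos u) [3, 5, 2, 1, 6, 4] Bs" and c:
        "map card Bs \<in> sizes4"
      using s unfolding shaped_def by blast
    obtain B0 B1 B2 B3 B4 B5 where B: "Bs = [B0, B1, B2, B3, B4, B5]"
      using inflatesD(1)[OF i] by (auto simp: length_Suc_conv)
    have "inflates S pos val [2, 5, 1, 6, 4, 3] [B4, B1, B5, B0, B2, B3]"
      using i ch[OF i] unfolding B inflates_def by (simp add: block_order_def lowleft_flip
          upleft_flip) blast
    moreover have "map card [B4, B1, B5, B0, B2, B3] \<in> sizes2"
      using c unfolding B sizes4_def sizes2_def by auto
    ultimately show ?thesis unfolding shaped_def by blast
  qed
  note flip4 = this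
  have "shaped S pos val [2, 6, 1, 7, 3, 5, 4] sizes3" if s:
      "shaped S (\<lambda>u. - val u) (\<lambda>u. - pos u) [4, 6, 2, 1, 3, 7, 5] sizes5"
  proof -
    obtain Bs where i: "inflates S (\<lambda>u. - val u) (\<lambda>u. - pos u) [4, 6, 2, 1, 3, 7, 5] Bs" and c:
        "map card Bs \<in> sizes5"
      using s unfolding shaped_def by blast
    obtain B0 B1 B2 B3 B4 B5 B6 where B: "Bs = [B0, B1, B2, B3, B4, B5, B6]"
      using inflatesD(1)[OF i] by (auto simp: length_Suc_conv)
    have "inflates S pos val [2, 6, 1, 7, 3, 5, 4] [B5, B1, B6, B0, B4, B2, B3]"
      using i ch[OF i] unfolding B inflates_def by (simp add: block_order_def lowleft_flip
          upleft_flip) blast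
    moreover have "map card [B5, B1, B6, B0, B4, B2, B3] \<in> sizes3"
      using c unfolding B sizes5_def sizes3_def by auto
    ultimately show ?thesis unfolding shaped_def by blast
  qed
  note flip5 = this
  have "shaped S pos val [2, 4, 1, 5, 7, 6, 3] sizes6" if s:
      "shaped S (\<lambda>u. - val u) (\<lambda>u. - pos u) [3, 2, 4, 6, 1, 7, 5] sizes8"
  proof -
    obtain Bs where i: "inflates S (\<lambda>u. - val u) (\<lambda>u. - pos u) [3, 2, 4, 6, 1, 7, 5] Bs" and c:
        "map card Bs \<in> sizes8"
      using s unfolding shaped_def by blast
    obtain B0 B1 B2 B3 B4 B5 B6 where B: "Bs = [B0, B1, B2, B3, B4, B5, B6]"
      using inflatesD(1)[OF i] by (auto simp: length_Suc_conv)
    have "inflates S pos val [2, 4, 1, 5, 7, 6, 3] [B5, B3, B6, B2, B0, B1, B4]"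
      using i ch[OF i] unfolding B inflates_def by (simp add: block_order_def lowleft_flip
          upleft_flip) blast
    moreover have "map card [B5, B3, B6, B2, B0, B1, B4] \<in> sizes6"
      using c unfolding B sizes8_def sizes6_def by auto
    ultimately show ?thesis unfolding shaped_def by blast
  qed
  note flip8 = this
  have "shaped S pos val [2, 4, 1, 6, 5, 3] sizes7" if s: "shaped S (\<lambda>u. - val u) (\<lambda>u. - pos u) [3,
      2, 5, 1, 6, 4] sizes9"
  proof -
    obtain Bs where i: "inflates S (\<lambda>u. - val u) (\<lambda>u. - pos u) [3, 2, 5, 1, 6, 4] Bs" and c:
        "map card Bs \<in> sizes9"
      using s unfolding shaped_def by blast
    obtain B0 B1 B2 B3 B4 B5 where B: "Bs = [B0, B1, B2, B3, B4, B5]"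
      using inflatesD(1)[OF i] by (auto simp: length_Suc_conv)
    have "inflates S pos val [2, 4, 1, 6, 5, 3] [B4, B2, B5, B0, B1, B3]"
      using i ch[OF i] unfolding B inflates_def by (simp add: block_order_def lowleft_flip
          upleft_flip) blast
    moreover have "map card [B4, B2, B5, B0, B1, B3] \<in> sizes7"
      using c unfolding B sizes9_def sizes7_def by auto
    ultimately show ?thesis unfolding shaped_def by blast
  qed
  note flip9 = this
  show ?thesis
    using o flip1 flip4 flip5 flip8 flip9 unfolding one_sided_def one_sided_flipped_def by blast
qed

lemma residual_points_crossing:
  assumes r: "residual_points S pos val" and fin: "finite S" and inj: "inj_on pos S" "inj_on val S"
  obtains a b c d where "crossing S pos val a b c d"
proof -
  have few: "card (invs pos val S) + 5 = 2 * card S" using r by (simp add: residual_points_def)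
  then have "S \<noteq> {}" by auto
  then have ne: "pos ` S \<noteq> {}" "val ` S \<noteq> {}" by auto
  have fi: "finite (pos ` S)" "finite (val ` S)" using fin by auto
  obtain a where a: "a \<in> S" "pos a = Min (pos ` S)" using Min_in[OF fi(1) ne(1)] by auto
  obtain b where b: "b \<in> S" "pos b = Max (pos ` S)" using Max_in[OF fi(1) ne(1)] by auto
  obtain c where c: "c \<in> S" "val c = Min (val ` S)" using Min_in[OF fi(2) ne(2)] by auto
  obtain d where d: "d \<in> S" "val d = Max (val ` S)" using Max_in[OF fi(2) ne(2)] by auto
  have ext: "\<forall>u\<in>S. pos a \<le> pos u" "\<forall>u\<in>S. pos u \<le> pos b" "\<forall>u\<in>S. val c \<le> val u" "\<forall>u\<in>S. val u \<le> val d"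
    using a b c d fi by auto
  have del: "conn pos val (S - {x})" if "x \<in> {a, b, c, d}" for x
    using r ext that a(1) b(1) c(1) d(1) unfolding residual_points_def by blast
  have "crossing S pos val a b c d"
    by unfold_locales (use fin inj a(1) b(1) c(1) d(1) ext r few del in \<open>auto simp: residual_points_def\<close>)
  then show thesis by (rule that)
qed

lemma residual_points_shapes:
  assumes r: "residual_points S pos val" and fin: "finite S" and inj: "inj_on pos S" "inj_on val S"
  shows "one_sided S pos val \<or> one_sided_flipped S pos val \<or> one_sided S val pos \<or>
      one_sided_flipped S val pos \<or>
   shaped S pos val [3, 5, 1, 6, 2, 4] sizes10 \<or> shaped S pos val [3, 5, 1, 7, 2, 6, 4] sizes11 \<or>
   shaped S pos val [4, 2, 6, 1, 7, 3, 5] sizes12"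
proof -
  obtain a b c d where "crossing S pos val a b c d" by (rule residual_points_crossing[OF assms])
  from crossing.crossing_shapes[OF this] show ?thesis using one_sided_flip inj by blast
qed

lemma inflates_valid_sizes:
  assumes i: "inflates S pos val \<tau> Bs" and r: "residual_points S pos val" and fin: "finite S"
  shows "valid_sizes \<tau> (map card Bs)"
proof -
  have l: "length Bs = length \<tau>" by (rule inflatesD(1)[OF i])
  have "1 \<le> card B" if "B \<in> set Bs" for B
  proof -
    have "B \<subseteq> S" "B \<noteq> {}" using i that unfolding inflates_def by blast+
    then show ?thesis using fin by (simp add: Suc_le_eq card_gt_0_iff finite_subset)
  qed
  moreover have "sum_list (map card Bs) = card S"
  proof -
    have "S = (\<Union>j\<in>{..<length \<tau>}. Bs ! j)" using i l unfolding inflates_def by (auto simp: set_conv_nth)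
    moreover have "card (\<Union>j\<in>{..<length \<tau>}. Bs ! j) = (\<Sum>j<length \<tau>. card (Bs ! j))"
        by (rule card_blocks[OF i fin]) simp
    ultimately show ?thesis using l by (simp add: sum_list_sum_nth atLeast0LessThan)
  qed
  ultimately show ?thesis
    unfolding valid_sizes_def using card_invs_inflates[OF i fin] r by (auto simp: residual_points_def)
qed

text \<open>
  The list \<open>\<pi>\<close> is left abstract here because the lemma is applied both to a residual and, with the two
  orders exchanged, to its inverse.
\<close>

lemma shaped_inflation:
  fixes n :: nat
  assumes r: "residual_points {1..n} pos val"
    and recognition: "\<And>\<tau> Bs. inflates {1..n} pos val \<tau> Bs \<Longrightarrow> distinct \<tau> \<Longrightarrow> \<pi> = iota_inflation \<tau> (map card Bs)"
    and s: "shaped {1..n} pos val \<tau> sizes" and d: "distinct \<tau>"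
    and p: "\<And>bs. bs \<in> sizes \<Longrightarrow> valid_sizes \<tau> bs \<Longrightarrow> bs \<in> params"
  shows "\<pi> \<in> iota_inflation \<tau> ` params"
proof -
  obtain Bs where i: "inflates {1..n} pos val \<tau> Bs" and c: "map card Bs \<in> sizes"
    using s unfolding shaped_def by blast
  have "map card Bs \<in> params" using p[OF c] inflates_valid_sizes[OF i r] by simp
  then show ?thesis using recognition[OF i d] by blast
qed

lemma shaped_families:
  fixes n :: nat
  assumes "residual_points {1..n} pos val"
    and "\<And>\<tau> Bs. inflates {1..n} pos val \<tau> Bs \<Longrightarrow> distinct \<tau> \<Longrightarrow> \<pi> = iota_inflation \<tau> (map card Bs)"
  shows
    "shaped {1..n} pos val [2, 4, 1, 5, 3] sizes1 \<Longrightarrow> \<pi> \<in> family1"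
    "shaped {1..n} pos val [2, 5, 1, 6, 4, 3] sizes2 \<Longrightarrow> \<pi> \<in> family2"
    "shaped {1..n} pos val [2, 6, 1, 7, 3, 5, 4] sizes3 \<Longrightarrow> \<pi> \<in> family3"
    "shaped {1..n} pos val [3, 5, 2, 1, 6, 4] sizes4 \<Longrightarrow> \<pi> \<in> family4"
    "shaped {1..n} pos val [4, 6, 2, 1, 3, 7, 5] sizes5 \<Longrightarrow> \<pi> \<in> family5"
    "shaped {1..n} pos val [2, 4, 1, 5, 7, 6, 3] sizes6 \<Longrightarrow> \<pi> \<in> family6"
    "shaped {1..n} pos val [2, 4, 1, 6, 5, 3] sizes7 \<Longrightarrow> \<pi> \<in> family7"
    "shaped {1..n} pos val [3, 2, 4, 6, 1, 7, 5] sizes8 \<Longrightarrow> \<pi> \<in> family8"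
    "shaped {1..n} pos val [3, 2, 5, 1, 6, 4] sizes9 \<Longrightarrow> \<pi> \<in> family9"
    "shaped {1..n} pos val [3, 5, 1, 6, 2, 4] sizes10 \<Longrightarrow> \<pi> \<in> family10"
    "shaped {1..n} pos val [3, 5, 1, 7, 2, 6, 4] sizes11 \<Longrightarrow> \<pi> \<in> family11"
    "shaped {1..n} pos val [4, 2, 6, 1, 7, 3, 5] sizes12 \<Longrightarrow> \<pi> \<in> family12"
  unfolding families_as_inflations
  by ((rule shaped_inflation[OF assms], assumption+, simp, erule (1) sizes_valid_params)+)

definition straight_families :: "nat list set" where
  "straight_families = family1 \<union> family2 \<union> family3 \<union> family4 \<union> family5 \<union> family6 \<union> family7 \<union> family8
      \<union> family9"

definition symmetric_families :: "nat list set" where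
  "symmetric_families = family10 \<union> family11 \<union> family12"

lemma residual_in_families:
  assumes "\<pi> \<in> residuals 2 n"
  shows "\<pi> \<in> straight_families \<union> symmetric_families \<union> perm_inverse ` straight_families"
proof -
  have \<pi>: "\<pi> \<in> permutations_of_set {1..n}" and r: "residual_points {1..n} (pl \<pi>) int"
    using assms unfolding residuals_2_iff by blast+
  have inj: "inj_on (pl \<pi>) {1..n}"
  proof (rule inj_onI)
    fix u w assume "u \<in> {1..n}" "w \<in> {1..n}" "pl \<pi> u = pl \<pi> w"
    then show "u = w" using inj_onD[OF inj_on_place[OF permD(1)[OF \<pi>]], of u w] permD(2)[OF \<pi>] by simp
  qed
  let ?\<rho> = "perm_inverse \<pi>"
  have \<rho>: "?\<rho> \<in> permutations_of_set {1..n}" "\<pi> = perm_inverse ?\<rho>" using perm_inverse_facts[OF \<pi>] by auto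
  note S = shaped_families[OF r iota_inflation_recognition[OF \<pi>]]
  note S' = shaped_families[OF residual_points_swap[OF r] perm_inverse_recognition[OF \<pi>]]
  have "one_sided {1..n} (pl \<pi>) int \<Longrightarrow> \<pi> \<in> straight_families"
    "one_sided_flipped {1..n} (pl \<pi>) int \<Longrightarrow> \<pi> \<in> straight_families"
    unfolding one_sided_def one_sided_flipped_def straight_families_def using S by blast+
  moreover have "one_sided {1..n} int (pl \<pi>) \<Longrightarrow> ?\<rho> \<in> straight_families"
    "one_sided_flipped {1..n} int (pl \<pi>) \<Longrightarrow> ?\<rho> \<in> straight_families"
    unfolding one_sided_def one_sided_flipped_def straight_families_def using S' by blast+
  moreover note residual_points_shapes[OF r finite_atLeastAtMost inj inj_on_of_nat]
  ultimately have "\<pi> \<in> straight_families \<union> symmetric_families \<or> ?\<rho> \<in> straight_families"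
    using S(10-12) unfolding symmetric_families_def by blast
  then show ?thesis using image_eqI[where f = perm_inverse and x = ?\<rho>, OF \<rho>(2)] by blast
qed

lemma params_residual:
  assumes \<pi>: "iota_inflation \<tau> bs \<in> permutations_of_set {1..n}"
    and v: "valid_sizes \<tau> bs \<and> length bs = length \<tau>" and \<tau>: "residual_type \<tau>" and r: "robust \<tau> bs"
  shows "iota_inflation \<tau> bs \<in> residuals 2 n"
proof -
  have "iota_inflation \<tau> bs \<in> residuals 2 (sum_list bs)"
  proof (rule residual_inflation[of \<tau> "length \<tau>"])
  show "\<tau> \<in> permutations_of_set {1..length \<tau>}" "3 \<le> length \<tau>" "avoids_1324 \<tau>" "\<not> splits \<tau>"
    using \<tau> unfolding residual_type_def by blast+
  show "length bs = length \<tau>" using v by blast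
  show "\<And>b. b \<in> set bs \<Longrightarrow> 1 \<le> b" "inflation_inversions (zip \<tau> bs) + 5 = 2 * sum_list bs"
    using v unfolding valid_sizes_def by blast+
  show "2 \<le> bs ! i \<or> \<not> splits (take i \<tau> @ drop (Suc i) \<tau>)"
    if "i < length \<tau>" "i = 0 \<or> i = length \<tau> - 1 \<or> \<tau> ! i = 1 \<or> \<tau> ! i = length \<tau>" for i
  proof -
    have "i \<in> set [0..<length \<tau>]" using that(1) by simp
    then show ?thesis using r that(2) unfolding robust_def by blast
  qed
qed
  moreover have "sum_list bs = n"
  proof -
    have "iota_inflation \<tau> bs \<in> permutations_of_set {1..sum_list bs}" using calculation
        unfolding residuals_2_iff by blast
    then show ?thesis using permD(3)[OF \<pi>] permD(3) by metis
  qed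
  ultimately show ?thesis by simp
qed

lemma families_residual:

  assumes "\<pi> \<in> permutations_of_set {1..n}"
  shows
  "\<pi> \<in> family1 \<Longrightarrow> \<pi> \<in> residuals 2 n"
  "\<pi> \<in> family2 \<Longrightarrow> \<pi> \<in> residuals 2 n"
  "\<pi> \<in> family3 \<Longrightarrow> \<pi> \<in> residuals 2 n"
  "\<pi> \<in> family4 \<Longrightarrow> \<pi> \<in> residuals 2 n"
  "\<pi> \<in> family5 \<Longrightarrow> \<pi> \<in> residuals 2 n"
  "\<pi> \<in> family6 \<Longrightarrow> \<pi> \<in> residuals 2 n"
  "\<pi> \<in> family7 \<Longrightarrow> \<pi> \<in> residuals 2 n"
  "\<pi> \<in> family8 \<Longrightarrow> \<pi> \<in> residuals 2 n"
  "\<pi> \<in> family9 \<Longrightarrow> \<pi> \<in> residuals 2 n"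
  "\<pi> \<in> family10 \<Longrightarrow> \<pi> \<in> residuals 2 n"
  "\<pi> \<in> family11 \<Longrightarrow> \<pi> \<in> residuals 2 n"
  "\<pi> \<in> family12 \<Longrightarrow> \<pi> \<in> residuals 2 n"
  unfolding families_as_inflations
  by (insert assms, elim imageE, hypsubst, rule params_residual, assumption,
      erule params_valid[THEN bspec], rule residual_types, erule params_robust)+

lemma perm_inverse_inflation:
  assumes \<tau>: "residual_type \<tau>" and l: "length bs = length \<tau>" and pos: "\<forall>b\<in>set bs. 1 \<le> b"
  shows "perm_inverse (iota_inflation \<tau> bs) = iota_inflation (perm_inverse \<tau>) (map (\<lambda>s. bs ! (s -
      1)) (perm_inverse \<tau>))"
proof -
  have "\<tau> \<in> permutations_of_set {1..length \<tau>}" using \<tau> by (simp add: residual_type_def)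
  from perm_inverse_iota_inflation[OF this l] pos show ?thesis
    by (simp add: perm_inverse_place comp_def del: upt_Suc)
qed

lemma params_permutation:
  assumes "valid_sizes \<tau> bs \<and> length bs = length \<tau>" "residual_type \<tau>"
  shows "\<exists>n. iota_inflation \<tau> bs \<in> permutations_of_set {1..n}"
  using iota_inflation_inflates(1)[of \<tau> bs] assms permD(1)[of \<tau>]
      unfolding valid_sizes_def residual_type_def by blast

lemma families_permutations:

  "\<pi> \<in> family1 \<Longrightarrow> \<exists>n. \<pi> \<in> permutations_of_set {1..n}"
  "\<pi> \<in> family2 \<Longrightarrow> \<exists>n. \<pi> \<in> permutations_of_set {1..n}"
  "\<pi> \<in> family3 \<Longrightarrow> \<exists>n. \<pi> \<in> permutations_of_set {1..n}"
  "\<pi> \<in> family4 \<Longrightarrow> \<exists>n. \<pi> \<in> permutations_of_set {1..n}"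
  "\<pi> \<in> family5 \<Longrightarrow> \<exists>n. \<pi> \<in> permutations_of_set {1..n}"
  "\<pi> \<in> family6 \<Longrightarrow> \<exists>n. \<pi> \<in> permutations_of_set {1..n}"
  "\<pi> \<in> family7 \<Longrightarrow> \<exists>n. \<pi> \<in> permutations_of_set {1..n}"
  "\<pi> \<in> family8 \<Longrightarrow> \<exists>n. \<pi> \<in> permutations_of_set {1..n}"
  "\<pi> \<in> family9 \<Longrightarrow> \<exists>n. \<pi> \<in> permutations_of_set {1..n}"
  "\<pi> \<in> family10 \<Longrightarrow> \<exists>n. \<pi> \<in> permutations_of_set {1..n}"
  "\<pi> \<in> family11 \<Longrightarrow> \<exists>n. \<pi> \<in> permutations_of_set {1..n}"
  "\<pi> \<in> family12 \<Longrightarrow> \<exists>n. \<pi> \<in> permutations_of_set {1..n}"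
  unfolding families_as_inflations
  by (elim imageE, hypsubst, rule params_permutation, erule params_valid[THEN bspec], rule residual_types)+

text \<open>
  Inversion permutes the blocks, and the resulting size lists only exchange \<open>x\<close> with \<open>y\<close> and \<open>z\<close> with
  \<open>w\<close> in the parametrization.
\<close>

lemma self_inverse_families:
  "perm_inverse ` family10 = family10" "perm_inverse ` family11 = family11"
      "perm_inverse ` family12 = family12"
proof -
  have involution: "perm_inverse ` F = F"
    if "\<And>\<pi>. \<pi> \<in> F \<Longrightarrow> perm_inverse \<pi> \<in> F" "\<And>\<pi>. \<pi> \<in> F \<Longrightarrow> \<exists>n. \<pi> \<in> permutations_of_set {1..n}" for F

  proof (rule set_eqI, rule iffI)
    fix \<pi> assume "\<pi> \<in> F"
    then have "perm_inverse \<pi> \<in> F" "perm_inverse (perm_inverse \<pi>) = \<pi>"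
        using that perm_inverse_facts(3) by blast+
    then show "\<pi> \<in> perm_inverse ` F" by (metis imageI)
  qed (use that(1) in blast)
  show "perm_inverse ` family10 = family10"
  proof (rule involution[OF _ families_permutations(10)])
    fix \<pi> assume "\<pi> \<in> family10"
    then obtain bs where \<pi>: "\<pi> = iota_inflation [3, 5, 1, 6, 2, 4] bs" "bs \<in> params10"
      unfolding families_as_inflations by blast
    then have v: "valid_sizes [3, 5, 1, 6, 2, 4] bs" "length bs = length [3, 5, 1, 6, 2, 4]"
        using params_valid(10) by auto
    obtain x y z w where bs: "bs = [x + 1, 1, y + 1, z + 1, 1, w + 1]" "x * y = 0 \<and> z * w = 0"
        using \<pi>(2) unfolding params10_def by blast
    have "perm_inverse \<pi> = iota_inflation [3, 5, 1, 6, 2, 4] [y + 1, 1, x + 1, w + 1, 1, z + 1]"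
      using perm_inverse_inflation[OF residual_types(10) v(2)] v(1)
      unfolding \<pi>(1) inverse_types valid_sizes_def bs(1) by simp
    moreover have "[y + 1, 1, x + 1, w + 1, 1, z + 1] \<in> params10"
      unfolding params10_def using bs(2) by - (rule CollectI, rule exI[of _ y], rule exI[of _ x],
          rule exI[of _ w], rule exI[of _ z], simp add: mult.commute)
    ultimately show "perm_inverse \<pi> \<in> family10" unfolding families_as_inflations by blast
  qed
  show "perm_inverse ` family11 = family11"
  proof (rule involution[OF _ families_permutations(11)])
    fix \<pi> assume "\<pi> \<in> family11"
    then obtain bs where \<pi>: "\<pi> = iota_inflation [3, 5, 1, 7, 2, 6, 4] bs" "bs \<in> params11"
      unfolding families_as_inflations by blast
    then have v: "valid_sizes [3, 5, 1, 7, 2, 6, 4] bs" "length bs = length [3, 5, 1, 7, 2, 6, 4]"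
        using params_valid(11) by auto
    obtain x y z where bs: "bs = [x + 1, 1, y + 1, 1, 1, z + 1, 1]" "x * y = 0" using \<pi>(2)
        unfolding params11_def by blast
    have "perm_inverse \<pi> = iota_inflation [3, 5, 1, 7, 2, 6, 4] [y + 1, 1, x + 1, 1, 1, z + 1, 1]"
      using perm_inverse_inflation[OF residual_types(11) v(2)] v(1)
      unfolding \<pi>(1) inverse_types valid_sizes_def bs(1) by simp
    moreover have "[y + 1, 1, x + 1, 1, 1, z + 1, 1] \<in> params11"
      unfolding params11_def using bs(2) by - (rule CollectI, rule exI[of _ y], rule exI[of _ x],
          rule exI[of _ z], simp add: mult.commute)
    ultimately show "perm_inverse \<pi> \<in> family11" unfolding families_as_inflations by blast
  qed
  show "perm_inverse ` family12 = family12"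
  proof (rule involution[OF _ families_permutations(12)])
    fix \<pi> assume "\<pi> \<in> family12"
    then obtain bs where \<pi>: "\<pi> = iota_inflation [4, 2, 6, 1, 7, 3, 5] bs" "bs \<in> params12"
      unfolding families_as_inflations by blast
    then have v: "valid_sizes [4, 2, 6, 1, 7, 3, 5] bs" "length bs = length [4, 2, 6, 1, 7, 3, 5]"
        using params_valid(12) by auto
    obtain x y z where bs: "bs = [1, z + 1, 1, 1, x + 1, 1, y + 1]" "x * y = 0" using \<pi>(2)
        unfolding params12_def by blast
    have "perm_inverse \<pi> = iota_inflation [4, 2, 6, 1, 7, 3, 5] [1, z + 1, 1, 1, y + 1, 1, x + 1]"
      using perm_inverse_inflation[OF residual_types(12) v(2)] v(1)
      unfolding \<pi>(1) inverse_types valid_sizes_def bs(1) by simp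
    moreover have "[1, z + 1, 1, 1, y + 1, 1, x + 1] \<in> params12"
      unfolding params12_def using bs(2) by - (rule CollectI, rule exI[of _ y], rule exI[of _ x],
          rule exI[of _ z], simp add: mult.commute)
    ultimately show "perm_inverse \<pi> \<in> family12" unfolding families_as_inflations by blast
  qed
qed

lemma residuals_eq_families:
  "residuals 2 n = permutations_of_set {1..n} \<inter>
    (straight_families \<union> symmetric_families \<union> perm_inverse ` straight_families)"
proof (rule set_eqI, rule iffI)
  fix \<pi> assume \<pi>: "\<pi> \<in> residuals 2 n"
  then show "\<pi> \<in> permutations_of_set {1..n} \<inter>
      (straight_families \<union> symmetric_families \<union> perm_inverse ` straight_families)"
    using residual_in_families[OF \<pi>] unfolding residuals_2_iff by blast
next
  fix \<pi> assume \<pi>: "\<pi> \<in> permutations_of_set {1..n} \<inter>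
      (straight_families \<union> symmetric_families \<union> perm_inverse ` straight_families)"
  have direct: "\<rho> \<in> residuals 2 m"
    if "\<rho> \<in> permutations_of_set {1..m}" "\<rho> \<in> straight_families \<union> symmetric_families" for \<rho> m
    using that(2) unfolding straight_families_def symmetric_families_def
    by (elim UnE; elim families_residual[OF that(1)])
  show "\<pi> \<in> residuals 2 n"
  proof (cases "\<pi> \<in> straight_families \<union> symmetric_families")
    case True
    then show ?thesis using direct \<pi> by blast
  next
    case False
    then obtain \<rho> where \<rho>: "\<pi> = perm_inverse \<rho>" "\<rho> \<in> straight_families" using \<pi> by blast
    have "\<exists>m. \<rho> \<in> permutations_of_set {1..m}"
      using \<rho>(2) unfolding straight_families_def by (elim UnE; elim families_permutations)
    then obtain m where m: "\<rho> \<in> permutations_of_set {1..m}" by blast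
    then have "m = n" using permD(3)[OF perm_inverse_facts(1)[OF m]] permD(3)[of \<pi> n] \<pi> \<rho>(1) by auto
    then show ?thesis using perm_inverse_residuals[OF direct[OF m]] \<rho> by blast
  qed
qed


section \<open>Counting\<close>

definition inflations :: "nat list \<Rightarrow> nat list set" where
  "inflations \<tau> = {iota_inflation \<tau> bs | bs. length bs = length \<tau> \<and> (\<forall>b\<in>set bs. 1 \<le> b)}"

lemma inflations_disjoint:
  assumes "residual_type \<tau>" "residual_type \<tau>'" "\<tau> \<noteq> \<tau>'"
  shows "inflations \<tau> \<inter> inflations \<tau>' = {}"
proof (rule equals0I)
  fix \<pi> assume "\<pi> \<in> inflations \<tau> \<inter> inflations \<tau>'"
  then obtain bs bs' where "\<pi> = iota_inflation \<tau> bs" "length bs = length \<tau>" "\<forall>b\<in>set bs. 1 \<le> b"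
    "\<pi> = iota_inflation \<tau>' bs'" "length bs' = length \<tau>'" "\<forall>b\<in>set bs'. 1 \<le> b"
    unfolding inflations_def by blast
  then show False
    using iota_inflation_inject[of \<tau> "length \<tau>" bs \<tau>' "length \<tau>'" bs'] assms
        unfolding residual_type_def by auto
qed

text \<open>
  Inflations of different types are different, so the cardinalities add up.
\<close>

lemma card_Union_inflations:
  assumes "distinct (map fst L)"
    "\<forall>p\<in>set L. residual_type (fst p) \<and> snd p \<subseteq> inflations (fst p) \<and> finite (snd p)"
  shows "card (\<Union> (snd ` set L)) = (\<Sum>(\<tau>, X)\<leftarrow>L. card X)"
  using assms
proof (induction L)
  case (Cons p L)
  obtain \<tau> X where p: "p = (\<tau>, X)" by (cases p)
  have X: "residual_type \<tau>" "X \<subseteq> inflations \<tau>" "finite X" using Cons.prems(2) p by auto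
  have IH: "card (\<Union> (snd ` set L)) = (\<Sum>(\<tau>, X)\<leftarrow>L. card X)" using Cons by auto
  have "X \<inter> Y = {}" if "(\<tau>', Y) \<in> set L" for \<tau>' Y
  proof -
    have "\<tau> \<noteq> \<tau>'" using Cons.prems(1) that p by force
    moreover have "residual_type \<tau>'" "Y \<subseteq> inflations \<tau>'"
      using bspec[OF Cons.prems(2), of "(\<tau>', Y)"] that by simp_all
    ultimately show ?thesis using inflations_disjoint[OF X(1), of \<tau>'] X(2) by blast
  qed
  then have "X \<inter> \<Union> (snd ` set L) = {}" by force
  moreover have "finite (\<Union> (snd ` set L))" using Cons.prems(2) by force
  ultimately show ?case using IH X(3) p by (simp add: card_Un_disjoint)
qed simp

lemma card_family_of_size:
  assumes \<tau>: "residual_type \<tau>" and P: "\<forall>bs\<in>P. valid_sizes \<tau> bs \<and> length bs = length \<tau>"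
  shows "card (permutations_of_set {1..n} \<inter> iota_inflation \<tau> ` P) = card {bs \<in> P. sum_list bs = n}"
    "iota_inflation \<tau> ` P \<subseteq> inflations \<tau>"
    "perm_inverse ` iota_inflation \<tau> ` P \<subseteq> inflations (perm_inverse \<tau>)"
    "card (permutations_of_set {1..n} \<inter> perm_inverse ` iota_inflation \<tau> ` P) =
      card (permutations_of_set {1..n} \<inter> iota_inflation \<tau> ` P)"
proof -
  have pos: "\<And>b. b \<in> set bs \<Longrightarrow> 1 \<le> b" "length bs = length \<tau>" if "bs \<in> P" for bs
    using bspec[OF P that] unfolding valid_sizes_def by blast+
  have t: "\<tau> \<in> permutations_of_set {1..length \<tau>}" "distinct \<tau>" "reduced \<tau>"
    using \<tau> permD(1)[of \<tau>] unfolding residual_type_def by blast+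
  have perm: "iota_inflation \<tau> bs \<in> permutations_of_set {1..sum_list bs}" if "bs \<in> P" for bs
    using iota_inflation_inflates(1)[OF t(2) pos(2)[OF that] pos(1)[OF that]] by blast
  have size: "iota_inflation \<tau> bs \<in> permutations_of_set {1..n} \<longleftrightarrow> sum_list bs = n" if "bs \<in> P" for bs
    using perm[OF that] permD(3)[OF perm[OF that]] permD(3)[of "iota_inflation \<tau> bs" n] by auto
  have "permutations_of_set {1..n} \<inter> iota_inflation \<tau> ` P = iota_inflation \<tau> ` {bs \<in> P. sum_list bs = n}"
    using size by auto
  moreover have "inj_on (iota_inflation \<tau>) {bs \<in> P. sum_list bs = n}"
  proof (rule inj_onI)
    fix bs bs' assume b: "bs \<in> {bs \<in> P. sum_list bs = n}" "bs' \<in> {bs \<in> P. sum_list bs = n}"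
      "iota_inflation \<tau> bs = iota_inflation \<tau> bs'"
    then have "bs \<in> P" "bs' \<in> P" by auto
    from iota_inflation_inject[OF t(1,3) pos(2,1)[OF this(1)] t(1,3) pos(2,1)[OF this(2)] b(3)]
    show "bs = bs'" by blast
  qed
  ultimately show "card (permutations_of_set {1..n} \<inter> iota_inflation \<tau> ` P) = card {bs \<in> P. sum_list
      bs = n}"
    by (simp add: card_image)
  show "iota_inflation \<tau> ` P \<subseteq> inflations \<tau>" unfolding inflations_def using pos by blast
  show "perm_inverse ` iota_inflation \<tau> ` P \<subseteq> inflations (perm_inverse \<tau>)"
  proof clarify
    fix bs assume b: "bs \<in> P"
    have s: "s \<in> set (perm_inverse \<tau>) \<Longrightarrow> s - 1 < length bs" for s
      using permD(2)[OF perm_inverse_facts(1)[OF t(1)]] pos(2)[OF b] by auto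
    have "perm_inverse (iota_inflation \<tau> bs) = iota_inflation (perm_inverse \<tau>) (map (\<lambda>s. bs ! (s -
        1)) (perm_inverse \<tau>))"
      by (rule perm_inverse_inflation[OF \<tau> pos(2)[OF b]]) (use pos(1)[OF b] in blast)
    moreover have "\<forall>b\<in>set (map (\<lambda>s. bs ! (s - 1)) (perm_inverse \<tau>)). 1 \<le> b"
      using pos(1)[OF b] s nth_mem by (metis (no_types, lifting) imageE list.set_map)
    moreover have "length (map (\<lambda>s. bs ! (s - 1)) (perm_inverse \<tau>)) = length (perm_inverse \<tau>)" by simp
    ultimately show "perm_inverse (iota_inflation \<tau> bs) \<in> inflations (perm_inverse \<tau>)"
      unfolding inflations_def by blast
  qed
  have "permutations_of_set {1..n} \<inter> perm_inverse ` iota_inflation \<tau> ` P =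
      perm_inverse ` (permutations_of_set {1..n} \<inter> iota_inflation \<tau> ` P)"
  proof (rule set_eqI, rule iffI)
    fix \<pi> assume "\<pi> \<in> permutations_of_set {1..n} \<inter> perm_inverse ` iota_inflation \<tau> ` P"
    then obtain bs where b: "bs \<in> P" "\<pi> = perm_inverse (iota_inflation \<tau> bs)"
        "\<pi> \<in> permutations_of_set {1..n}" by blast
    have "iota_inflation \<tau> bs = perm_inverse \<pi>" using perm_inverse_facts(3)[OF perm[OF b(1)]] b(2) by simp
    then have "iota_inflation \<tau> bs \<in> permutations_of_set {1..n}"
        using perm_inverse_facts(1)[OF b(3)] by simp
    then show "\<pi> \<in> perm_inverse ` (permutations_of_set {1..n} \<inter> iota_inflation \<tau> ` P)" using b by blast
  qed (use perm_inverse_facts(1) in blast)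
  moreover have "inj_on perm_inverse (permutations_of_set {1..n} \<inter> iota_inflation \<tau> ` P)"
    by (rule inj_on_inverseI[of _ perm_inverse]) (use perm_inverse_facts(3) in blast)
  ultimately show "card (permutations_of_set {1..n} \<inter> perm_inverse ` iota_inflation \<tau> ` P) =
      card (permutations_of_set {1..n} \<inter> iota_inflation \<tau> ` P)"
    by (simp add: card_image)
qed

text \<open>
  One of \<open>x\<close>, \<open>y\<close> is zero, and \<open>z\<close> is determined by the other.
\<close>

lemma card_one_product:
  shows "finite {(x :: nat, y :: nat, z :: nat). x * y = 0 \<and> x + y + z = N}"
    "card {(x :: nat, y :: nat, z :: nat). x * y = 0 \<and> x + y + z = N} = 2 * N + 1"
proof -
  let ?A = "(\<lambda>i. (i, 0 :: nat, N - i)) ` {0..N}" and ?B = "(\<lambda>i. (0 :: nat, i, N - i)) ` {1..N}"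
  have eq: "{(x :: nat, y :: nat, z :: nat). x * y = 0 \<and> x + y + z = N} = ?A \<union> ?B"
  proof (rule set_eqI, rule iffI)
    fix p :: "nat \<times> nat \<times> nat" assume p: "p \<in> {(x, y, z). x * y = 0 \<and> x + y + z = N}"
    obtain x y z where e: "p = (x, y, z)" by (cases p)
    show "p \<in> ?A \<union> ?B"
    proof (cases "y = 0")
      case True
      then show ?thesis using p e by (intro UnI1 image_eqI[of _ _ x]) auto
    next
      case False
      then show ?thesis using p e by (intro UnI2 image_eqI[of _ _ y]) auto
    qed
  qed auto
  then show "finite {(x :: nat, y :: nat, z :: nat). x * y = 0 \<and> x + y + z = N}" by simp
  have "card ?A = N + 1" "card ?B = N" by (subst card_image; auto simp: inj_on_def)+
  moreover have "?A \<inter> ?B = {}" by auto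
  ultimately show "card {(x :: nat, y :: nat, z :: nat). x * y = 0 \<and> x + y + z = N} = 2 * N + 1"
    unfolding eq by (simp add: card_Un_disjoint)
qed

lemma card_one_product_tight:
  assumes "1 \<le> N"
  shows "card {(x :: nat, y :: nat). x * y = 0 \<and> x + y = N} = 2"
proof -
  have "{(x :: nat, y :: nat). x * y = 0 \<and> x + y = N} = {(0, N), (N, 0)}" by auto
  then show ?thesis using assms by simp
qed

text \<open>
  The quadruples with \<open>w = 0\<close> are counted by \<open>N\<close>, those with \<open>z = 0 < w\<close> by \<open>N - 1\<close> in the preceding
  count.
\<close>

lemma card_two_products:
  assumes "1 \<le> N"
  shows "card {(x :: nat, y :: nat, z :: nat, w :: nat). x * y = 0 \<and> z * w = 0 \<and> x + y + z + w = N} = 4 * N"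
proof -
  let ?T = "\<lambda>N. {(x :: nat, y :: nat, z :: nat). x * y = 0 \<and> x + y + z = N}"
  let ?A = "(\<lambda>(x, y, z). (x, y, z, 0 :: nat)) ` ?T N" and ?B = "(\<lambda>(x, y, z). (x, y, 0 :: nat,
      z + 1)) ` ?T (N - 1)"
  have eq: "{(x :: nat, y :: nat, z :: nat, w :: nat). x * y = 0 \<and> z * w = 0 \<and> x + y + z + w = N} = ?A \<union> ?B"
  proof (rule set_eqI, rule iffI)
    fix p :: "nat \<times> nat \<times> nat \<times> nat" assume p: "p \<in> {(x, y, z, w). x * y = 0 \<and> z * w = 0 \<and>
        x + y + z + w = N}"
    obtain x y z w where e: "p = (x, y, z, w)" by (cases p)
    show "p \<in> ?A \<union> ?B"
    proof (cases "w = 0")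
      case True
      then show ?thesis using p e by (intro UnI1 image_eqI[of _ _ "(x, y, z)"]) auto
    next
      case False
      then show ?thesis using p e by (intro UnI2 image_eqI[of _ _ "(x, y, w - 1)"]) auto
    qed
  qed (use assms in auto)
  have "card ?A = card (?T N)" "card ?B = card (?T (N - 1))"
    by (rule card_image, auto simp: inj_on_def)+
  moreover have "?A \<inter> ?B = {}" by auto
  ultimately show ?thesis
    unfolding eq using assms card_one_product by (subst card_Un_disjoint) auto
qed

text \<open>
  One of the products is \<open>1 * 1\<close> and the other is zero; the bound on \<open>N\<close> makes the four solutions
  different.
\<close>

lemma card_products_sum_1:
  assumes "3 \<le> N"
  shows "card {(x :: nat, y :: nat, z :: nat, w :: nat). x * y + z * w = 1 \<and> x + y + z + w = N} = 4"
proof -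
  have "{(x :: nat, y :: nat, z :: nat, w :: nat). x * y + z * w = 1 \<and> x + y + z + w = N} =
    {(1, 1, 0, N - 2), (1, 1, N - 2, 0), (0, N - 2, 1, 1), (N - 2, 0, 1, 1)}"
    using assms by (auto simp: add_is_1)
  moreover have "N - 2 \<noteq> 0" using assms by auto
  ultimately show ?thesis by simp
qed

text \<open>
  The constants subtracted from \<open>n\<close> are the lengths of the smallest members of the families.
\<close>

lemma card_params:
  assumes "10 \<le> n"
  shows
    "card {bs \<in> params1. sum_list bs = n} = 4"
    "card {bs \<in> params2. sum_list bs = n} = 2 * (n - 7) + 1"
    "card {bs \<in> params3. sum_list bs = n} = 2 * (n - 8) + 1"
    "card {bs \<in> params4. sum_list bs = n} = 2 * (n - 7) + 1"
    "card {bs \<in> params5. sum_list bs = n} = 2 * (n - 8) + 1"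
    "card {bs \<in> params6. sum_list bs = n} = 2 * (n - 9) + 1"
    "card {bs \<in> params7. sum_list bs = n} = 2"
    "card {bs \<in> params8. sum_list bs = n} = 2 * (n - 9) + 1"
    "card {bs \<in> params9. sum_list bs = n} = 2"
    "card {bs \<in> params10. sum_list bs = n} = 4 * (n - 6)"
    "card {bs \<in> params11. sum_list bs = n} = 2 * (n - 7) + 1"
    "card {bs \<in> params12. sum_list bs = n} = 2 * (n - 7) + 1"
proof -
  have "{bs \<in> params1. sum_list bs = n} = (\<lambda>(x, y, z, w). [x + 1, 1, y + 2, z + 1,
      w + 2]) ` {(x :: nat, y :: nat, z :: nat, w :: nat). x * y + z * w = 1 \<and> x + y + z + w = n - 7}"
    unfolding params1_def using assms by (auto simp: image_iff)
  then show "card {bs \<in> params1. sum_list bs = n} = 4"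
    using assms card_products_sum_1[of "n - 7"] by (simp add: card_image inj_on_def)
  have "{bs \<in> params2. sum_list bs = n} = (\<lambda>(x, y, z). [x + 1, 1, y + 2, z + 1, 1, 1]) ` {(x :: nat,
      y :: nat, z :: nat). x * y = 0 \<and> x + y + z = n - 7}"
    unfolding params2_def using assms by (auto simp: image_iff)
  then show "card {bs \<in> params2. sum_list bs = n} = 2 * (n - 7) + 1"
    using assms card_one_product(2)[of "n - 7"] by (simp add: card_image inj_on_def)
  have "{bs \<in> params3. sum_list bs = n} = (\<lambda>(x, y, z). [x + 1, 1, y + 2, 1, z + 1, 1,
      1]) ` {(x :: nat, y :: nat, z :: nat). x * y = 0 \<and> x + y + z = n - 8}"
    unfolding params3_def using assms by (auto simp: image_iff)
  then show "card {bs \<in> params3. sum_list bs = n} = 2 * (n - 8) + 1"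
    using assms card_one_product(2)[of "n - 8"] by (simp add: card_image inj_on_def)
  have "{bs \<in> params4. sum_list bs = n} = (\<lambda>(x, y, z). [z + 1, 1, 1, 1, x + 1, y + 2]) ` {(x :: nat,
      y :: nat, z :: nat). x * y = 0 \<and> x + y + z = n - 7}"
    unfolding params4_def using assms by (auto simp: image_iff)
  then show "card {bs \<in> params4. sum_list bs = n} = 2 * (n - 7) + 1"
    using assms card_one_product(2)[of "n - 7"] by (simp add: card_image inj_on_def)
  have "{bs \<in> params5. sum_list bs = n} = (\<lambda>(x, y, z). [1, 1, 1, 1, z + 1, x + 1,
      y + 2]) ` {(x :: nat, y :: nat, z :: nat). x * y = 0 \<and> x + y + z = n - 8}"
    unfolding params5_def using assms by (auto simp: image_iff)
  then show "card {bs \<in> params5. sum_list bs = n} = 2 * (n - 8) + 1"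
    using assms card_one_product(2)[of "n - 8"] by (simp add: card_image inj_on_def)
  have "{bs \<in> params6. sum_list bs = n} = (\<lambda>(x, y, z). [x + 1, 1, y + 2, z + 1, 1, 1,
      2]) ` {(x :: nat, y :: nat, z :: nat). x * y = 0 \<and> x + y + z = n - 9}"
    unfolding params6_def using assms by (auto simp: image_iff)
  then show "card {bs \<in> params6. sum_list bs = n} = 2 * (n - 9) + 1"
    using assms card_one_product(2)[of "n - 9"] by (simp add: card_image inj_on_def)
  have "{bs \<in> params7. sum_list bs = n} = (\<lambda>(x, y). [x + 1, 1, y + 2, 1, 1, 2]) ` {(x :: nat,
      y :: nat). x * y = 0 \<and> x + y = n - 8}"
    unfolding params7_def using assms by (auto simp: image_iff)
  then show "card {bs \<in> params7. sum_list bs = n} = 2"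
    using assms card_one_product_tight[of "n - 8"] by (simp add: card_image inj_on_def)
  have "{bs \<in> params8. sum_list bs = n} = (\<lambda>(x, y, z). [1, 1, z + 1, 1, 2, x + 1,
      y + 2]) ` {(x :: nat, y :: nat, z :: nat). x * y = 0 \<and> x + y + z = n - 9}"
    unfolding params8_def using assms by (auto simp: image_iff)
  then show "card {bs \<in> params8. sum_list bs = n} = 2 * (n - 9) + 1"
    using assms card_one_product(2)[of "n - 9"] by (simp add: card_image inj_on_def)
  have "{bs \<in> params9. sum_list bs = n} = (\<lambda>(x, y). [1, 1, 1, 2, x + 1, y + 2]) ` {(x :: nat,
      y :: nat). x * y = 0 \<and> x + y = n - 8}"
    unfolding params9_def using assms by (auto simp: image_iff)
  then show "card {bs \<in> params9. sum_list bs = n} = 2"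
    using assms card_one_product_tight[of "n - 8"] by (simp add: card_image inj_on_def)
  have "{bs \<in> params10. sum_list bs = n} = (\<lambda>(x, y, z, w). [x + 1, 1, y + 1, z + 1, 1,
      w + 1]) ` {(x :: nat, y :: nat, z :: nat, w :: nat). x * y = 0 \<and> z * w = 0 \<and> x + y + z + w = n - 6}"
    unfolding params10_def using assms by (auto simp: image_iff)
  then show "card {bs \<in> params10. sum_list bs = n} = 4 * (n - 6)"
    using assms card_two_products[of "n - 6"] by (simp add: card_image inj_on_def)
  have "{bs \<in> params11. sum_list bs = n} = (\<lambda>(x, y, z). [x + 1, 1, y + 1, 1, 1, z + 1,
      1]) ` {(x :: nat, y :: nat, z :: nat). x * y = 0 \<and> x + y + z = n - 7}"
    unfolding params11_def using assms by (auto simp: image_iff)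
  then show "card {bs \<in> params11. sum_list bs = n} = 2 * (n - 7) + 1"
    using assms card_one_product(2)[of "n - 7"] by (simp add: card_image inj_on_def)
  have "{bs \<in> params12. sum_list bs = n} = (\<lambda>(x, y, z). [1, z + 1, 1, 1, x + 1, 1,
      y + 1]) ` {(x :: nat, y :: nat, z :: nat). x * y = 0 \<and> x + y + z = n - 7}"
    unfolding params12_def using assms by (auto simp: image_iff)
  then show "card {bs \<in> params12. sum_list bs = n} = 2 * (n - 7) + 1"
    using assms card_one_product(2)[of "n - 7"] by (simp add: card_image inj_on_def)
qed

lemma card_residuals:
  assumes "10 \<le> n"
  shows "card (residuals 2 n) = 32 * n - 214"
proof -
  let ?P = "permutations_of_set {1..n}"
  define L where "L = [([2 :: nat, 4, 1, 5, 3], ?P \<inter> family1),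
    ([2, 5, 1, 6, 4, 3], ?P \<inter> family2),
    ([2, 6, 1, 7, 3, 5, 4], ?P \<inter> family3),
    ([3, 5, 2, 1, 6, 4], ?P \<inter> family4),
    ([4, 6, 2, 1, 3, 7, 5], ?P \<inter> family5),
    ([2, 4, 1, 5, 7, 6, 3], ?P \<inter> family6),
    ([2, 4, 1, 6, 5, 3], ?P \<inter> family7),
    ([3, 2, 4, 6, 1, 7, 5], ?P \<inter> family8),
    ([3, 2, 5, 1, 6, 4], ?P \<inter> family9),
    ([3, 5, 1, 6, 2, 4], ?P \<inter> family10),
    ([3, 5, 1, 7, 2, 6, 4], ?P \<inter> family11),
    ([4, 2, 6, 1, 7, 3, 5], ?P \<inter> family12),
    ([3, 1, 5, 2, 4], ?P \<inter> perm_inverse ` family1),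
    ([3, 1, 6, 5, 2, 4], ?P \<inter> perm_inverse ` family2),
    ([3, 1, 5, 7, 6, 2, 4], ?P \<inter> perm_inverse ` family3),
    ([4, 3, 1, 6, 2, 5], ?P \<inter> perm_inverse ` family4),
    ([4, 3, 5, 1, 7, 2, 6], ?P \<inter> perm_inverse ` family5),
    ([3, 1, 7, 2, 4, 6, 5], ?P \<inter> perm_inverse ` family6),
    ([3, 1, 6, 2, 5, 4], ?P \<inter> perm_inverse ` family7),
    ([5, 2, 1, 3, 7, 4, 6], ?P \<inter> perm_inverse ` family8),
    ([4, 2, 1, 6, 3, 5], ?P \<inter> perm_inverse ` family9)]"
  note F1 = card_family_of_size[OF residual_types(1) params_valid(1), folded families_as_inflations,
      unfolded inverse_types]
  note F2 = card_family_of_size[OF residual_types(2) params_valid(2), folded families_as_inflations,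
      unfolded inverse_types]
  note F3 = card_family_of_size[OF residual_types(3) params_valid(3), folded families_as_inflations,
      unfolded inverse_types]
  note F4 = card_family_of_size[OF residual_types(4) params_valid(4), folded families_as_inflations,
      unfolded inverse_types]
  note F5 = card_family_of_size[OF residual_types(5) params_valid(5), folded families_as_inflations,
      unfolded inverse_types]
  note F6 = card_family_of_size[OF residual_types(6) params_valid(6), folded families_as_inflations,
      unfolded inverse_types]
  note F7 = card_family_of_size[OF residual_types(7) params_valid(7), folded families_as_inflations,
      unfolded inverse_types]
  note F8 = card_family_of_size[OF residual_types(8) params_valid(8), folded families_as_inflations,
      unfolded inverse_types]
  note F9 = card_family_of_size[OF residual_types(9) params_valid(9), folded families_as_inflations,
      unfolded inverse_types]
  note F10 = card_family_of_size[OF residual_types(10) params_valid(10),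
      folded families_as_inflations, unfolded inverse_types]
  note F11 = card_family_of_size[OF residual_types(11) params_valid(11),
      folded families_as_inflations, unfolded inverse_types]
  note F12 = card_family_of_size[OF residual_types(12) params_valid(12),
      folded families_as_inflations, unfolded inverse_types]
  have residuals: "residuals 2 n = \<Union> (snd ` set L)"
    unfolding residuals_eq_families straight_families_def symmetric_families_def image_Un L_def
    by (simp only: list.set image_insert image_empty snd_conv Union_insert Union_empty
        Int_Un_distrib Un_assoc Un_empty_right)
  have "\<forall>p\<in>set L. residual_type (fst p) \<and> snd p \<subseteq> inflations (fst p) \<and> finite (snd p)"
    unfolding L_def list.set ball_simps fst_conv snd_conv
    by (intro conjI residual_types TrueI finite_Int disjI1 finite_permutations_of_set finite_atLeastAtMost;
        rule le_infI2, rule F1(2) F2(2) F3(2) F4(2) F5(2) F6(2) F7(2) F8(2) F9(2) F10(2) F11(2)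
            F12(2) F1(3) F2(3) F3(3) F4(3) F5(3) F6(3) F7(3) F8(3) F9(3))
  moreover have "distinct (map fst L)" unfolding L_def by simp
  ultimately have "card (residuals 2 n) = (\<Sum>(\<tau>, X)\<leftarrow>L. card X)"
    unfolding residuals by (intro card_Union_inflations)
  also have "(\<Sum>(\<tau>, X)\<leftarrow>L. card X) = 32 * n - 214"
    unfolding L_def list.map sum_list.Cons sum_list.Nil prod.case
      F1(4) F2(4) F3(4) F4(4) F5(4) F6(4) F7(4) F8(4) F9(4) F1(1) F2(1) F3(1) F4(1) F5(1) F6(1)
          F7(1) F8(1) F9(1) F10(1) F11(1) F12(1) card_params[OF assms]
    using assms by simp
  finally show ?thesis .
qed

theorem theorem4p3:
  shows "(\<forall>n. residuals 2 n =
            permutations_of_set {1..n} \<inter>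
              (family1 \<union> family2 \<union> family3 \<union> family4 \<union> family5 \<union> family6 \<union>
               family7 \<union> family8 \<union> family9 \<union> family10 \<union> family11 \<union> family12 \<union>
               perm_inverse ` family1 \<union> perm_inverse ` family2 \<union> perm_inverse ` family3 \<union>
               perm_inverse ` family4 \<union> perm_inverse ` family5 \<union> perm_inverse ` family6 \<union>
               perm_inverse ` family7 \<union> perm_inverse ` family8 \<union> perm_inverse ` family9))
       \<and> (perm_inverse ` family10 = family10 \<and> perm_inverse ` family11 = family11 \<and>
          perm_inverse ` family12 = family12)
       \<and> (\<forall>n\<ge>10. int (card (residuals 2 n)) = 32 * int n - 214)"
proof (intro conjI allI impI)
  fix n :: nat
  show "residuals 2 n = permutations_of_set {1..n} \<inter>
      (family1 \<union> family2 \<union> family3 \<union> family4 \<union> family5 \<union> family6 \<union>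
       family7 \<union> family8 \<union> family9 \<union> family10 \<union> family11 \<union> family12 \<union>
       perm_inverse ` family1 \<union> perm_inverse ` family2 \<union> perm_inverse ` family3 \<union>
       perm_inverse ` family4 \<union> perm_inverse ` family5 \<union> perm_inverse ` family6 \<union>
       perm_inverse ` family7 \<union> perm_inverse ` family8 \<union> perm_inverse ` family9)"
    unfolding residuals_eq_families straight_families_def symmetric_families_def image_Un
    by (simp only: Un_assoc)
next
  fix n :: nat
  assume "10 \<le> n"
  then show "int (card (residuals 2 n)) = 32 * int n - 214"
    using card_residuals[of n] by simp
qed (rule self_inverse_families)+

end
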